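(* Consider the problem $\min_{x\in\mathbb{R}^n}\frac{\|x\|_1}{\|x\|}$ subject to $q(x)\le0$, where $q=P_1-P_2$ with $P_1:\mathbb{R}^n\to\mathbb{R}$ continuously differentiable with Lipschitz continuous gradient, $P_2:\mathbb{R}^n\to\mathbb{R}$ convex continuous, $\{x:q(x)\le0\}\neq\emptyset$ and $q(0)>0$. Assume that $P_1$ is twice continuously differentiable and that the GMFCQ holds at every point of $\{x:q(x)\le0\}$. Let $\{x^t\}$ be the sequence generated by the algorithm MBA$_{\ell_1/\ell_2}$ (described in the context) and assume that $\{x^t\}$ is bounded. Let $$\widetilde F(x,y,\zeta,w):=\frac{\|x\|_1}{\|x\|}+\delta_{[\widetilde q\le0]}(x,y,\zeta,w)+\delta_{\|\cdot\|\ge\rho}(x),$$ $$\widetilde q(x,y,\zeta,w):=P_1(y)+\langle\nabla P_1(y),x-y\rangle+P_2^*(\zeta)-\langle\zeta,x\rangle+\frac w2\|x-y\|^2,$$ where $\rho>0$ is chosen such that $\{x:q(x)\le0\}\subset\{x:\|x\|>\rho\}$. If $\widetilde F$ is a KL function, then $\{x^t\}$ converges to a Clarke critical point $x^*$ of the problem ($x^*$ is stationary if $q$ is in addition regular at $x^*$). Moreover, if $\widetilde F$ is a KL function with exponent $\theta\in[0,1)$, then the following statements hold: (i) If $\theta=0$, then $\{x^t\}$ converges finitely. (ii) If $\theta\in(0,\frac12]$, then there exist $c_0>0$, $Q_1\in(0,1)$ and a nonnegative integer $\underline t$ such that $\|x^t-x^*\|\le c_0Q_1^t$ for $t>\underline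 t$. (iii) If $\theta\in(\frac12,1)$, then there exist $c_0>0$ and a nonnegative integer $\underline t$ such that $\|x^t-x^*\|\le c_0t^{-\frac{1-\theta}{2\theta-1}}$ for $t>\underline t$.
   Context: Here $(x,y,\zeta,w)\in\mathbb{R}^n\times\mathbb{R}^n\times\mathbb{R}^n\times\mathbb{R}$; $P_2^*(\zeta)=\sup_x\{\langle x,\zeta\rangle-P_2(x)\}$ is the convex conjugate; $\delta_C$ is the indicator function of $C$ ($0$ on $C$, $\infty$ off $C$); $[\widetilde q\le0]=\{(x,y,\zeta,w):\widetilde q(x,y,\zeta,w)\le0\}$; $\delta_{\|\cdot\|\ge\rho}$ is the indicator of $\{x:\|x\|\ge\rho\}$. Algorithm MBA$_{\ell_1/\ell_2}$. Step 0: choose $x^0$ with $q(x^0)\le0$, $\alpha>0$ and $0<l_{\min}<l_{\max}$; set $\omega_0=\|x^0\|_1/\|x^0\|$, $t=0$. Step 1: choose $l_t^0\in[l_{\min},l_{\max}]$ arbitrarily, set $l_t=l_t^0$, and choose $\zeta^t\in\partial P_2(x^t)$. (1a) Let $\widetilde x$ be the minimizer of $$\min_x\ \|x\|_1-\frac{\omega_t}{\|x^t\|}\langle x,x^t\rangle+\frac\alpha2\|x-x^t\|^2\ \ \text{s.t.}\ \ q(x^t)+\langle\nabla P_1(x^t)-\zeta^t,x-x^t\rangle+\frac{l_t}2\|x-x^t\|^2\le0.$$ (1b) If $q(\widetilde x)\le0$, go to Step 2; else replace $l_t$ by $2l_t$ and go to (1a). Step 2: set $x^{t+1}=\widetilde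 x$, $\omega_{t+1}=\|x^{t+1}\|_1/\|x^{t+1}\|$, $\bar l_t:=l_t$; replace $t$ by $t+1$ and go to Step 1. Subdifferentials: for proper closed $h$ and $\bar x\in\mathrm{dom}\,h$, $\widehat\partial h(\bar x)=\{v:\liminf_{x\to\bar x,x\ne\bar x}\frac{h(x)-h(\bar x)-\langle v,x-\bar x\rangle}{\|x-\bar x\|}\ge0\}$; the limiting subdifferential is $\partial h(\bar x)=\{v:\exists\,x^k\to\bar x,\ h(x^k)\to h(\bar x),\ v^k\in\widehat\partial h(x^k),\ v^k\to v\}$ (empty off $\mathrm{dom}\,h$; the classical subdifferential when $h$ is convex); $\mathrm{dom}\,\partial h=\{x:\partial h(x)\ne\emptyset\}$. For locally Lipschitz $h$, the Clarke subdifferential is $\partial^\circ h(\bar x)=\{v:\limsup_{x\to\bar x,\tau\downarrow0}\frac{h(x+\tau w)-h(x)}{\tau}\ge\langle v,w\rangle\ \forall w\}$. A nonempty closed set $C$ is regular at $x\in C$ if $\partial\delta_C(x)=\widehat\partial\delta_C(x)$; a function is regular at a point if its epigraph is regular at the corresponding point of its graph. GMFCQ holds at $x^*$ with $q(x^* )\le0$ if: $q(x^* )=0$ implies $0\notin\partial^\circ q(x^* )$. A point $\bar x$ with $q(\bar x)\le0$ is stationary if $0\in\partial\big(\frac{\|\cdot\|_1}{\|\cdot\|}+\delta_{\{q\le0\}}\big)(\bar x)$; it is a Clarke critical point if there is $\bar\lambda\ge0$ with $0\in\partial\frac{\|\cdot\|_1}{\|\cdot\|}(\bar x)+\bar\lambda\,\partial^\circ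 q(\bar x)$ and $\bar\lambda q(\bar x)=0$. KL property: a proper closed $h$ satisfies the KL property at $\widehat x\in\mathrm{dom}\,\partial h$ if there are $a\in(0,\infty]$, a neighborhood $U$ of $\widehat x$ and a continuous concave $\varphi:[0,a)\to[0,\infty)$ with $\varphi(0)=0$, continuously differentiable on $(0,a)$ with $\varphi'>0$, such that $\varphi'(h(x)-h(\widehat x))\,\mathrm{dist}(0,\partial h(x))\ge1$ for every $x\in U$ with $h(\widehat x)<h(x)<h(\widehat x)+a$. If $\varphi$ can be chosen as $\varphi(\nu)=a_0\nu^{1-\theta}$ with $a_0>0$, $\theta\in[0,1)$, the KL property holds at $\widehat x$ with exponent $\theta$. $h$ is a KL function (resp. KL function with exponent $\theta$) if it satisfies the KL property (resp. with exponent $\theta$) at every point of $\mathrm{dom}\,\partial h$. *)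

theory Defs
  imports "HOL-Analysis.Analysis"
begin

section \<open>Extended-valued functions and subdifferentials\<close>

definition delta_fun :: "'a set \<Rightarrow> 'a \<Rightarrow> ereal" where
  "delta_fun C x = (if x \<in> C then 0 else \<infinity>)"

definition proper_fun :: "('a \<Rightarrow> ereal) \<Rightarrow> bool" where
  "proper_fun h \<longleftrightarrow> (\<forall>x. h x \<noteq> -\<infinity>) \<and> (\<exists>x. h x \<noteq> \<infinity>)"

definition closed_fun :: "('a::topological_space \<Rightarrow> ereal) \<Rightarrow> bool" where
  "closed_fun h \<longleftrightarrow> closed {(x, r::real). h x \<le> ereal r}"

definition convex_conjugate :: "('a::real_inner \<Rightarrow> real) \<Rightarrow> 'a \<Rightarrow> ereal" where
  "convex_conjugate f z = (SUP x. ereal (x \<bullet> z - f x))"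

text \<open>The filter \<^term>\<open>at xb\<close> is punctured, as required in the Frechet subdifferential.\<close>

definition frechet_subdiff :: "('a::euclidean_space \<Rightarrow> ereal) \<Rightarrow> 'a \<Rightarrow> 'a set" where
  "frechet_subdiff h xb =
     {v. \<bar>h xb\<bar> \<noteq> \<infinity> \<and>
         0 \<le> Liminf (at xb)
               (\<lambda>x. (h x - h xb - ereal (v \<bullet> (x - xb))) / ereal (norm (x - xb)))}"

definition limiting_subdiff :: "('a::euclidean_space \<Rightarrow> ereal) \<Rightarrow> 'a \<Rightarrow> 'a set" where
  "limiting_subdiff h xb =
     {v. \<bar>h xb\<bar> \<noteq> \<infinity> \<and>
         (\<exists>X V. X \<longlonglongrightarrow> xb \<and> (\<lambda>k. h (X k)) \<longlonglongrightarrow> h xb \<and>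
                (\<forall>k::nat. V k \<in> frechet_subdiff h (X k)) \<and> V \<longlonglongrightarrow> v)}"

definition dom_subdiff :: "('a::euclidean_space \<Rightarrow> ereal) \<Rightarrow> 'a set" where
  "dom_subdiff h = {x. limiting_subdiff h x \<noteq> {}}"

text \<open>In the limes superior the base point \<open>x\<close> may equal \<open>xb\<close>, hence \<^term>\<open>nhds xb\<close>.\<close>

definition clarke_subdiff :: "('a::euclidean_space \<Rightarrow> real) \<Rightarrow> 'a \<Rightarrow> 'a set" where
  "clarke_subdiff h xb =
     {v. \<forall>w. Limsup (nhds xb \<times>\<^sub>F at_right 0)
               (\<lambda>(x, \<tau>). ereal ((h (x + \<tau> *\<^sub>R w) - h x) / \<tau>)) \<ge> ereal (v \<bullet> w)}"

definition regular_set_at :: "'a::euclidean_space set \<Rightarrow> 'a \<Rightarrow> bool" where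
  "regular_set_at C x \<longleftrightarrow> closed C \<and> x \<in> C \<and>
     limiting_subdiff (delta_fun C) x = frechet_subdiff (delta_fun C) x"

definition regular_fun_at :: "('a::euclidean_space \<Rightarrow> real) \<Rightarrow> 'a \<Rightarrow> bool" where
  "regular_fun_at f x \<longleftrightarrow> regular_set_at (epigraph UNIV f) (x, f x)"

section \<open>The Kurdyka-Lojasiewicz property\<close>

definition desingularizing :: "ereal \<Rightarrow> (real \<Rightarrow> real) \<Rightarrow> bool" where
  "desingularizing a \<phi> \<longleftrightarrow>
     (\<forall>\<nu>\<in>{\<nu>. 0 \<le> \<nu> \<and> ereal \<nu> < a}. 0 \<le> \<phi> \<nu>) \<and>
     continuous_on {\<nu>. 0 \<le> \<nu> \<and> ereal \<nu> < a} \<phi> \<and>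
     concave_on {\<nu>. 0 \<le> \<nu> \<and> ereal \<nu> < a} \<phi> \<and>
     \<phi> 0 = 0 \<and>
     (\<forall>\<nu>\<in>{\<nu>. 0 < \<nu> \<and> ereal \<nu> < a}. \<phi> field_differentiable at \<nu> \<and> 0 < deriv \<phi> \<nu>) \<and>
     continuous_on {\<nu>. 0 < \<nu> \<and> ereal \<nu> < a} (deriv \<phi>)"

text \<open>The distance from the origin is an \<^typ>\<open>ereal\<close>-valued infimum, so that the distance
  to the empty set is \<open>\<infinity>\<close> (\<^const>\<open>infdist\<close> would give 0).\<close>

definition KL_inequality ::
    "('a::euclidean_space \<Rightarrow> ereal) \<Rightarrow> 'a \<Rightarrow> ereal \<Rightarrow> 'a set \<Rightarrow> (real \<Rightarrow> real) \<Rightarrow> bool" where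
  "KL_inequality h xh a U \<phi> \<longleftrightarrow>
     (\<forall>x\<in>U. h xh < h x \<and> h x < h xh + a \<longrightarrow>
        1 \<le> ereal (deriv \<phi> (real_of_ereal (h x - h xh))) *
             (INF v\<in>limiting_subdiff h x. ereal (dist 0 v)))"

definition KL_property_via ::
    "('a::euclidean_space \<Rightarrow> ereal) \<Rightarrow> 'a \<Rightarrow> ereal \<Rightarrow> (real \<Rightarrow> real) \<Rightarrow> bool" where
  "KL_property_via h xh a \<phi> \<longleftrightarrow>
     0 < a \<and> desingularizing a \<phi> \<and> (\<exists>U. open U \<and> xh \<in> U \<and> KL_inequality h xh a U \<phi>)"

definition KL_property_at :: "('a::euclidean_space \<Rightarrow> ereal) \<Rightarrow> 'a \<Rightarrow> bool" where
  "KL_property_at h xh \<longleftrightarrow> (\<exists>a \<phi>. KL_property_via h xh a \<phi>)"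

definition KL_exponent_at :: "('a::euclidean_space \<Rightarrow> ereal) \<Rightarrow> 'a \<Rightarrow> real \<Rightarrow> bool" where
  "KL_exponent_at h xh \<theta> \<longleftrightarrow> 0 \<le> \<theta> \<and> \<theta> < 1 \<and>
     (\<exists>a a0. 0 < a0 \<and> KL_property_via h xh a (\<lambda>\<nu>. a0 * \<nu> powr (1 - \<theta>)))"

definition KL_function :: "('a::euclidean_space \<Rightarrow> ereal) \<Rightarrow> bool" where
  "KL_function h \<longleftrightarrow> proper_fun h \<and> closed_fun h \<and> (\<forall>x\<in>dom_subdiff h. KL_property_at h x)"

definition KL_function_with_exponent :: "('a::euclidean_space \<Rightarrow> ereal) \<Rightarrow> real \<Rightarrow> bool" where
  "KL_function_with_exponent h \<theta> \<longleftrightarrow>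
     proper_fun h \<and> closed_fun h \<and> (\<forall>x\<in>dom_subdiff h. KL_exponent_at h x \<theta>)"

section \<open>The l1/l2 problem\<close>

definition l1_norm :: "real^'n \<Rightarrow> real" where
  "l1_norm x = (\<Sum>i\<in>UNIV. \<bar>x $ i\<bar>)"

text \<open>The value at the origin is 0 by the convention for division by 0; it plays no role below,
  since the origin is infeasible.\<close>

definition l1_l2 :: "real^'n \<Rightarrow> real" where
  "l1_l2 x = l1_norm x / norm x"

definition GMFCQ_at :: "(real^'n \<Rightarrow> real) \<Rightarrow> real^'n \<Rightarrow> bool" where
  "GMFCQ_at q x \<longleftrightarrow> (q x = 0 \<longrightarrow> 0 \<notin> clarke_subdiff q x)"

definition stationary_point :: "(real^'n \<Rightarrow> real) \<Rightarrow> real^'n \<Rightarrow> bool" where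
  "stationary_point q x \<longleftrightarrow> q x \<le> 0 \<and>
     0 \<in> limiting_subdiff (\<lambda>y. ereal (l1_l2 y) + delta_fun {z. q z \<le> 0} y) x"

definition clarke_critical_point :: "(real^'n \<Rightarrow> real) \<Rightarrow> real^'n \<Rightarrow> bool" where
  "clarke_critical_point q x \<longleftrightarrow> q x \<le> 0 \<and>
     (\<exists>lam\<ge>0. 0 \<in> {u + lam *\<^sub>R v |u v. u \<in> limiting_subdiff (\<lambda>y. ereal (l1_l2 y)) x \<and>
                                       v \<in> clarke_subdiff q x} \<and>
            lam * q x = 0)"

section \<open>The algorithm\<close>

definition mba_objective :: "real \<Rightarrow> real \<Rightarrow> real^'n \<Rightarrow> real^'n \<Rightarrow> real" where
  "mba_objective \<alpha> \<omega> xt x =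
     l1_norm x - \<omega> / norm xt * (x \<bullet> xt) + \<alpha> / 2 * (norm (x - xt))\<^sup>2"

definition mba_feasible ::
    "(real^'n \<Rightarrow> real) \<Rightarrow> (real^'n \<Rightarrow> real^'n) \<Rightarrow> real^'n \<Rightarrow> real^'n \<Rightarrow> real \<Rightarrow> real^'n \<Rightarrow> bool" where
  "mba_feasible q gP1 xt \<zeta> l x \<longleftrightarrow>
     q xt + (gP1 xt - \<zeta>) \<bullet> (x - xt) + l / 2 * (norm (x - xt))\<^sup>2 \<le> 0"

text \<open>In iteration \<open>t\<close>, \<open>z i\<close> is the subproblem solution after \<open>i\<close> doublings of the initial
  \<open>l0\<close>, and \<open>j\<close> is the number of doublings at which the line search stops.\<close>

definition mba_sequence ::
    "(real^'n \<Rightarrow> real) \<Rightarrow> (real^'n \<Rightarrow> real^'n) \<Rightarrow> (real^'n \<Rightarrow> real) \<Rightarrow>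
     real \<Rightarrow> real \<Rightarrow> real \<Rightarrow> (nat \<Rightarrow> real^'n) \<Rightarrow> bool" where
  "mba_sequence q gP1 P2 \<alpha> lmin lmax x \<longleftrightarrow>
     q (x 0) \<le> 0 \<and> 0 < \<alpha> \<and> 0 < lmin \<and> lmin < lmax \<and>
     (\<forall>t. \<exists>l0\<in>{lmin..lmax}. \<exists>\<zeta>\<in>limiting_subdiff (\<lambda>y. ereal (P2 y)) (x t).
        \<exists>z. \<exists>j::nat.
          (\<forall>i\<le>j. is_arg_min (mba_objective \<alpha> (l1_l2 (x t)) (x t))
                   (mba_feasible q gP1 (x t) \<zeta> (2 ^ i * l0)) (z i)) \<and>
          (\<forall>i<j. \<not> q (z i) \<le> 0) \<and> q (z j) \<le> 0 \<and>
          x (Suc t) = z j)"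

section \<open>The potential function\<close>

definition q_tilde ::
    "(real^'n \<Rightarrow> real) \<Rightarrow> (real^'n \<Rightarrow> real^'n) \<Rightarrow> (real^'n \<Rightarrow> real) \<Rightarrow>
     (real^'n) \<times> (real^'n) \<times> (real^'n) \<times> real \<Rightarrow> ereal" where
  "q_tilde P1 gP1 P2 = (\<lambda>(x, y, \<zeta>, w).
     ereal (P1 y + gP1 y \<bullet> (x - y)) + convex_conjugate P2 \<zeta> - ereal (\<zeta> \<bullet> x)
       + ereal (w / 2 * (norm (x - y))\<^sup>2))"

definition F_tilde ::
    "(real^'n \<Rightarrow> real) \<Rightarrow> (real^'n \<Rightarrow> real^'n) \<Rightarrow> (real^'n \<Rightarrow> real) \<Rightarrow> real \<Rightarrow>
     (real^'n) \<times> (real^'n) \<times> (real^'n) \<times> real \<Rightarrow> ereal" where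
  "F_tilde P1 gP1 P2 \<rho> = (\<lambda>(x, y, \<zeta>, w).
     ereal (l1_l2 x) + delta_fun {p. q_tilde P1 gP1 P2 p \<le> 0} (x, y, \<zeta>, w)
       + delta_fun {z. norm z \<ge> \<rho>} x)"

end

theory Submission
  imports Defs
begin

text \<open>
  Write \<open>d t = norm (x (t + 1) - x t)\<close> and \<open>\<omega>\<close> for the ratio of the norms. Since \<open>x t\<close> is feasible
  for its own subproblem, optimality of \<open>x (t + 1)\<close> and the Cauchy-Schwarz inequality give a decrease
  of \<open>\<omega>\<close> by at least a multiple of \<open>d t ^ 2\<close> (\<open>mba_kkt.ratio_decrease\<close>). Hence \<open>\<omega> (x t)\<close>
  converges and \<open>d\<close> tends to 0.

  The constraint qualification makes every subproblem satisfy the Slater condition: an element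
  \<open>\<nabla>P1 - \<zeta>\<close> with \<open>\<zeta>\<close> a subgradient of \<open>P2\<close> belongs to the Clarke subdifferential of \<open>q\<close>
  (\<open>clarke_subdiff_difference\<close>). So each \<open>x (t + 1)\<close> has a multiplier (\<open>mba_subproblem_kkt\<close>), and
  the same qualification, applied at a limit point, keeps the multipliers bounded
  (\<open>mba_kkt.bounded_lam\<close>).

  The potential function at \<open>z t = (x (t + 1), x t, \<zeta> t, l t)\<close> has the value \<open>\<omega> (x (t + 1))\<close>.
  Although it is neither smooth nor convex, it dominates a function that is differentiable at
  \<open>z t\<close> and equal to it there: the 1-norm is replaced by the affine minorant that the optimality
  system provides, the conjugate of \<open>P2\<close> by its affine minorant with slope \<open>x t\<close>, and
  the indicator of the constraint by the multiplier times the constraint function. The gradient of that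
  minorant is a Frechet subgradient (\<open>frechet_subdiff_F_tilde\<close>). By the optimality system its norm
  is at most a constant times \<open>d t\<close> (\<open>mba_kkt.potential_subgradient_bound\<close>).

  From here on the argument is abstract (locale \<open>kl_descent\<close>). The components \<open>\<zeta> t\<close> and \<open>l t\<close> of \<open>z t\<close>
  may jump, so a trapping argument around a single cluster point is not possible; instead finitely
  many cluster points whose neighborhoods catch the tail of \<open>z\<close> are used, and their desingularizing
  functions are added (\<open>uniformized_KL\<close>). With \<open>\<Phi> t\<close> the value of the sum at the excess of the
  potential over its limit, concavity and the inequality turn the quadratic descent into
  \<open>d (t + 1) \<le> d t / 2 + c (\<Phi> t - \<Phi> (t + 1))\<close>, which makes \<open>d\<close> summable and bounds its tails
  \<open>S t = \<Sum>i\<ge>t. d i\<close> by \<open>S (t + 1) \<le> d t + 2 c \<Phi> t\<close>. For exponent 0 the inequality keeps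
  nonzero steps away from 0, so they stop. If the exponent is \<open>\<theta> > 0\<close>, then \<open>\<Phi> t\<close> is at most
  a multiple of the power \<open>(1 - \<theta>) / \<theta>\<close> of \<open>d t = S t - S (t + 1)\<close>; the rates are those of the
  resulting recursion for \<open>S\<close>.

  Finally, the optimality systems pass to the limit (\<open>mba_kkt.limit_kkt\<close>) and show that the limit
  is Clarke critical. If \<open>q\<close> is regular there, then \<open>\<nabla>P1 - \<zeta>\<close> is even a Frechet subgradient of
  \<open>q\<close> (\<open>regular_difference_frechet_subdiff\<close>), and the critical point is stationary.
\<close>

section \<open>Frechet and limiting subgradients\<close>

text \<open>The limes inferior of difference quotients becomes a local inequality with a slack
  \<open>e * norm (x - xb)\<close>; because the slack vanishes at \<open>xb\<close>, full neighborhoods may replace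
  punctured ones, which makes the condition easy to transport along continuous maps.\<close>

lemma frechet_subdiff_iff:
  "v \<in> frechet_subdiff h xb \<longleftrightarrow> \<bar>h xb\<bar> \<noteq> \<infinity> \<and>
     (\<forall>e>0. \<forall>\<^sub>F x in nhds xb. h xb + ereal (v \<bullet> (x - xb) - e * norm (x - xb)) \<le> h x)"
proof (cases "\<bar>h xb\<bar> = \<infinity>")
  case True
  then show ?thesis by (simp add: frechet_subdiff_def)
next
  case False
  then obtain c where c: "h xb = ereal c" by auto
  let ?Q = "\<lambda>x. (h x - h xb - ereal (v \<bullet> (x - xb))) / ereal (norm (x - xb))"
  have quot: "ereal (- e) < ?Q x \<longleftrightarrow> h xb + ereal (v \<bullet> (x - xb) - e * norm (x - xb)) < h x"
    if "x \<noteq> xb" for x e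
    using that by (cases "h x") (auto simp: c field_simps)
  have "v \<in> frechet_subdiff h xb \<longleftrightarrow> (\<forall>y<0. \<forall>\<^sub>F x in at xb. y < ?Q x)"
    using False by (simp add: frechet_subdiff_def le_Liminf_iff)
  also have "\<dots> \<longleftrightarrow> (\<forall>e>0. \<forall>\<^sub>F x in at xb. ereal (- e) < ?Q x)"
  proof
    assume *: "\<forall>e>0. \<forall>\<^sub>F x in at xb. ereal (- e) < ?Q x"
    show "\<forall>y<0. \<forall>\<^sub>F x in at xb. y < ?Q x"
    proof (intro allI impI)
      fix y :: ereal assume y: "y < 0"
      obtain e where e: "e > 0" "y \<le> ereal (- e)"
      proof (cases y)
        case (real r) then show ?thesis using that[of "- r"] y by (auto simp: zero_ereal_def)
      next
        case MInf then show ?thesis using that[of 1] by auto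
      qed (use y in auto)
      show "\<forall>\<^sub>F x in at xb. y < ?Q x"
        using *[rule_format, OF e(1)] by eventually_elim (use e in auto)
    qed
  qed auto
  also have "\<dots> \<longleftrightarrow> (\<forall>e>0. \<forall>\<^sub>F x in at xb. h xb + ereal (v \<bullet> (x - xb) - e * norm (x - xb)) < h x)"
    by (intro all_cong imp_cong refl eventually_cong) (auto simp: eventually_at_filter quot)
  also have "\<dots> \<longleftrightarrow> (\<forall>e>0. \<forall>\<^sub>F x in nhds xb. h xb + ereal (v \<bullet> (x - xb) - e * norm (x - xb)) \<le> h x)"
  proof (intro iffI allI impI)
    fix e :: real assume "e > 0"
      and *: "\<forall>e>0. \<forall>\<^sub>F x in at xb. h xb + ereal (v \<bullet> (x - xb) - e * norm (x - xb)) < h x"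
    then have "\<forall>\<^sub>F x in at xb. h xb + ereal (v \<bullet> (x - xb) - e * norm (x - xb)) < h x" by blast
    then show "\<forall>\<^sub>F x in nhds xb. h xb + ereal (v \<bullet> (x - xb) - e * norm (x - xb)) \<le> h x"
      unfolding eventually_at_filter
    proof (rule eventually_mono)
      fix x assume "x \<noteq> xb \<longrightarrow> x \<in> UNIV \<longrightarrow> h xb + ereal (v \<bullet> (x - xb) - e * norm (x - xb)) < h x"
      then show "h xb + ereal (v \<bullet> (x - xb) - e * norm (x - xb)) \<le> h x"
        by (cases "x = xb") (auto simp: c)
    qed
  next
    fix e :: real assume e: "e > 0"
      and *: "\<forall>e>0. \<forall>\<^sub>F x in nhds xb. h xb + ereal (v \<bullet> (x - xb) - e * norm (x - xb)) \<le> h x"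
    from e have "e / 2 > 0" by simp
    with * have "\<forall>\<^sub>F x in nhds xb. h xb + ereal (v \<bullet> (x - xb) - e / 2 * norm (x - xb)) \<le> h x" by blast
    then show "\<forall>\<^sub>F x in at xb. h xb + ereal (v \<bullet> (x - xb) - e * norm (x - xb)) < h x"
      unfolding eventually_at_filter
    proof (rule eventually_mono, intro impI)
      fix x assume x: "h xb + ereal (v \<bullet> (x - xb) - e / 2 * norm (x - xb)) \<le> h x" "x \<noteq> xb"
      have "e * norm (x - xb) > 0" using e x by simp
      then have "h xb + ereal (v \<bullet> (x - xb) - e * norm (x - xb))
              < h xb + ereal (v \<bullet> (x - xb) - e / 2 * norm (x - xb))"
        by (simp add: c)
      with x show "h xb + ereal (v \<bullet> (x - xb) - e * norm (x - xb)) < h x" by simp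
    qed
  qed
  finally show ?thesis using False by simp
qed

lemma frechet_subdiff_real_iff:
  "v \<in> frechet_subdiff (\<lambda>y. ereal (f y)) x \<longleftrightarrow>
     (\<forall>e>0. \<forall>\<^sub>F y in nhds x. f x + v \<bullet> (y - x) - e * norm (y - x) \<le> f y)"
  by (simp add: frechet_subdiff_iff add_diff_eq)

text \<open>Subgradients pass from a minorant that touches \<open>h\<close> at \<open>x\<close> to \<open>h\<close> itself. With a
  differentiable minorant this is the device that replaces a calculus of subdifferentials of sums and
  indicators.\<close>

lemma frechet_subdiff_minorant:
  assumes "v \<in> frechet_subdiff g x" "\<And>y. g y \<le> h y" "h x = g x"
  shows "v \<in> frechet_subdiff h x"
  unfolding frechet_subdiff_iff
proof (intro conjI allI impI)
  show "\<bar>h x\<bar> \<noteq> \<infinity>" using assms by (simp add: frechet_subdiff_iff)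
next
  fix e :: real assume "e > 0"
  then have "\<forall>\<^sub>F y in nhds x. g x + ereal (v \<bullet> (y - x) - e * norm (y - x)) \<le> g y"
    using assms(1) unfolding frechet_subdiff_iff by blast
  then show "\<forall>\<^sub>F y in nhds x. h x + ereal (v \<bullet> (y - x) - e * norm (y - x)) \<le> h y"
    by eventually_elim (use assms(2,3) order_trans in auto)
qed

lemma frechet_subdiff_differentiable:
  assumes "(f has_derivative (\<lambda>d. v \<bullet> d)) (at x)"
  shows "v \<in> frechet_subdiff (\<lambda>y. ereal (f y)) x"
  unfolding frechet_subdiff_real_iff
proof (intro allI impI)
  fix e :: real assume "e > 0"
  then obtain d where d: "d > 0"
      "\<And>y. norm (y - x) < d \<Longrightarrow> \<bar>f y - f x - v \<bullet> (y - x)\<bar> \<le> e * norm (y - x)"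
    using assms unfolding has_derivative_at_alt by (auto simp: real_norm_def)
  then show "\<forall>\<^sub>F y in nhds x. f x + v \<bullet> (y - x) - e * norm (y - x) \<le> f y"
    unfolding eventually_nhds_metric
    by (intro exI[of _ d]) (auto simp: dist_norm abs_le_iff dest!: d(2))
qed

lemma frechet_subdiff_add_scaleR:
  assumes u: "u \<in> frechet_subdiff (\<lambda>y. ereal (f y)) x"
    and v: "v \<in> frechet_subdiff (\<lambda>y. ereal (g y)) x" and c: "c \<ge> 0"
  shows "u + c *\<^sub>R v \<in> frechet_subdiff (\<lambda>y. ereal (f y + c * g y)) x"
  unfolding frechet_subdiff_real_iff
proof (intro allI impI)
  fix e :: real assume e: "e > 0"
  have e': "e / (2 * (1 + c)) > 0" "e / (2 * (1 + c)) * c \<le> e / 2" "e / 2 > 0" using e c by (auto simp: field_simps)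
  have "\<forall>\<^sub>F y in nhds x. f x + u \<bullet> (y - x) - e / 2 * norm (y - x) \<le> f y"
    "\<forall>\<^sub>F y in nhds x. g x + v \<bullet> (y - x) - e / (2 * (1 + c)) * norm (y - x) \<le> g y"
    using u v e' unfolding frechet_subdiff_real_iff by blast+
  then show "\<forall>\<^sub>F y in nhds x. f x + c * g x + (u + c *\<^sub>R v) \<bullet> (y - x) - e * norm (y - x) \<le> f y + c * g y"
  proof eventually_elim
    case (elim y)
    have "c * (g x + v \<bullet> (y - x) - e / (2 * (1 + c)) * norm (y - x)) \<le> c * g y"
      using elim(2) c by (rule mult_left_mono)
    then have "c * g x + c * (v \<bullet> (y - x)) - (e / (2 * (1 + c)) * c) * norm (y - x) \<le> c * g y"
      by (simp add: algebra_simps)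
    moreover have "(e / (2 * (1 + c)) * c) * norm (y - x) \<le> e / 2 * norm (y - x)"
      by (intro mult_right_mono e'(2)) auto
    ultimately show ?case using elim(1) unfolding inner_add_left inner_scaleR_left by linarith
  qed
qed

lemma frechet_subset_limiting: "frechet_subdiff h x \<subseteq> limiting_subdiff h x"
proof
  fix v assume "v \<in> frechet_subdiff h x"
  then show "v \<in> limiting_subdiff h x"
    unfolding limiting_subdiff_def
    by (intro CollectI conjI exI[of _ "\<lambda>_. x"] exI[of _ "\<lambda>_. v"])
       (auto simp: frechet_subdiff_def)
qed

section \<open>Subgradients of convex functions\<close>

definition subgrad :: "('a::real_inner \<Rightarrow> real) \<Rightarrow> 'a \<Rightarrow> 'a set" where
  "subgrad f x = {v. \<forall>y. f x + v \<bullet> (y - x) \<le> f y}"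

text \<open>A Frechet subgradient of a convex function is a subgradient: the local inequality with
  slack is scaled up along the segment to any \<open>y\<close>. The subgradient inequality is preserved in the limit.\<close>

lemma limiting_subdiff_convex:
  assumes conv: "convex_on UNIV f"
  shows "limiting_subdiff (\<lambda>y. ereal (f y)) x \<subseteq> subgrad f x"
proof
  fix v assume "v \<in> limiting_subdiff (\<lambda>y. ereal (f y)) x"
  then obtain X V where X: "X \<longlonglongrightarrow> x" "(\<lambda>k. f (X k)) \<longlonglongrightarrow> f x"
      and V: "\<And>k. V k \<in> frechet_subdiff (\<lambda>y. ereal (f y)) (X k)" "V \<longlonglongrightarrow> v"
    unfolding limiting_subdiff_def by auto
  have sub: "f (X k) + V k \<bullet> (y - X k) \<le> f y" for k y
  proof (rule field_le_epsilon)
    fix e :: real assume e: "e > 0"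
    let ?d = "y - X k" let ?e = "e / (norm ?d + 1)"
    have e': "?e > 0" "?e * norm ?d \<le> e" using e by (auto simp: field_simps add_pos_nonneg)
    have "\<forall>\<^sub>F z in nhds (X k). f (X k) + V k \<bullet> (z - X k) - ?e * norm (z - X k) \<le> f z"
      using V(1)[of k] e'(1) unfolding frechet_subdiff_real_iff by blast
    then obtain \<delta> where \<delta>: "\<delta> > 0"
        "\<And>z. dist z (X k) < \<delta> \<Longrightarrow> f (X k) + V k \<bullet> (z - X k) - ?e * norm (z - X k) \<le> f z"
      unfolding eventually_nhds_metric by blast
    \<comment> \<open>A step along the segment so short that the local inequality applies.\<close>
    define t where "t = min 1 (\<delta> / (2 * (norm ?d + 1)))"
    have t: "0 < t" "t \<le> 1" "t * norm ?d < \<delta>"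
    proof -
      show "0 < t" "t \<le> 1" using \<delta> by (auto simp: t_def add_nonneg_pos)
      have "t * norm ?d \<le> \<delta> / (2 * (norm ?d + 1)) * norm ?d" by (intro mult_right_mono) (auto simp: t_def)
      also have "\<dots> < \<delta>" using \<delta>(1) by (simp add: field_simps add_pos_nonneg)
      finally show "t * norm ?d < \<delta>" .
    qed
    have "f (X k) + V k \<bullet> (t *\<^sub>R ?d) - ?e * norm (t *\<^sub>R ?d) \<le> f (X k + t *\<^sub>R ?d)"
      using \<delta>(2)[of "X k + t *\<^sub>R ?d"] t by (simp add: dist_norm)
    also have "f (X k + t *\<^sub>R ?d) \<le> (1 - t) * f (X k) + t * f y"
      using convex_onD[OF conv, of t "X k" y] t by (simp add: algebra_simps)
    finally have "f (X k) + V k \<bullet> (t *\<^sub>R ?d) - ?e * norm (t *\<^sub>R ?d) \<le> (1 - t) * f (X k) + t * f y" .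
    moreover have "norm (t *\<^sub>R ?d) = t * norm ?d" using t by simp
    ultimately have "t * (V k \<bullet> ?d) - ?e * (t * norm ?d) \<le> (1 - t) * f (X k) + t * f y - f (X k)"
      by (simp only: inner_scaleR_right)
    then have "t * (f (X k) + V k \<bullet> ?d) \<le> t * (f y + ?e * norm ?d)"
      by (simp add: distrib_left left_diff_distrib mult.left_commute)
    then have "f (X k) + V k \<bullet> ?d \<le> f y + ?e * norm ?d" using t by simp
    with e' show "f (X k) + V k \<bullet> ?d \<le> f y + e" by linarith
  qed
  have "f x + v \<bullet> (y - x) \<le> f y" for y
  proof (rule LIMSEQ_le_const2)
    show "(\<lambda>k. f (X k) + V k \<bullet> (y - X k)) \<longlonglongrightarrow> f x + v \<bullet> (y - x)"
      by (intro tendsto_intros X V)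
  qed (use sub in auto)
  then show "v \<in> subgrad f x" by (simp add: subgrad_def)
qed

lemma subgrad_closed:
  assumes "continuous_on UNIV f" "X \<longlonglongrightarrow> x" "V \<longlonglongrightarrow> v" "\<And>k. V k \<in> subgrad f (X k)"
  shows "v \<in> subgrad f x"
proof -
  have "f x + v \<bullet> (y - x) \<le> f y" for y
  proof (rule LIMSEQ_le_const2)
    have "(\<lambda>k. f (X k)) \<longlonglongrightarrow> f x"
      by (rule continuous_on_tendsto_compose[OF assms(1,2)]) auto
    then show "(\<lambda>k. f (X k) + V k \<bullet> (y - X k)) \<longlonglongrightarrow> f x + v \<bullet> (y - x)"
      by (intro tendsto_intros assms)
  qed (use assms(4) in \<open>auto simp: subgrad_def\<close>)
  then show "v \<in> subgrad f x" by (simp add: subgrad_def)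
qed

text \<open>Moving from \<open>x\<close> by a unit step in the direction of a subgradient \<open>v\<close> increases \<open>f\<close> by at
  least \<open>norm v\<close>, while \<open>f\<close> is bounded on the 1-neighborhood of \<open>S\<close>.\<close>

lemma subgrad_bounded:
  fixes f :: "'a::euclidean_space \<Rightarrow> real"
  assumes cont: "continuous_on UNIV f" and S: "bounded S"
  obtains B where "\<And>x v. x \<in> S \<Longrightarrow> v \<in> subgrad f x \<Longrightarrow> norm v \<le> B"
proof -
  obtain r where r: "\<And>x. x \<in> S \<Longrightarrow> norm x \<le> r" using S by (auto simp: bounded_iff)
  have "compact (f ` cball 0 (r + 1))"
    by (intro compact_continuous_image continuous_on_subset[OF cont]) auto
  then obtain M where M: "\<And>y. norm y \<le> r + 1 \<Longrightarrow> \<bar>f y\<bar> \<le> M"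
    by (force dest!: compact_imp_bounded simp: bounded_iff)
  show ?thesis
  proof (rule that[of "2 * M"])
    fix x v assume x: "x \<in> S" and v: "v \<in> subgrad f x"
    have "norm (x + sgn v) \<le> r + 1"
      using r[OF x] norm_triangle_ineq[of x "sgn v"] by (auto simp: norm_sgn split: if_splits)
    moreover have "f x + v \<bullet> sgn v \<le> f (x + sgn v)"
      using v by (auto simp: subgrad_def dest!: spec[of _ "x + sgn v"])
    moreover have "v \<bullet> sgn v = norm v"
      by (simp add: sgn_div_norm power2_norm_eq_inner[symmetric] power2_eq_square field_simps)
    ultimately show "norm v \<le> 2 * M" using M[of x] M[of "x + sgn v"] r[OF x] by auto
  qed
qed

text \<open>The upper estimate comes from convexity on the ray through \<open>y\<close>, which is bounded at distance 1;
  the lower one from the subgradient.\<close>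

lemma convex_calm:
  fixes f :: "'a::euclidean_space \<Rightarrow> real"
  assumes conv: "convex_on UNIV f" and cont: "continuous_on UNIV f" and \<zeta>: "\<zeta> \<in> subgrad f x"
  obtains K where "\<And>y. norm (y - x) \<le> 1 \<Longrightarrow> \<bar>f y - f x\<bar> \<le> K * norm (y - x)"
proof -
  have "compact (f ` cball x 1)"
    by (intro compact_continuous_image continuous_on_subset[OF cont]) auto
  then have "bounded (f ` cball x 1)" by (rule compact_imp_bounded)
  then obtain M where "\<forall>y\<in>cball x 1. \<bar>f y\<bar> \<le> M"
    by (auto simp: bounded_iff)
  then have M: "\<bar>f y\<bar> \<le> M" if "norm (y - x) \<le> 1" for y
    using that by (simp add: dist_norm norm_minus_commute)
  show ?thesis
  proof (rule that[of "2 * M + norm \<zeta>"])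
    fix y assume y: "norm (y - x) \<le> 1"
    define d where "d = y - x"
    have up: "f y - f x \<le> 2 * M * norm d"
    proof (cases "d = 0")
      case False
      define u where "u = x + (1 / norm d) *\<^sub>R d"
      have "norm (u - x) \<le> 1" using False by (simp add: u_def)
      have "y = (1 - norm d) *\<^sub>R x + norm d *\<^sub>R u"
        using False by (simp add: u_def d_def algebra_simps)
      then have "f y \<le> (1 - norm d) * f x + norm d * f u"
        using convex_onD[OF conv, of "norm d" x u] y by (simp add: d_def)
      then have "f y - f x \<le> norm d * (f u - f x)" by (simp add: algebra_simps)
      also have "\<dots> \<le> norm d * (2 * M)"
        using M[OF \<open>norm (u - x) \<le> 1\<close>] M[of x] by (intro mult_left_mono) auto
      finally show ?thesis by (simp add: mult.commute)
    qed (simp add: d_def)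
    have "f x + \<zeta> \<bullet> d \<le> f y" using \<zeta> by (simp add: subgrad_def d_def)
    moreover have "\<bar>\<zeta> \<bullet> d\<bar> \<le> norm \<zeta> * norm d" by (rule Cauchy_Schwarz_ineq2)
    moreover have "0 \<le> M" using M[of x] by simp
    moreover have "0 \<le> M * norm d" "0 \<le> norm \<zeta> * norm d" using \<open>0 \<le> M\<close> by auto
    ultimately show "\<bar>f y - f x\<bar> \<le> (2 * M + norm \<zeta>) * norm (y - x)"
      using up unfolding d_def[symmetric] distrib_right by linarith
  qed
qed

section \<open>Differences of a smooth and a convex function\<close>

text \<open>The base points \<open>x - \<tau> w\<close> are used in the upper limit of the difference quotients:
  they give backward quotients, in which the subgradient inequality of \<open>P2\<close> at \<open>x\<close> has the required
  direction although \<open>P2\<close> enters with a negative sign.\<close>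

lemma clarke_subdiff_difference:
  fixes P1 P2 :: "'a::euclidean_space \<Rightarrow> real"
  assumes P1: "GDERIV P1 x :> g" and z: "\<zeta> \<in> subgrad P2 x"
  shows "g - \<zeta> \<in> clarke_subdiff (\<lambda>y. P1 y - P2 y) x"
  unfolding clarke_subdiff_def
proof (intro CollectI allI)
  fix w
  let ?h = "\<lambda>y. P1 y - P2 y"
  let ?G = "\<lambda>(y, \<tau>). ereal ((?h (y + \<tau> *\<^sub>R w) - ?h y) / \<tau>)"
  let ?m = "\<lambda>\<tau>::real. (x - \<tau> *\<^sub>R w, \<tau>)"
  have m: "filterlim ?m (nhds x \<times>\<^sub>F at_right 0) (at_right 0)"
  proof (rule filterlim_Pair)
    have "((\<lambda>\<tau>. x - \<tau> *\<^sub>R w) \<longlongrightarrow> x - 0 *\<^sub>R w) (at_right 0)"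
      by (intro tendsto_intros)
    then show "((\<lambda>\<tau>. x - \<tau> *\<^sub>R w) \<longlongrightarrow> x) (at_right 0)" by simp
  qed (simp add: filterlim_ident)
  have der: "((\<lambda>\<tau>. P1 (x - \<tau> *\<^sub>R w)) has_real_derivative - (g \<bullet> w)) (at 0)"
  proof -
    have "(P1 has_derivative (\<lambda>d. g \<bullet> d)) (at (x - 0 *\<^sub>R w))"
      using P1 by (simp add: gderiv_def inner_commute)
    then have "((\<lambda>\<tau>. P1 (x - \<tau> *\<^sub>R w)) has_derivative (\<lambda>\<tau>. g \<bullet> (- (\<tau> *\<^sub>R w)))) (at (0::real))"
      by (intro has_derivative_compose[where f = "\<lambda>\<tau>. x - \<tau> *\<^sub>R w" and g = P1])
         (auto intro!: derivative_eq_intros)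
    then show ?thesis 
      unfolding has_field_derivative_def by (rule has_derivative_eq_rhs) (auto simp: fun_eq_iff)
  qed
  have lim: "((\<lambda>\<tau>. - ((P1 (x - \<tau> *\<^sub>R w) - P1 x) / \<tau>) - \<zeta> \<bullet> w) \<longlongrightarrow> - (- (g \<bullet> w)) - \<zeta> \<bullet> w) (at_right 0)"
  proof (intro tendsto_intros)
    have "((\<lambda>\<tau>. (P1 (x - \<tau> *\<^sub>R w) - P1 x) / \<tau>) \<longlongrightarrow> - (g \<bullet> w)) (at 0)"
      using der unfolding has_field_derivative_iff by simp
    then show "((\<lambda>\<tau>. (P1 (x - \<tau> *\<^sub>R w) - P1 x) / \<tau>) \<longlongrightarrow> - (g \<bullet> w)) (at_right 0)"
      by (rule tendsto_mono[OF at_le[OF subset_UNIV]])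
  qed
  have "ereal ((g - \<zeta>) \<bullet> w) = Limsup (at_right 0) (\<lambda>\<tau>. ereal (- ((P1 (x - \<tau> *\<^sub>R w) - P1 x) / \<tau>) - \<zeta> \<bullet> w))"
    using tendsto_ereal[OF lim]
    by (subst lim_imp_Limsup) (auto simp: inner_diff_left simp del: tendsto_ereal)
  also have "\<dots> \<le> Limsup (at_right 0) (\<lambda>\<tau>. ?G (?m \<tau>))"
  proof (rule Limsup_mono)
    show "\<forall>\<^sub>F \<tau> in at_right 0. ereal (- ((P1 (x - \<tau> *\<^sub>R w) - P1 x) / \<tau>) - \<zeta> \<bullet> w) \<le> ?G (?m \<tau>)"
      unfolding eventually_at_filter
    proof (rule always_eventually, intro allI impI)
      fix \<tau> :: real assume "\<tau> \<noteq> 0" "\<tau> \<in> {0<..}"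
      then have "\<tau> > 0" by simp
      moreover have "P2 x - \<tau> * (\<zeta> \<bullet> w) \<le> P2 (x - \<tau> *\<^sub>R w)"
        using z by (auto simp: subgrad_def dest!: spec[of _ "x - \<tau> *\<^sub>R w"])
      ultimately have "P2 x - P2 (x - \<tau> *\<^sub>R w) \<le> \<tau> * (\<zeta> \<bullet> w)" by simp
      with \<open>\<tau> > 0\<close> have "(P2 x - P2 (x - \<tau> *\<^sub>R w)) / \<tau> \<le> \<zeta> \<bullet> w"
        by (simp add: pos_divide_le_eq mult.commute)
      then show "ereal (- ((P1 (x - \<tau> *\<^sub>R w) - P1 x) / \<tau>) - \<zeta> \<bullet> w) \<le> ?G (?m \<tau>)"
        by (simp add: diff_divide_distrib)
    qed
  qed
  also have "\<dots> \<le> Limsup (filtermap ?m (at_right 0)) ?G"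
    by (rule Limsup_filtermap_ge)
  also have "\<dots> \<le> Limsup (nhds x \<times>\<^sub>F at_right 0) ?G"
    using m unfolding filterlim_def le_filter_def Limsup_def by (intro INF_superset_mono) auto
  finally show "ereal ((g - \<zeta>) \<bullet> w) \<le> Limsup (nhds x \<times>\<^sub>F at_right 0) ?G" .
qed

text \<open>A Frechet subgradient of \<open>P1 - P2\<close> makes \<open>P2\<close> lie, up to first order, below an
  affine function of slope \<open>g - v\<close>, while each subgradient \<open>\<zeta>\<close> keeps it above one of slope \<open>\<zeta>\<close>.
  So the slopes agree.\<close>

lemma frechet_subdiff_difference_unique:
  fixes P1 P2 :: "'a::euclidean_space \<Rightarrow> real"
  assumes P1: "GDERIV P1 x :> g" and z: "\<zeta> \<in> subgrad P2 x"
    and v: "v \<in> frechet_subdiff (\<lambda>y. ereal (P1 y - P2 y)) x"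
  shows "v = g - \<zeta>"
proof -
  define w where "w = v - g + \<zeta>"
  have "norm w \<le> e" if e: "e > 0" for e
  proof -
    have "\<forall>\<^sub>F y in nhds x. P1 x - P2 x + v \<bullet> (y - x) - e / 2 * norm (y - x) \<le> P1 y - P2 y"
      using v e unfolding frechet_subdiff_real_iff by (meson half_gt_zero)
    moreover have "(- g) \<in> frechet_subdiff (\<lambda>y. ereal (- P1 y)) x"
      using P1 by (intro frechet_subdiff_differentiable)
        (auto simp: gderiv_def inner_commute intro!: derivative_eq_intros)
    then have "\<forall>\<^sub>F y in nhds x. - P1 x + (- g) \<bullet> (y - x) - e / 2 * norm (y - x) \<le> - P1 y"
      using e unfolding frechet_subdiff_real_iff by (meson half_gt_zero)
    ultimately have "\<forall>\<^sub>F y in nhds x. w \<bullet> (y - x) \<le> e * norm (y - x)"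
    proof eventually_elim
      case (elim y)
      have "P2 x + \<zeta> \<bullet> (y - x) \<le> P2 y" using z by (simp add: subgrad_def)
      with elim show ?case
        by (simp add: w_def inner_add_left inner_diff_left)
    qed
    then obtain \<delta> where \<delta>: "\<delta> > 0" "\<And>y. dist y x < \<delta> \<Longrightarrow> w \<bullet> (y - x) \<le> e * norm (y - x)"
      unfolding eventually_nhds_metric by blast
    show "norm w \<le> e"
    proof (cases "w = 0")
      case False
      define t where "t = \<delta> / (2 * norm w)"
      have t: "t > 0" "t * norm w < \<delta>" using False \<delta>(1) by (auto simp: t_def)
      have "w \<bullet> (t *\<^sub>R w) \<le> e * norm (t *\<^sub>R w)"
        using \<delta>(2)[of "x + t *\<^sub>R w"] t by (simp add: dist_norm)
      then have "t * norm w * norm w \<le> t * norm w * e"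
        using t by (simp add: power2_norm_eq_inner[symmetric] power2_eq_square mult_ac)
      then show ?thesis using t False by simp
    qed (use e in simp)
  qed
  then have "norm w \<le> 0" by (rule field_le_epsilon) simp
  then show ?thesis by (simp add: w_def algebra_simps)
qed

lemma frechet_normal_epigraph:
  fixes f :: "'a::euclidean_space \<Rightarrow> real"
  assumes v: "v \<in> frechet_subdiff (\<lambda>y. ereal (f y)) x"
  shows "(v, - 1) \<in> frechet_subdiff (delta_fun (epigraph UNIV f)) (x, f x)"
  unfolding frechet_subdiff_iff
proof (intro conjI allI impI)
  show "\<bar>delta_fun (epigraph UNIV f) (x, f x)\<bar> \<noteq> \<infinity>"
    by (simp add: delta_fun_def epigraph_def)
next
  fix e :: real assume e: "e > 0"
  have "\<forall>\<^sub>F y in nhds x. f x + v \<bullet> (y - x) - e * norm (y - x) \<le> f y"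
    using v e unfolding frechet_subdiff_real_iff by blast
  then have "\<forall>\<^sub>F p in nhds (x, f x). f x + v \<bullet> (fst p - x) - e * norm (fst p - x) \<le> f (fst p)"
    by (rule eventually_compose_filterlim) (auto intro!: tendsto_eq_intros filterlim_ident)
  then show "\<forall>\<^sub>F p in nhds (x, f x). delta_fun (epigraph UNIV f) (x, f x)
      + ereal ((v, - 1) \<bullet> (p - (x, f x)) - e * norm (p - (x, f x))) \<le> delta_fun (epigraph UNIV f) p"
  proof eventually_elim
    case (elim p)
    obtain y s where p: "p = (y, s)" by (cases p)
    have "e * norm (y - x) \<le> e * norm (p - (x, f x))"
      using e norm_fst_le[of "y - x" "s - f x"] by (simp add: p)
    with elim show ?case by (auto simp: p delta_fun_def epigraph_def)
  qed
qed

text \<open>Distances in the epigraph along the graph are comparable to distances in the domain,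
  because \<open>f\<close> changes at most linearly near \<open>x\<close>.\<close>

lemma frechet_subdiff_of_normal_epigraph:
  fixes f :: "'a::euclidean_space \<Rightarrow> real"
  assumes n: "(v, - 1) \<in> frechet_subdiff (delta_fun (epigraph UNIV f)) (x, f x)"
    and cont: "continuous_on UNIV f"
    and calm: "\<forall>\<^sub>F y in nhds x. \<bar>f y - f x\<bar> \<le> K * norm (y - x)"
  shows "v \<in> frechet_subdiff (\<lambda>y. ereal (f y)) x"
  unfolding frechet_subdiff_real_iff
proof (intro allI impI)
  fix e :: real assume e: "e > 0"
  define e' where "e' = e / (1 + \<bar>K\<bar>)"
  have e': "e' > 0" "e' * (1 + \<bar>K\<bar>) = e" using e by (auto simp: e'_def add_pos_nonneg)
  have "\<forall>\<^sub>F p in nhds (x, f x). delta_fun (epigraph UNIV f) (x, f x)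
      + ereal ((v, - 1) \<bullet> (p - (x, f x)) - e' * norm (p - (x, f x))) \<le> delta_fun (epigraph UNIV f) p"
    using n e'(1) unfolding frechet_subdiff_iff by blast
  moreover have "filterlim (\<lambda>y. (y, f y)) (nhds (x, f x)) (nhds x)"
    using cont by (intro tendsto_intros filterlim_ident) (auto simp: continuous_on_def dest: tendsto_at_iff_tendsto_nhds[THEN iffD1])
  ultimately have "\<forall>\<^sub>F y in nhds x. delta_fun (epigraph UNIV f) (x, f x)
      + ereal ((v, - 1) \<bullet> ((y, f y) - (x, f x)) - e' * norm ((y, f y) - (x, f x)))
      \<le> delta_fun (epigraph UNIV f) (y, f y)"
    by (rule eventually_compose_filterlim)
  with calm show "\<forall>\<^sub>F y in nhds x. f x + v \<bullet> (y - x) - e * norm (y - x) \<le> f y"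
  proof eventually_elim
    case (elim y)
    have "norm ((y, f y) - (x, f x)) \<le> norm (y - x) + norm (f y - f x)"
      using norm_Pair_le[of "y - x" "f y - f x"] by simp
    also have "\<dots> \<le> (1 + \<bar>K\<bar>) * norm (y - x)"
      using elim(1) mult_right_mono[OF abs_ge_self[of K], of "norm (y - x)"] by (simp add: distrib_right)
    finally have "norm ((y, f y) - (x, f x)) \<le> (1 + \<bar>K\<bar>) * norm (y - x)" .
    then have "e' * norm ((y, f y) - (x, f x)) \<le> e' * ((1 + \<bar>K\<bar>) * norm (y - x))"
      using e' by (intro mult_left_mono) auto
    then have "e' * norm ((y, f y) - (x, f x)) \<le> e * norm (y - x)"
      by (simp only: mult.assoc[symmetric] e'(2))
    moreover have "v \<bullet> (y - x) - (f y - f x) - e' * norm ((y, f y) - (x, f x)) \<le> 0"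
      using elim(2) by (simp add: delta_fun_def epigraph_def)
    ultimately show ?case by linarith
  qed
qed

text \<open>The function \<open>f y + c (norm (y - x)^2 - norm (z - x)^2)\<close> of \<open>z\<close> lies below \<open>f\<close>
  near \<open>y\<close> and touches it there.\<close>

lemma frechet_subdiff_penalised_minimiser:
  fixes f :: "'a::euclidean_space \<Rightarrow> real"
  assumes r: "norm (y - x) < r" and c: "c \<ge> 0"
    and min: "\<And>z. norm (z - x) \<le> r \<Longrightarrow> f y + c * (norm (y - x))\<^sup>2 \<le> f z + c * (norm (z - x))\<^sup>2"
  shows "(- 2 * c) *\<^sub>R (y - x) \<in> frechet_subdiff (\<lambda>z. ereal (f z)) y"
  unfolding frechet_subdiff_real_iff
proof (intro allI impI)
  fix e :: real assume e: "e > 0"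
  define \<delta> where "\<delta> = min (r - norm (y - x)) (e / (c + 1))"
  have \<delta>: "\<delta> > 0" using r e c by (auto simp: \<delta>_def)
  show "\<forall>\<^sub>F z in nhds y. f y + ((- 2 * c) *\<^sub>R (y - x)) \<bullet> (z - y) - e * norm (z - y) \<le> f z"
    unfolding eventually_nhds_metric
  proof (intro exI conjI allI impI)
    fix z assume z: "dist z y < \<delta>"
    have "norm (z - x) \<le> norm (z - y) + norm (y - x)" by (metis diff_add_cancel add_diff_eq norm_triangle_ineq)
    then have "norm (z - x) \<le> r" using z by (auto simp: \<delta>_def dist_norm)
    from min[OF this] have "f y + c * (norm (y - x))\<^sup>2 \<le> f z + c * (norm (z - x))\<^sup>2" .
    moreover have "(norm (z - x))\<^sup>2 = (norm (y - x))\<^sup>2 + 2 * ((y - x) \<bullet> (z - y)) + (norm (z - y))\<^sup>2"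
      unfolding power2_norm_eq_inner by (simp add: algebra_simps inner_commute)
    ultimately have 1: "f y - 2 * c * ((y - x) \<bullet> (z - y)) - c * (norm (z - y))\<^sup>2 \<le> f z"
      by (simp add: algebra_simps)
    have "c * norm (z - y) \<le> c * (e / (c + 1))"
      using z c by (intro mult_left_mono) (auto simp: \<delta>_def dist_norm)
    also have "\<dots> \<le> e" using c e by (simp add: field_simps)
    finally have "c * norm (z - y) * norm (z - y) \<le> e * norm (z - y)"
      by (intro mult_right_mono) auto
    with 1 show "f y + ((- 2 * c) *\<^sub>R (y - x)) \<bullet> (z - y) - e * norm (z - y) \<le> f z"
      by (simp add: power2_eq_square)
  qed (use \<delta> in simp)
qed

text \<open>Minimisers of \<open>f + n * norm (\<cdot> - x)^2\<close> on a ball converge to \<open>x\<close> and carry Frechet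
  subgradients \<open>- 2 n (y n - x)\<close>. These stay bounded because \<open>f\<close> changes at most linearly at
  \<open>x\<close>, so they have a limit \<open>w\<close>. The vector \<open>(w, - 1)\<close> is a limiting normal to the epigraph, and
  regularity makes it a Frechet normal.\<close>

lemma regular_frechet_subdiff_nonempty:
  fixes f :: "'a::euclidean_space \<Rightarrow> real"
  assumes reg: "regular_fun_at f x" and cont: "continuous_on UNIV f"
    and r: "r > 0" and calm: "\<And>y. norm (y - x) \<le> r \<Longrightarrow> \<bar>f y - f x\<bar> \<le> K * norm (y - x)"
  shows "\<exists>v. v \<in> frechet_subdiff (\<lambda>y. ereal (f y)) x"
proof -
  have "\<exists>y\<in>cball x r. \<forall>z\<in>cball x r. f y + real n * (norm (y - x))\<^sup>2 \<le> f z + real n * (norm (z - x))\<^sup>2" for n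
    using r by (intro continuous_attains_inf continuous_intros continuous_on_subset[OF cont]) auto
  then have "\<exists>y. norm (y - x) \<le> r \<and>
      (\<forall>z. norm (z - x) \<le> r \<longrightarrow> f y + real n * (norm (y - x))\<^sup>2 \<le> f z + real n * (norm (z - x))\<^sup>2)" for n
    by (auto simp: dist_norm norm_minus_commute Bex_def Ball_def)
  then obtain y where y: "\<And>n. norm (y n - x) \<le> r"
      and min: "\<And>n z. norm (z - x) \<le> r \<Longrightarrow>
        f (y n) + real n * (norm (y n - x))\<^sup>2 \<le> f z + real n * (norm (z - x))\<^sup>2"
    by metis
  have bound: "real n * norm (y n - x) \<le> \<bar>K\<bar>" for n
  proof (cases "y n = x")
    case False
    have "real n * (norm (y n - x))\<^sup>2 \<le> f x - f (y n)" using min[of x n] r by simp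
    also have "\<dots> \<le> K * norm (y n - x)" using calm[OF y[of n]] by linarith
    finally have "real n * norm (y n - x) * norm (y n - x) \<le> K * norm (y n - x)"
      by (simp add: power2_eq_square mult.assoc)
    then show ?thesis using False by simp
  qed simp
  have "(\<lambda>n. norm (y n - x)) \<longlonglongrightarrow> 0"
  proof (rule tendsto_sandwich[OF _ _ tendsto_const])
    show "\<forall>\<^sub>F n in sequentially. norm (y n - x) \<le> \<bar>K\<bar> / real n"
      using eventually_gt_at_top[of 0] by eventually_elim (use bound in \<open>auto simp: field_simps\<close>)
    show "(\<lambda>n. \<bar>K\<bar> / real n) \<longlonglongrightarrow> 0" by (rule lim_const_over_n)
  qed auto
  then have yx: "y \<longlonglongrightarrow> x" using Lim_null tendsto_norm_zero_iff by blast
  define v where "v n = (- 2 * real n) *\<^sub>R (y n - x)" for n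
  have "bounded (range v)"
    unfolding bounded_iff
  proof (intro exI ballI)
    fix w assume "w \<in> range v"
    then show "norm w \<le> 2 * \<bar>K\<bar>" using bound by (auto simp: v_def mult.assoc)
  qed
  then obtain w s where s: "strict_mono (s :: nat \<Rightarrow> nat)" "(v \<circ> s) \<longlonglongrightarrow> w"
    using bounded_imp_convergent_subsequence by blast
  have ys: "(\<lambda>n. y (s n)) \<longlonglongrightarrow> x" using LIMSEQ_subseq_LIMSEQ[OF yx s(1)] by (simp add: o_def)
  then obtain N where N: "\<And>n. n \<ge> N \<Longrightarrow> norm (y (s n) - x) < r"
    using r by (auto simp: LIMSEQ_iff)
  let ?E = "delta_fun (epigraph UNIV f)"
  have "(w, - 1) \<in> limiting_subdiff ?E (x, f x)"
    unfolding limiting_subdiff_def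
  proof (intro CollectI conjI exI allI)
    show "\<bar>?E (x, f x)\<bar> \<noteq> \<infinity>" by (simp add: delta_fun_def epigraph_def)
    have "(\<lambda>n. y (s (n + N))) \<longlonglongrightarrow> x" using ys by (rule LIMSEQ_ignore_initial_segment)
    moreover from this have "(\<lambda>n. f (y (s (n + N)))) \<longlonglongrightarrow> f x"
      by (rule continuous_on_tendsto_compose[OF cont]) auto
    ultimately show "(\<lambda>n. (y (s (n + N)), f (y (s (n + N))))) \<longlonglongrightarrow> (x, f x)"
      by (rule tendsto_Pair)
    show "(\<lambda>n. ?E (y (s (n + N)), f (y (s (n + N))))) \<longlonglongrightarrow> ?E (x, f x)"
      by (simp add: delta_fun_def epigraph_def)
    show "(v (s (n + N)), - 1) \<in> frechet_subdiff ?E (y (s (n + N)), f (y (s (n + N))))" for n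
      unfolding v_def
      by (intro frechet_normal_epigraph frechet_subdiff_penalised_minimiser[of _ _ r] N min) auto
    show "(\<lambda>n. (v (s (n + N)), - 1 :: real)) \<longlonglongrightarrow> (w, - 1)"
      using LIMSEQ_ignore_initial_segment[OF s(2), of N] by (intro tendsto_Pair) (auto simp: o_def)
  qed
  then have "(w, - 1) \<in> frechet_subdiff ?E (x, f x)"
    using reg by (simp add: regular_fun_at_def regular_set_at_def)
  moreover have "\<forall>\<^sub>F y in nhds x. \<bar>f y - f x\<bar> \<le> K * norm (y - x)"
    unfolding eventually_nhds_metric using r calm by (intro exI[of _ r]) (auto simp: dist_norm)
  ultimately show ?thesis
    using frechet_subdiff_of_normal_epigraph[OF _ cont] by blast
qed

text \<open>Regularity provides some Frechet subgradient of \<open>P1 - P2\<close>, and any such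
  vector must equal \<open>g x - \<zeta>\<close> for every subgradient \<open>\<zeta>\<close> of \<open>P2\<close>.\<close>

lemma regular_difference_frechet_subdiff:
  fixes P1 P2 :: "'a::euclidean_space \<Rightarrow> real"
  assumes P1: "\<And>y. GDERIV P1 y :> g y" and conv: "convex_on UNIV P2" and cont: "continuous_on UNIV P2"
    and \<zeta>: "\<zeta> \<in> subgrad P2 x" and reg: "regular_fun_at (\<lambda>y. P1 y - P2 y) x"
  shows "g x - \<zeta> \<in> frechet_subdiff (\<lambda>y. ereal (P1 y - P2 y)) x"
proof -
  have P1d: "(P1 has_derivative (\<lambda>d. g y \<bullet> d)) (at y)" for y
    using P1[of y] by (simp add: gderiv_def inner_commute)
  have contq: "continuous_on UNIV (\<lambda>y. P1 y - P2 y)"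
    by (intro continuous_intros cont continuous_at_imp_continuous_on ballI has_derivative_continuous[OF P1d])
  obtain K where K: "\<And>y. norm (y - x) \<le> 1 \<Longrightarrow> \<bar>P2 y - P2 x\<bar> \<le> K * norm (y - x)"
    using convex_calm[OF conv cont \<zeta>] by blast
  obtain \<delta> where \<delta>: "\<delta> > 0" "\<And>y. norm (y - x) < \<delta> \<Longrightarrow> \<bar>P1 y - P1 x - g x \<bullet> (y - x)\<bar> \<le> 1 * norm (y - x)"
    using P1d[of x] unfolding has_derivative_at_alt real_norm_def by (meson zero_less_one)
  define r where "r = min 1 (\<delta> / 2)"
  have r: "r > 0" using \<delta> by (simp add: r_def)
  have "\<bar>(P1 y - P2 y) - (P1 x - P2 x)\<bar> \<le> (1 + norm (g x) + K) * norm (y - x)"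
    if "norm (y - x) \<le> r" for y
  proof -
    have "norm (y - x) \<le> 1" "norm (y - x) < \<delta>" using that \<delta>(1) by (auto simp: r_def)
    then have "\<bar>P2 y - P2 x\<bar> \<le> K * norm (y - x)" "\<bar>P1 y - P1 x - g x \<bullet> (y - x)\<bar> \<le> norm (y - x)"
      using K \<delta>(2) by auto
    moreover have "\<bar>g x \<bullet> (y - x)\<bar> \<le> norm (g x) * norm (y - x)" by (rule Cauchy_Schwarz_ineq2)
    ultimately show ?thesis by (simp add: distrib_right)
  qed
  then obtain v where v: "v \<in> frechet_subdiff (\<lambda>y. ereal (P1 y - P2 y)) x"
    using regular_frechet_subdiff_nonempty[OF reg contq r] by blast
  with frechet_subdiff_difference_unique[OF P1 \<zeta> v] show ?thesis by simp
qed

section \<open>Multipliers for convex problems with one constraint\<close>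

text \<open>The first-order condition for a convex function plus a differentiable one. The
  differentiability of \<open>h\<close> is given as an expansion along segments with a quadratic remainder, the form
  in which it is available for quadratic polynomials.\<close>

lemma subgrad_of_smooth_perturbation_minimiser:
  assumes conv: "convex_on UNIV f"
    and upper: "\<And>y t. 0 < t \<Longrightarrow> t \<le> 1 \<Longrightarrow> h (x + t *\<^sub>R (y - x)) \<le> h x + t * (u \<bullet> (y - x)) + t\<^sup>2 * c y"
    and min: "\<And>y. f x + h x \<le> f y + h y"
  shows "- u \<in> subgrad f x"
proof -
  have "f x - u \<bullet> (y - x) \<le> f y" for y
  proof (rule field_le_epsilon)
    fix e :: real assume e: "e > 0"
    define t where "t = min 1 (e / (\<bar>c y\<bar> + 1))"
    have t: "0 < t" "t \<le> 1" using e by (auto simp: t_def add_nonneg_pos)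
    have "t * c y \<le> t * \<bar>c y\<bar>" using t by (intro mult_left_mono) auto
    also have "\<dots> \<le> e / (\<bar>c y\<bar> + 1) * \<bar>c y\<bar>" by (intro mult_right_mono) (auto simp: t_def)
    also have "\<dots> \<le> e" using e by (simp add: field_simps add_nonneg_pos)
    finally have tc: "t * c y \<le> e" .
    have "f (x + t *\<^sub>R (y - x)) \<le> (1 - t) * f x + t * f y"
      using convex_onD[OF conv, of t x y] t by (simp add: algebra_simps)
    with min[of "x + t *\<^sub>R (y - x)"] upper[OF t, of y]
    have "t * (f x - u \<bullet> (y - x)) \<le> t * (f y + t * c y)"
      by (simp add: algebra_simps power2_eq_square)
    then have "f x - u \<bullet> (y - x) \<le> f y + t * c y" using t by simp
    with tc show "f x - u \<bullet> (y - x) \<le> f y + e" by linarith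
  qed
  then show ?thesis by (simp add: subgrad_def)
qed

text \<open>The convex set of all \<open>(r, s)\<close> that some \<open>y\<close> beats, strictly in the objective and weakly
  in the constraint, does not contain the origin. A separating line has nonnegative coefficients, and the
  Slater point excludes a vanishing coefficient of the objective; its normalised other coefficient is
  the multiplier.\<close>

lemma slater_multiplier:
  fixes \<phi> g :: "'a::real_vector \<Rightarrow> real"
  assumes \<phi>: "convex_on UNIV \<phi>" and g: "convex_on UNIV g"
    and slater: "g x0 < 0" and feas: "g xs \<le> 0" and min: "\<And>y. g y \<le> 0 \<Longrightarrow> \<phi> xs \<le> \<phi> y"
  obtains lam where "lam \<ge> 0" "lam * g xs = 0" "\<And>y. \<phi> xs \<le> \<phi> y + lam * g y"
proof -
  define A where "A = {(r, s). \<exists>y. \<phi> y - \<phi> xs < r \<and> g y \<le> s}"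
  have A: "convex A"
  proof (rule convexI, clarify)
    fix r s r' s' u v :: real
    assume *: "(r, s) \<in> A" "(r', s') \<in> A" "0 \<le> u" "0 \<le> v" "u + v = 1"
    then obtain y y' where y: "\<phi> y - \<phi> xs < r" "g y \<le> s" "\<phi> y' - \<phi> xs < r'" "g y' \<le> s'"
      by (auto simp: A_def)
    let ?y = "u *\<^sub>R y + v *\<^sub>R y'"
    have "\<phi> ?y \<le> u * \<phi> y + v * \<phi> y'" "g ?y \<le> u * g y + v * g y'"
      using \<phi> g * by (auto simp: convex_on_def)
    moreover have "u * \<phi> y + v * \<phi> y' - \<phi> xs < u * r + v * r'"
    proof -
      have "u * (\<phi> y - \<phi> xs) + v * (\<phi> y' - \<phi> xs) < u * r + v * r'"
      proof (cases "u = 0")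
        case False
        then show ?thesis using y * by (intro add_less_le_mono mult_strict_left_mono mult_left_mono) auto
      qed (use y * in auto)
      moreover have "\<phi> xs = u * \<phi> xs + v * \<phi> xs" using * by (metis distrib_right mult_1)
      ultimately show ?thesis by (simp add: right_diff_distrib)
    qed
    moreover have "u * g y + v * g y' \<le> u * s + v * s'"
      using y * by (intro add_mono mult_left_mono) auto
    ultimately show "u *\<^sub>R (r, s) + v *\<^sub>R (r', s') \<in> A"
      by (auto simp: A_def intro!: exI[of _ ?y])
  qed
  have "(0, 0) \<notin> A" using min by (force simp: A_def)
  moreover have "(1, g xs) \<in> A" by (auto simp: A_def intro!: exI[of _ xs])
  ultimately have "{(0, 0)} \<inter> A = {}" "A \<noteq> {}" by auto
  then obtain a b where ab: "a \<noteq> 0" "\<forall>p\<in>{(0, 0)}. a \<bullet> p \<le> b" "\<forall>p\<in>A. b \<le> a \<bullet> p"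
    using separating_hyperplane_sets[OF convex_singleton A, of "(0, 0)"] by auto
  obtain m k where a: "a = (m, k)" by (cases a)
  have sep: "0 \<le> m * r + k * s" if "(r, s) \<in> A" for r s
    using ab that by (force simp: a)
  have le: "0 \<le> m * (\<phi> y - \<phi> xs) + k * g y" for y
  proof (rule field_le_epsilon)
    fix e :: real assume e: "e > 0"
    define d where "d = e / (\<bar>m\<bar> + 1)"
    have d: "d > 0" using e by (simp add: d_def)
    have "0 \<le> m * (\<phi> y - \<phi> xs + d) + k * g y" using d by (intro sep) (auto simp: A_def intro!: exI[of _ y])
    moreover have "m * d \<le> \<bar>m\<bar> * d" using d by (intro mult_right_mono) auto
    moreover have "\<bar>m\<bar> * d \<le> e" using e by (simp add: d_def field_simps)
    ultimately show "0 \<le> m * (\<phi> y - \<phi> xs) + k * g y + e" unfolding distrib_left by linarith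
  qed
  have m0: "m \<ge> 0"
  proof (rule ccontr)
    assume "\<not> m \<ge> 0"
    \<comment> \<open>A first coordinate so large that a negative \<open>m\<close> would violate the separation.\<close>
    define r where "r = 1 + \<bar>k * g xs\<bar> / \<bar>m\<bar>"
    have "(r, g xs) \<in> A" by (auto simp: A_def r_def add_pos_nonneg intro!: exI[of _ xs])
    from sep[OF this] have "0 \<le> m * r + k * g xs" .
    moreover have "m * r = m - \<bar>k * g xs\<bar>" using \<open>\<not> m \<ge> 0\<close> by (simp add: r_def field_simps)
    ultimately show False using \<open>\<not> m \<ge> 0\<close> by linarith
  qed
  have k0: "k \<ge> 0"
  proof (rule ccontr)
    assume "\<not> k \<ge> 0"
    \<comment> \<open>A slack so large that a negative \<open>k\<close> would violate the separation.\<close>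
    define s where "s = (m + 1) / \<bar>k\<bar>"
    have "s \<ge> 0" using m0 by (simp add: s_def)
    then have "(1, s) \<in> A" using feas by (auto simp: A_def intro!: exI[of _ xs])
    from sep[OF this] have "0 \<le> m + k * s" by simp
    moreover have "k * s = - (m + 1)" using \<open>\<not> k \<ge> 0\<close> by (simp add: s_def field_simps)
    ultimately show False by simp
  qed
  have m: "m > 0"
  proof (rule ccontr)
    assume "\<not> m > 0"
    then have "m = 0" using m0 by simp
    then have "k > 0" using ab(1) k0 by (auto simp: a zero_prod_def)
    then show False using le[of x0] slater \<open>m = 0\<close> by (simp add: zero_le_mult_iff)
  qed
  show ?thesis
  proof (rule that[of "k / m"])
    show "0 \<le> k / m" using k0 m by simp
    show "k / m * g xs = 0"
      using le[of xs] feas k0 m by (auto simp: zero_le_mult_iff)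
    show "\<phi> xs \<le> \<phi> y + k / m * g y" for y
      using le[of y] m by (simp add: field_simps)
  qed
qed

section \<open>The l1/l2 ratio\<close>

lemma convex_on_l1_norm: "convex_on UNIV l1_norm"
proof (rule convex_onI)
  fix t :: real and x y :: "real^'n"
  assume t: "0 < t" "t < 1"
  have "\<bar>(1 - t) * x $ i + t * y $ i\<bar> \<le> (1 - t) * \<bar>x $ i\<bar> + t * \<bar>y $ i\<bar>" for i
    using t abs_triangle_ineq[of "(1 - t) * x $ i" "t * y $ i"] by (simp add: abs_mult)
  then show "l1_norm ((1 - t) *\<^sub>R x + t *\<^sub>R y) \<le> (1 - t) * l1_norm x + t * l1_norm y"
    unfolding l1_norm_def sum_distrib_left sum.distrib[symmetric] by (intro sum_mono) auto
qed auto

lemma continuous_on_l1_norm [continuous_intros]: "continuous_on S l1_norm"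
  unfolding l1_norm_def by (intro continuous_intros)

lemma l1_norm_triangle_lipschitz:
  fixes x y :: "real^'n"
  shows "l1_norm y - l1_norm x \<le> CARD('n) * norm (y - x)"
proof -
  have "\<bar>y $ i\<bar> - \<bar>x $ i\<bar> \<le> norm (y - x)" for i
    using component_le_norm_cart[of "y - x" i] by simp
  then have "(\<Sum>i\<in>UNIV. \<bar>y $ i\<bar> - \<bar>x $ i\<bar>) \<le> (\<Sum>i\<in>(UNIV::'n set). norm (y - x))"
    by (intro sum_mono) auto
  then show ?thesis by (simp add: l1_norm_def sum_subtractf)
qed

lemma l1_norm_nonneg: "0 \<le> l1_norm x"
  by (simp add: l1_norm_def sum_nonneg)

lemma l1_l2_nonneg: "0 \<le> l1_l2 x"
  by (simp add: l1_l2_def l1_norm_nonneg)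

lemma tendsto_l1_norm: "X \<longlonglongrightarrow> x \<Longrightarrow> (\<lambda>t. l1_norm (X t)) \<longlonglongrightarrow> l1_norm x"
  by (rule continuous_on_tendsto_compose[OF continuous_on_l1_norm[of UNIV]]) auto

lemma tendsto_l1_l2: "X \<longlonglongrightarrow> x \<Longrightarrow> x \<noteq> 0 \<Longrightarrow> (\<lambda>t. l1_l2 (X t)) \<longlonglongrightarrow> l1_l2 x"
  unfolding l1_l2_def by (intro tendsto_intros tendsto_l1_norm) auto

text \<open>The map \<open>x \<mapsto> (l1_l2 x / norm x) x\<close> is Lipschitz continuous away from the origin; the
  change is split into that of the ratio and that of the direction \<open>x / norm x\<close>. Only the case in which
  the ratio decreases from \<open>Y\<close> to \<open>X\<close> is treated, since that spares an absolute value.\<close>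

lemma l1_l2_direction_lipschitz:
  fixes X Y :: "real^'n"
  assumes \<rho>: "\<rho> > 0" "\<rho> \<le> norm X" "\<rho> \<le> norm Y" and le: "l1_l2 X \<le> l1_l2 Y"
  shows "norm ((l1_l2 Y / norm Y) *\<^sub>R Y - (l1_l2 X / norm X) *\<^sub>R X)
      \<le> (CARD('n) + 3 * l1_l2 X) / \<rho> * norm (X - Y)"
proof -
  let ?d = "norm (X - Y)"
  have pos: "norm X > 0" "norm Y > 0" using \<rho> by linarith+
  have dn: "\<bar>norm X - norm Y\<bar> \<le> ?d" by (rule norm_triangle_ineq3)
  have "l1_l2 Y - l1_l2 X = (l1_norm Y - l1_norm X) / norm Y + l1_l2 X * ((norm X - norm Y) / norm Y)"
    using pos by (simp add: l1_l2_def field_simps)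
  also have "\<dots> \<le> CARD('n) * ?d / \<rho> + l1_l2 X * (?d / \<rho>)"
  proof (intro add_mono mult_left_mono)
    have "(l1_norm Y - l1_norm X) / norm Y \<le> (CARD('n) * ?d) / norm Y"
      using l1_norm_triangle_lipschitz[of Y X] pos by (intro divide_right_mono) (auto simp: norm_minus_commute)
    also have "\<dots> \<le> (CARD('n) * ?d) / \<rho>" using \<rho> pos by (intro divide_left_mono) auto
    finally show "(l1_norm Y - l1_norm X) / norm Y \<le> CARD('n) * ?d / \<rho>" .
    have "(norm X - norm Y) / norm Y \<le> ?d / norm Y" using dn pos by (intro divide_right_mono) auto
    also have "\<dots> \<le> ?d / \<rho>" using \<rho> pos by (intro divide_left_mono) auto
    finally show "(norm X - norm Y) / norm Y \<le> ?d / \<rho>" .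
  qed (rule l1_l2_nonneg)
  finally have 1: "l1_l2 Y - l1_l2 X \<le> (CARD('n) + l1_l2 X) / \<rho> * ?d"
    by (simp add: add_divide_distrib distrib_right)
  have "(1 / norm Y) *\<^sub>R Y - (1 / norm X) *\<^sub>R X
      = (1 / norm Y) *\<^sub>R (Y - X) + ((norm X - norm Y) / (norm Y * norm X)) *\<^sub>R X"
    using pos by (simp add: scaleR_diff_right diff_divide_distrib scaleR_diff_left)
  also have "norm \<dots> \<le> 1 / norm Y * ?d + \<bar>norm X - norm Y\<bar> / (norm Y * norm X) * norm X"
    using pos by (intro order_trans[OF norm_triangle_ineq]) (simp add: norm_minus_commute)
  also have "\<bar>norm X - norm Y\<bar> / (norm Y * norm X) * norm X = \<bar>norm X - norm Y\<bar> / norm Y"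
    using pos by simp
  also have "1 / norm Y * ?d + \<bar>norm X - norm Y\<bar> / norm Y \<le> 2 * (?d / norm Y)"
    using dn pos divide_right_mono[OF dn, of "norm Y"] by simp
  also have "\<dots> \<le> 2 * (?d / \<rho>)" using \<rho> pos by (intro mult_left_mono divide_left_mono) auto
  finally have 2: "norm ((1 / norm Y) *\<^sub>R Y - (1 / norm X) *\<^sub>R X) \<le> 2 * (?d / \<rho>)" .
  have "(l1_l2 Y / norm Y) *\<^sub>R Y - (l1_l2 X / norm X) *\<^sub>R X =
      (l1_l2 Y - l1_l2 X) *\<^sub>R ((1 / norm Y) *\<^sub>R Y) + l1_l2 X *\<^sub>R ((1 / norm Y) *\<^sub>R Y - (1 / norm X) *\<^sub>R X)"
    by (simp add: algebra_simps diff_divide_distrib)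
  also have "norm \<dots> \<le> (l1_l2 Y - l1_l2 X) * 1 + l1_l2 X * (2 * (?d / \<rho>))"
  proof (rule order_trans[OF norm_triangle_ineq add_mono])
    show "norm ((l1_l2 Y - l1_l2 X) *\<^sub>R ((1 / norm Y) *\<^sub>R Y)) \<le> (l1_l2 Y - l1_l2 X) * 1"
      using pos le by simp
    show "norm (l1_l2 X *\<^sub>R ((1 / norm Y) *\<^sub>R Y - (1 / norm X) *\<^sub>R X)) \<le> l1_l2 X * (2 * (?d / \<rho>))"
      using 2 l1_l2_nonneg[of X] by (simp only: norm_scaleR abs_of_nonneg) (rule mult_left_mono)
  qed
  also have "\<dots> \<le> (CARD('n) + l1_l2 X) / \<rho> * ?d + l1_l2 X * (2 * (?d / \<rho>))" using 1 by simp
  also have "\<dots> = (CARD('n) + 3 * l1_l2 X) / \<rho> * ?d"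
    using \<rho> by (simp add: field_simps)
  finally show ?thesis .
qed

text \<open>A subgradient \<open>s\<close> of the 1-norm gives an affine minorant of the numerator, hence a
  minorant of the ratio that is differentiable away from the origin. The last two facts about this
  minorant are stated because it reappears inside a minorant of the potential function.\<close>

lemma frechet_subdiff_l1_l2:
  fixes x s :: "real^'n"
  assumes s: "s \<in> subgrad l1_norm x" and x: "x \<noteq> 0"
  shows "(1 / norm x) *\<^sub>R (s - (l1_l2 x / norm x) *\<^sub>R x) \<in> frechet_subdiff (\<lambda>y. ereal (l1_l2 y)) x"
    and "((\<lambda>y. (l1_norm x + s \<bullet> (y - x)) / norm y) has_derivative
      (\<lambda>d. ((1 / norm x) *\<^sub>R (s - (l1_l2 x / norm x) *\<^sub>R x)) \<bullet> d)) (at x)" (is ?D)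
    and "(l1_norm x + s \<bullet> (y - x)) / norm y \<le> l1_l2 y"
proof -
  show le: "(l1_norm x + s \<bullet> (y - x)) / norm y \<le> l1_l2 y" for y
    using s by (auto simp: subgrad_def l1_l2_def intro!: divide_right_mono)
  have norm': "(norm has_derivative (\<lambda>d. d \<bullet> sgn x)) (at x)"
    using has_derivative_norm[OF x] by (simp add: inner_commute)
  show D: ?D
    using x by (auto intro!: derivative_eq_intros norm'
      simp: fun_eq_iff l1_l2_def sgn_div_norm inner_diff_left inner_diff_right field_simps power2_eq_square inner_commute)
  show "(1 / norm x) *\<^sub>R (s - (l1_l2 x / norm x) *\<^sub>R x) \<in> frechet_subdiff (\<lambda>y. ereal (l1_l2 y)) x"
    by (rule frechet_subdiff_minorant[OF frechet_subdiff_differentiable[OF D]]) (use le in \<open>auto simp: l1_l2_def\<close>)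
qed

section \<open>The subproblem of one iteration\<close>

lemma quadratic_along_segment:
  fixes b x xt d :: "'a::real_inner" and k a :: real
  defines "h \<equiv> \<lambda>x. k + b \<bullet> (x - xt) + a / 2 * (norm (x - xt))\<^sup>2"
  shows "h (x + t *\<^sub>R d) = h x + t * ((b + a *\<^sub>R (x - xt)) \<bullet> d) + t\<^sup>2 * (a / 2 * (norm d)\<^sup>2)"
  unfolding h_def power2_norm_eq_inner
  by (simp add: inner_commute algebra_simps power2_eq_square add_divide_distrib)

lemma convex_on_quadratic:
  fixes b xt :: "'a::real_inner"
  assumes a: "a \<ge> 0"
  shows "convex_on UNIV (\<lambda>x. k + b \<bullet> (x - xt) + a / 2 * (norm (x - xt))\<^sup>2)" (is "convex_on _ ?h")
proof (rule convex_onI)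
  fix t :: real and x y :: 'a assume t: "0 < t" "t < 1"
  define h D Q where "h = ?h" and "D = (b + a *\<^sub>R (x - xt)) \<bullet> (y - x)" and "Q = a / 2 * (norm (y - x))\<^sup>2"
  have "h y = h x + D + Q"
    using quadratic_along_segment[of k b x 1 "y - x" xt a] by (simp add: h_def D_def Q_def)
  moreover have "h ((1 - t) *\<^sub>R x + t *\<^sub>R y) = h x + t * D + t\<^sup>2 * Q"
    using quadratic_along_segment[of k b x t "y - x" xt a] by (simp add: h_def D_def Q_def algebra_simps)
  moreover have "t\<^sup>2 * Q \<le> t * Q"
    using t a by (intro mult_right_mono) (auto simp: Q_def power2_eq_square mult_left_le)
  ultimately have "h ((1 - t) *\<^sub>R x + t *\<^sub>R y) \<le> (1 - t) * h x + t * h y"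
    by (simp add: algebra_simps)
  then show "?h ((1 - t) *\<^sub>R x + t *\<^sub>R y) \<le> (1 - t) * ?h x + t * ?h y"
    by (simp only: h_def)
qed auto

text \<open>The model constraint is a convex quadratic. It has a strictly feasible point: \<open>xt\<close> itself if
  \<open>q xt < 0\<close>, and otherwise a step from \<open>xt\<close> against the nonzero gradient of the model. The minimiser
  therefore minimises the Lagrangian, which is the 1-norm plus a quadratic.\<close>

lemma mba_subproblem_kkt:
  fixes xt xn \<zeta> :: "real^'n"
  assumes min: "is_arg_min (mba_objective \<alpha> \<omega> xt) (mba_feasible q gP1 xt \<zeta> l) xn"
    and \<alpha>: "\<alpha> > 0" and l: "l > 0" and feas: "q xt \<le> 0"
    and slater: "q xt = 0 \<Longrightarrow> gP1 xt \<noteq> \<zeta>"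
  obtains lam s where "lam \<ge> 0" "s \<in> subgrad l1_norm xn"
    "lam * (q xt + (gP1 xt - \<zeta>) \<bullet> (xn - xt) + l / 2 * (norm (xn - xt))\<^sup>2) = 0"
    "s - (\<omega> / norm xt) *\<^sub>R xt + \<alpha> *\<^sub>R (xn - xt) + lam *\<^sub>R (gP1 xt - \<zeta> + l *\<^sub>R (xn - xt)) = 0"
proof -
  define v where "v = gP1 xt - \<zeta>"
  define g where "g x = q xt + v \<bullet> (x - xt) + l / 2 * (norm (x - xt))\<^sup>2" for x
  define b where "b = - (\<omega> / norm xt) *\<^sub>R xt"
  define h where "h x = b \<bullet> xt + b \<bullet> (x - xt) + \<alpha> / 2 * (norm (x - xt))\<^sup>2" for x
  have obj: "mba_objective \<alpha> \<omega> xt x = l1_norm x + h x" for x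
    by (simp add: mba_objective_def h_def b_def inner_diff_right inner_commute algebra_simps)
  have gq: "mba_feasible q gP1 xt \<zeta> l x \<longleftrightarrow> g x \<le> 0" for x
    by (simp add: mba_feasible_def g_def v_def)
  have xn: "g xn \<le> 0" and opt: "\<And>y. g y \<le> 0 \<Longrightarrow> l1_norm xn + h xn \<le> l1_norm y + h y"
    using min by (auto simp: is_arg_min_def gq obj not_less)
  have "\<exists>x0. g x0 < 0"
  proof (cases "q xt = 0")
    case True
    with slater have v: "v \<noteq> 0" by (simp add: v_def)
    \<comment> \<open>The unconstrained minimiser of the model.\<close>
    have "g (xt - (1 / l) *\<^sub>R v) = - (norm v)\<^sup>2 / (2 * l)"
      using l True by (simp add: g_def power2_norm_eq_inner[symmetric] field_simps power2_eq_square)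
    also have "\<dots> < 0" using v l by simp
    finally show ?thesis by blast
  next
    case False
    then have "g xt < 0" using feas by (simp add: g_def)
    then show ?thesis by blast
  qed
  then obtain x0 where "g x0 < 0" by blast
  moreover have "convex_on UNIV (\<lambda>x. l1_norm x + h x)"
    unfolding h_def using \<alpha> by (intro convex_on_add convex_on_l1_norm convex_on_quadratic) auto
  moreover have "convex_on UNIV g"
    unfolding g_def using l by (intro convex_on_quadratic) auto
  ultimately obtain lam where lam: "lam \<ge> 0" "lam * g xn = 0"
      "\<And>y. l1_norm xn + h xn \<le> l1_norm y + h y + lam * g y"
    using slater_multiplier[of "\<lambda>x. l1_norm x + h x" g x0 xn] xn opt by blast
  have "- (b + \<alpha> *\<^sub>R (xn - xt) + lam *\<^sub>R (v + l *\<^sub>R (xn - xt))) \<in> subgrad l1_norm xn"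
  proof (rule subgrad_of_smooth_perturbation_minimiser[OF convex_on_l1_norm, where h = "\<lambda>x. h x + lam * g x"])
    fix y and t :: real
    show "h (xn + t *\<^sub>R (y - xn)) + lam * g (xn + t *\<^sub>R (y - xn)) \<le> h xn + lam * g xn
      + t * ((b + \<alpha> *\<^sub>R (xn - xt) + lam *\<^sub>R (v + l *\<^sub>R (xn - xt))) \<bullet> (y - xn))
      + t\<^sup>2 * (\<alpha> / 2 * (norm (y - xn))\<^sup>2 + lam * (l / 2 * (norm (y - xn))\<^sup>2))"
      unfolding g_def h_def quadratic_along_segment by (simp add: algebra_simps)
  next
    show "l1_norm xn + (h xn + lam * g xn) \<le> l1_norm y + (h y + lam * g y)" for y
      using lam(3)[of y] by (simp add: lam(2) add.assoc)
  qed
  from that[OF lam(1) this] lam(2) show ?thesis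
    by (simp add: g_def v_def b_def algebra_simps)
qed

lemma gradient_lipschitz_upper_bound:
  fixes f :: "'a::euclidean_space \<Rightarrow> real"
  assumes f: "\<And>y. GDERIV f y :> g y" and lip: "L-lipschitz_on UNIV g"
  shows "f y \<le> f x + g x \<bullet> (y - x) + L / 2 * (norm (y - x))\<^sup>2"
proof -
  let ?d = "y - x"
  define u where "u t = f (x + t *\<^sub>R ?d) - t * (g x \<bullet> ?d) - L / 2 * t\<^sup>2 * (norm ?d)\<^sup>2" for t
  have der: "((\<lambda>t. f (x + t *\<^sub>R ?d)) has_real_derivative g (x + t *\<^sub>R ?d) \<bullet> ?d) (at t)" for t
  proof -
    have "(f has_derivative (\<lambda>h. g (x + t *\<^sub>R ?d) \<bullet> h)) (at (x + t *\<^sub>R ?d))"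
      using f[of "x + t *\<^sub>R ?d"] by (simp add: gderiv_def inner_commute)
    then have "((\<lambda>t. f (x + t *\<^sub>R ?d)) has_derivative (\<lambda>s. g (x + t *\<^sub>R ?d) \<bullet> (s *\<^sub>R ?d))) (at t)"
      by (rule has_derivative_compose[where f = "\<lambda>t. x + t *\<^sub>R ?d", rotated])
         (auto intro!: derivative_eq_intros)
    then show ?thesis
      unfolding has_field_derivative_def by (rule has_derivative_eq_rhs) (auto simp: fun_eq_iff)
  qed
  have "u 1 \<le> u 0"
  proof (rule DERIV_nonpos_imp_nonincreasing[of 0 1 u])
    fix t :: real assume t: "0 \<le> t" "t \<le> 1"
    have "(u has_real_derivative g (x + t *\<^sub>R ?d) \<bullet> ?d - g x \<bullet> ?d - L * t * (norm ?d)\<^sup>2) (at t)"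
      unfolding u_def by (auto intro!: derivative_eq_intros der)
    moreover have "g (x + t *\<^sub>R ?d) \<bullet> ?d - g x \<bullet> ?d \<le> L * t * (norm ?d)\<^sup>2"
    proof -
      have "(g (x + t *\<^sub>R ?d) - g x) \<bullet> ?d \<le> norm (g (x + t *\<^sub>R ?d) - g x) * norm ?d"
        by (rule norm_cauchy_schwarz)
      also have "\<dots> \<le> (L * norm (t *\<^sub>R ?d)) * norm ?d"
        using lipschitz_onD[OF lip, of "x + t *\<^sub>R ?d" x] by (intro mult_right_mono) (auto simp: dist_norm)
      finally show ?thesis using t by (simp add: inner_diff_left power2_eq_square mult.assoc)
    qed
    ultimately show "\<exists>y. (u has_real_derivative y) (at t) \<and> y \<le> 0" by (intro exI conjI) auto
  qed simp
  then show ?thesis by (simp add: u_def)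
qed

section \<open>The Kurdyka-Lojasiewicz inequality along a bounded sequence\<close>

definition cluster_point :: "(nat \<Rightarrow> 'a::topological_space) \<Rightarrow> 'a \<Rightarrow> bool" where
  "cluster_point z p \<longleftrightarrow> (\<exists>r. strict_mono r \<and> (z \<circ> r) \<longlonglongrightarrow> p)"

lemma cluster_pointI_frequently:
  fixes z :: "nat \<Rightarrow> 'a::metric_space"
  assumes "\<And>V. open V \<Longrightarrow> p \<in> V \<Longrightarrow> \<exists>\<^sub>F t in sequentially. z t \<in> V"
  shows "cluster_point z p"
proof -
  have ex: "\<exists>t>N. dist (z t) p < 1 / real (Suc n)" for n N
    using assms[of "ball p (1 / real (Suc n))"]
    by (auto simp: frequently_sequentially dist_commute) (metis Suc_le_lessD)
  have "\<exists>r. \<forall>n. dist (z (r n)) p < 1 / real (Suc n) \<and> r n < r (Suc n)"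
    by (rule dependent_nat_choice) (use ex in blast)+
  then obtain r where r: "\<And>n. dist (z (r n)) p < 1 / real (Suc n)" "\<And>n. r n < r (Suc n)" by blast
  have "(\<lambda>n. dist (z (r n)) p) \<longlonglongrightarrow> 0"
    by (rule tendsto_sandwich[OF _ _ tendsto_const LIMSEQ_inverse_real_of_nat])
       (use r(1) in \<open>auto simp: inverse_eq_divide intro!: always_eventually less_imp_le\<close>)
  then have "(z \<circ> r) \<longlonglongrightarrow> p" by (subst tendsto_dist_iff) (simp add: o_def)
  with r(2) show ?thesis by (auto simp: cluster_point_def strict_mono_Suc_iff)
qed

text \<open>The closure of the range is compact. It is covered by the sets \<open>U p\<close> at the cluster points
  and, at all other points, by neighborhoods that the sequence eventually avoids.\<close>

lemma eventually_in_finite_cluster_cover: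
  fixes z :: "nat \<Rightarrow> 'a::heine_borel"
  assumes bdd: "bounded (range z)"
    and U: "\<And>p. cluster_point z p \<Longrightarrow> open (U p) \<and> p \<in> U p"
  obtains J where "finite J" "\<And>p. p \<in> J \<Longrightarrow> cluster_point z p"
    "\<forall>\<^sub>F t in sequentially. \<exists>p\<in>J. z t \<in> U p"
proof -
  have "\<exists>V. open V \<and> p \<in> V \<and> (\<forall>\<^sub>F t in sequentially. z t \<notin> V)" if "\<not> cluster_point z p" for p
    using cluster_pointI_frequently[of p z] that by (auto simp: frequently_def)
  then obtain V where V: "\<And>p. \<not> cluster_point z p \<Longrightarrow>
      open (V p) \<and> p \<in> V p \<and> (\<forall>\<^sub>F t in sequentially. z t \<notin> V p)" by metis
  define W where "W p = (if cluster_point z p then U p else V p)" for p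
  have W: "open (W p)" "p \<in> W p" for p using U V by (auto simp: W_def)
  have "compact (closure (range z))" using bdd by (simp add: compact_closure)
  then obtain D where D: "D \<subseteq> closure (range z)" "finite D" "closure (range z) \<subseteq> (\<Union>p\<in>D. W p)"
    using W by (elim compactE_image[where C = "closure (range z)" and f = W]) blast+
  have "\<forall>\<^sub>F t in sequentially. \<forall>p\<in>{p\<in>D. \<not> cluster_point z p}. z t \<notin> V p"
    using D(2) V by (subst eventually_ball_finite_distrib) auto
  then have "\<forall>\<^sub>F t in sequentially. \<exists>p\<in>{p\<in>D. cluster_point z p}. z t \<in> U p"
  proof eventually_elim
    case (elim t)
    have "z t \<in> closure (range z)" using closure_subset[of "range z"] by auto
    then obtain p where "p \<in> D" "z t \<in> W p" using D(3) by blast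
    with elim show ?case by (auto simp: W_def split: if_splits)
  qed
  with D(2) show ?thesis by (intro that[of "{p\<in>D. cluster_point z p}"]) auto
qed

text \<open>The tangent at \<open>s\<close> lies above the concave function. This holds up to the endpoint
  \<open>s' = 0\<close>, where the function need not be differentiable.\<close>

lemma desingularizing_tangent:
  assumes des: "desingularizing a \<phi>" and s: "0 < s" "ereal s < a" and s': "0 \<le> s'" "s' \<le> s"
  shows "deriv \<phi> s * (s - s') \<le> \<phi> s - \<phi> s'"
proof -
  let ?S = "{\<nu>. 0 \<le> \<nu> \<and> ereal \<nu> < a}"
  obtain b where b: "s < b" "ereal b < a"
    using ereal_dense2[OF s(2)] by auto
  have "s \<in> interior ?S"
  proof (rule interiorI[of "{0<..<b}"])
    show "{0<..<b} \<subseteq> ?S" using b(2) by (auto intro: less_trans[of "ereal _" "ereal b"])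
  qed (use s b in auto)
  moreover have "connected ?S"
    by (rule is_interval_connected) (auto simp: is_interval_1 intro: le_less_trans[of "ereal _" "ereal _"])
  moreover have "convex_on ?S (\<lambda>\<nu>. - \<phi> \<nu>)" using des by (simp add: desingularizing_def concave_on_def)
  moreover have "s' \<in> ?S" using s s' by (auto intro: le_less_trans[of "ereal _" "ereal _"])
  moreover have "((\<lambda>\<nu>. - \<phi> \<nu>) has_field_derivative - deriv \<phi> s) (at s within ?S)"
  proof -
    have "\<phi> field_differentiable at s" using des s by (auto simp: desingularizing_def)
    then have "(\<phi> has_field_derivative deriv \<phi> s) (at s)" by (simp add: field_differentiable_derivI)
    then show ?thesis by (rule DERIV_minus[OF has_field_derivative_at_within])
  qed
  ultimately have "- \<phi> s' - - \<phi> s \<ge> - deriv \<phi> s * (s' - s)"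
    using convex_on_imp_above_tangent[of ?S "\<lambda>\<nu>. - \<phi> \<nu>" s s' "- deriv \<phi> s"] by blast
  then show ?thesis by (simp add: algebra_simps)
qed

text \<open>All cluster points share the value \<open>ws\<close>, so their desingularizing functions are evaluated at
  the same argument. As the derivatives are positive, the inequality at one of finitely many cluster
  points implies the one for the sum of the functions.\<close>

lemma uniformized_KL:
  fixes h :: "'a::euclidean_space \<Rightarrow> ereal" and z v :: "nat \<Rightarrow> 'a"
  assumes bdd: "bounded (range z)"
    and hz: "\<And>t. h (z t) = ereal (w t)" and w: "w \<longlonglongrightarrow> ws"
    and v: "\<And>t. v t \<in> limiting_subdiff h (z t)"
    and cl: "\<And>p. cluster_point z p \<Longrightarrow> h p = ereal ws \<and> KL_property_via h p (a p) (\<phi> p)"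
  obtains J a0 where "finite J" "\<And>p. p \<in> J \<Longrightarrow> cluster_point z p" "\<And>p. p \<in> J \<Longrightarrow> ereal a0 \<le> a p"
    "\<forall>\<^sub>F t in sequentially. w t - ws < a0 \<and>
       (ws < w t \<longrightarrow> 1 \<le> (\<Sum>p\<in>J. deriv (\<phi> p) (w t - ws)) * norm (v t))"
proof -
  have "\<exists>U. open U \<and> p \<in> U \<and> KL_inequality h p (a p) U (\<phi> p)" if "cluster_point z p" for p
    using cl[OF that] by (auto simp: KL_property_via_def)
  then obtain U where U: "\<And>p. cluster_point z p \<Longrightarrow>
      open (U p) \<and> p \<in> U p \<and> KL_inequality h p (a p) (U p) (\<phi> p)" by metis
  obtain J where J: "finite J" "\<And>p. p \<in> J \<Longrightarrow> cluster_point z p"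
      "\<forall>\<^sub>F t in sequentially. \<exists>p\<in>J. z t \<in> U p"
    using eventually_in_finite_cluster_cover[OF bdd, of U] U by blast
  have a: "0 < a p" "desingularizing (a p) (\<phi> p)" if "p \<in> J" for p
    using cl[OF J(2)[OF that]] by (auto simp: KL_property_via_def)
  have "\<exists>a0>0. \<forall>p\<in>J. ereal a0 \<le> a p"
    using J(1) a(1)
  proof (induction J rule: finite_induct)
    case (insert q J)
    then obtain a0 where a0: "a0 > 0" "\<forall>p\<in>J. ereal a0 \<le> a p" by auto
    obtain b where b: "0 < ereal b" "ereal b < a q" using insert.prems ereal_dense2[of 0 "a q"] by auto
    have "\<forall>p\<in>insert q J. ereal (min a0 b) \<le> a p"
      using a0(2) b(2) by (auto simp: min_def intro: order_trans)
         (metis ereal_less_eq(3) linear order_trans less_imp_le)+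
    then show ?case using a0(1) b(1) by (intro exI[of _ "min a0 b"]) auto
  qed (auto intro: exI[of _ 1])
  then obtain a0 where a0: "a0 > 0" "\<And>p. p \<in> J \<Longrightarrow> ereal a0 \<le> a p" by blast
  have "\<forall>\<^sub>F t in sequentially. w t < ws + a0"
    using order_tendstoD(2)[OF w, of "ws + a0"] a0(1) by simp
  with J(3) have "\<forall>\<^sub>F t in sequentially. w t - ws < a0 \<and>
       (ws < w t \<longrightarrow> 1 \<le> (\<Sum>p\<in>J. deriv (\<phi> p) (w t - ws)) * norm (v t))"
  proof eventually_elim
    case (elim t)
    have "1 \<le> (\<Sum>p\<in>J. deriv (\<phi> p) (w t - ws)) * norm (v t)" if t: "ws < w t"
    proof -
      obtain p where p: "p \<in> J" "z t \<in> U p" using elim by blast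
      have pos: "0 < deriv (\<phi> q) (w t - ws)" if "q \<in> J" for q
      proof -
        have "ereal (w t - ws) < a q"
          using elim(2) less_le_trans[OF _ a0(2)[OF that], of "ereal (w t - ws)"] by simp
        then show ?thesis using a(2)[OF that] t by (auto simp: desingularizing_def)
      qed
      have hp: "h p = ereal ws" using cl J(2) p by blast
      have "ereal (w t) < ereal ws + ereal a0" using elim(2) by simp
      also have "\<dots> \<le> ereal ws + a p" using a0(2)[OF p(1)] by (intro add_left_mono)
      finally have "1 \<le> ereal (deriv (\<phi> p) (w t - ws)) * (INF u\<in>limiting_subdiff h (z t). ereal (dist 0 u))"
        using U[OF J(2)[OF p(1)]] p(2) t hp hz[of t] by (auto simp: KL_inequality_def)
      also have "\<dots> \<le> ereal (deriv (\<phi> p) (w t - ws)) * ereal (dist 0 (v t))"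
        using pos[OF p(1)] v[of t] by (intro ereal_mult_left_mono INF_lower) auto
      finally have "1 \<le> deriv (\<phi> p) (w t - ws) * norm (v t)" by (simp add: one_ereal_def)
      also have "\<dots> \<le> (\<Sum>p\<in>J. deriv (\<phi> p) (w t - ws)) * norm (v t)"
        using J(1) p(1) pos by (intro mult_right_mono member_le_sum) (auto intro: less_imp_le)
      finally show ?thesis .
    qed
    then show ?case using elim by auto
  qed
  with J(1,2) a0(2) show ?thesis by (rule that)
qed

section \<open>Rates from recursive inequalities\<close>

text \<open>The quantity \<open>(sum of the n steps after t) + d (t + n) + \<Phi> (t + n)\<close> does not increase with
  \<open>n\<close>.\<close>

lemma halving_recursion:
  fixes d \<Phi> :: "nat \<Rightarrow> real"
  assumes d: "\<And>t. 0 \<le> d t" and \<Phi>: "\<And>t. T \<le> t \<Longrightarrow> 0 \<le> \<Phi> t"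
    and rec: "\<And>t. T \<le> t \<Longrightarrow> d (Suc t) \<le> (d t + (\<Phi> t - \<Phi> (Suc t))) / 2"
  shows "summable d" and "T \<le> t \<Longrightarrow> (\<Sum>i. d (i + Suc t)) \<le> d t + \<Phi> t"
proof -
  have partial: "(\<Sum>i<n. d (i + Suc t)) \<le> d t + \<Phi> t" if t: "T \<le> t" for t n
  proof -
    have "(\<Sum>i<n. d (i + Suc t)) + d (n + t) + \<Phi> (n + t) \<le> d t + \<Phi> t"
    proof (induction n)
      case (Suc n)
      then show ?case using rec[of "n + t"] t by simp
    qed simp
    then show ?thesis using d[of "n + t"] \<Phi>[of "n + t"] t by simp
  qed
  have sum: "summable (\<lambda>i. d (i + Suc t))" if "T \<le> t" for t
    by (rule summableI_nonneg_bounded[OF d partial[OF that]])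
  from sum[of T] show "summable d" using summable_iff_shift[of d "Suc T"] by simp
  show "T \<le> t \<Longrightarrow> (\<Sum>i. d (i + Suc t)) \<le> d t + \<Phi> t"
    by (rule suminf_le_const[OF sum partial])
qed

lemma geometric_rate:
  fixes S :: "nat \<Rightarrow> real"
  assumes K: "K > 0" and rec: "\<And>t. T \<le> t \<Longrightarrow> S (Suc t) \<le> K * (S t - S (Suc t))"
    and pos: "\<And>t. 0 \<le> S t"
  shows "\<exists>c Q T. c > 0 \<and> Q \<in> {0<..<1} \<and> (\<forall>t>T. S t \<le> c * Q ^ t)"
proof -
  define Q where "Q = K / (1 + K)"
  have Q: "0 < Q" "Q < 1" using K by (auto simp: Q_def)
  have step: "S (Suc t) \<le> Q * S t" if "T \<le> t" for t
    using rec[OF that] K by (simp add: Q_def field_simps)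
  have "S (n + T) \<le> (S T + 1) / Q ^ T * Q ^ (n + T)" for n
  proof (induction n)
    case (Suc n)
    have "S (Suc n + T) \<le> Q * S (n + T)" using step[of "n + T"] by simp
    also have "\<dots> \<le> Q * ((S T + 1) / Q ^ T * Q ^ (n + T))" using Q Suc by (intro mult_left_mono) auto
    finally show ?case by (simp add: mult_ac)
  qed (use Q in simp)
  then have "\<forall>t>T. S t \<le> (S T + 1) / Q ^ T * Q ^ t"
    by (metis less_imp_le le_add_diff_inverse2)
  moreover have "(S T + 1) / Q ^ T > 0" using Q pos[of T] by (simp add: add_nonneg_pos)
  ultimately show ?thesis using Q
    by (intro exI[of _ "(S T + 1) / Q ^ T"] exI[of _ Q] exI[of _ T]) auto
qed

text \<open>The recursion discretises \<open>S' = - S^p / K\<close>, along which \<open>S powr (1 - p)\<close> grows linearly. Growth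
  by at least \<open>\<mu>\<close> per step is proved in two cases: if \<open>S\<close> is at most halved, the powers of \<open>S t\<close> and
  \<open>S (t + 1)\<close> are comparable and \<open>ln u \<ge> 1 - 1 / u\<close> gives the growth; if \<open>S\<close> drops by more than
  half, \<open>S powr (1 - p)\<close> is multiplied by more than \<open>2 powr (p - 1)\<close>.\<close>

lemma sublinear_rate:
  fixes S :: "nat \<Rightarrow> real"
  assumes p: "p > 1" and K: "K > 0" and pos: "\<And>t. T \<le> t \<Longrightarrow> 0 < S t"
    and rec: "\<And>t. T \<le> t \<Longrightarrow> S (Suc t) powr p \<le> K * (S t - S (Suc t))"
  shows "\<exists>c T. c > 0 \<and> (\<forall>t>T. S t \<le> c * real t powr (- (1 / (p - 1))))"
proof -
  define \<beta> where "\<beta> = p - 1"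
  have \<beta>: "\<beta> > 0" using p by (simp add: \<beta>_def)
  have dec: "S (Suc t) \<le> S t" if "T \<le> t" for t
  proof -
    have "0 \<le> S (Suc t) powr p" by simp
    then have "0 \<le> K * (S t - S (Suc t))" using rec[OF that] by linarith
    then show ?thesis using K by (simp add: zero_le_mult_iff)
  qed
  have decT: "S t \<le> S T" if "T \<le> t" for t
    using that by (induction t rule: dec_induct) (use dec order_trans in auto)
  define \<mu> where "\<mu> = min (\<beta> / (2 powr p * K)) ((2 powr \<beta> - 1) * S T powr (- \<beta>))"
  have "1 < (2::real) powr \<beta>" using \<beta> by simp
  then have \<mu>: "\<mu> > 0" using \<beta> K pos[of T] by (simp add: \<mu>_def)
  have step: "S t powr (- \<beta>) + \<mu> \<le> S (Suc t) powr (- \<beta>)" if t: "T \<le> t" for t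
  proof -
    define a b where "a = S t" and "b = S (Suc t)"
    have ab: "0 < b" "b \<le> a" "0 < a" using pos[of t] pos[of "Suc t"] dec t by (auto simp: a_def b_def)
    have quot: "b powr (- \<beta>) = a powr (- \<beta>) * (a / b) powr \<beta>"
      using ab by (simp add: powr_divide powr_minus field_simps)
    show ?thesis
    proof (cases "a \<le> 2 * b")
      case True
      have "ln (b / a) \<le> b / a - 1" using ab by (intro ln_le_minus_one) auto
      then have "(a - b) / a \<le> ln (a / b)" using ab by (simp add: ln_div field_simps)
      then have "1 + \<beta> * ((a - b) / a) \<le> 1 + \<beta> * ln (a / b)"
        using \<beta> by (intro add_left_mono mult_left_mono) auto
      also have "\<dots> \<le> (a / b) powr \<beta>" using ab exp_ge_add_one_self[of "\<beta> * ln (a / b)"] by (simp add: powr_def)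
      finally have 1: "a powr (- \<beta>) * (1 + \<beta> * ((a - b) / a)) \<le> b powr (- \<beta>)"
        unfolding quot by (intro mult_left_mono) auto
      have "a powr p / 2 powr p = (a / 2) powr p" using ab by (simp add: powr_divide)
      also have "\<dots> \<le> b powr p" using True ab p by (intro powr_mono2) auto
      also have "\<dots> \<le> K * (a - b)" using rec[OF t] by (simp add: a_def b_def)
      finally have "a powr p / (2 powr p * K) \<le> a - b" using K by (simp add: field_simps)
      then have "\<beta> * a powr (- p) * (a powr p / (2 powr p * K)) \<le> \<beta> * a powr (- p) * (a - b)"
        using \<beta> by (intro mult_left_mono) auto
      moreover have "a powr (- p) * a powr p = 1" using ab by (simp add: powr_minus)
      ultimately have "\<beta> / (2 powr p * K) \<le> \<beta> * a powr (- p) * (a - b)"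
        by (simp add: mult.assoc)
      moreover have "a powr (- \<beta>) * (\<beta> * ((a - b) / a)) = \<beta> * a powr (- p) * (a - b)"
      proof -
        have "a powr (- \<beta>) = a powr (- p) * a" using ab powr_add[of a "- p" 1] by (simp add: \<beta>_def algebra_simps)
        then show ?thesis using ab by simp
      qed
      moreover have "\<mu> \<le> \<beta> / (2 powr p * K)" by (simp add: \<mu>_def)
      ultimately show ?thesis using 1 by (simp add: distrib_left a_def b_def)
    next
      case False
      then have "2 powr \<beta> \<le> (a / b) powr \<beta>" using ab \<beta> by (intro powr_mono2) (auto simp: field_simps)
      then have 1: "a powr (- \<beta>) * 2 powr \<beta> \<le> b powr (- \<beta>)" unfolding quot by (intro mult_left_mono) auto
      have "S T powr (- \<beta>) \<le> a powr (- \<beta>)"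
        using ab \<beta> decT[OF t] by (intro powr_mono2') (auto simp: a_def)
      then have "(2 powr \<beta> - 1) * S T powr (- \<beta>) \<le> (2 powr \<beta> - 1) * a powr (- \<beta>)"
        using \<open>1 < 2 powr \<beta>\<close> by (intro mult_left_mono) auto
      moreover have "\<mu> \<le> (2 powr \<beta> - 1) * S T powr (- \<beta>)" by (simp add: \<mu>_def)
      ultimately have "\<mu> \<le> (2 powr \<beta> - 1) * a powr (- \<beta>)" by linarith
      with 1 show ?thesis by (simp add: algebra_simps a_def b_def)
    qed
  qed
  have grow: "\<mu> * real n \<le> S (n + T) powr (- \<beta>)" for n
  proof (induction n)
    case (Suc n)
    then show ?case using step[of "n + T"] by (simp add: algebra_simps)
  qed simp
  have "S t \<le> (\<mu> / 2) powr (- (1 / \<beta>)) * real t powr (- (1 / \<beta>))" if t: "t > 2 * T" for t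
  proof -
    have "real t / 2 \<le> real (t - T)" using t by (simp add: of_nat_diff)
    then have "\<mu> * (real t / 2) \<le> \<mu> * real (t - T)" using \<mu> by simp
    also have "\<dots> \<le> S t powr (- \<beta>)" using grow[of "t - T"] t by simp
    finally have "(S t powr (- \<beta>)) powr (- (1 / \<beta>)) \<le> (\<mu> / 2 * real t) powr (- (1 / \<beta>))"
      using \<mu> \<beta> t by (intro powr_mono2') (auto simp: field_simps)
    moreover have "(S t powr (- \<beta>)) powr (- (1 / \<beta>)) = S t"
      using \<beta> pos[of t] t by (simp add: powr_powr)
    moreover have "(\<mu> / 2 * real t) powr (- (1 / \<beta>)) = (\<mu> / 2) powr (- (1 / \<beta>)) * real t powr (- (1 / \<beta>))"
      by (simp only: powr_mult)
    ultimately show ?thesis by simp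
  qed
  then show ?thesis using \<mu> unfolding \<beta>_def
    by (intro exI[of _ "(\<mu> / 2) powr (- (1 / (p - 1)))"] exI[of _ "2 * T"]) auto
qed

lemma steps_tendsto_0_of_descent:
  fixes w d :: "nat \<Rightarrow> real"
  assumes \<kappa>: "\<kappa> > 0" and w: "w \<longlonglongrightarrow> ws"
    and descent: "\<And>t. \<kappa> * (d (Suc t))\<^sup>2 \<le> w t - w (Suc t)" and d: "\<And>t. 0 \<le> d t"
  shows "d \<longlonglongrightarrow> 0"
proof -
  have "(\<lambda>t. (w t - w (Suc t)) / \<kappa>) \<longlonglongrightarrow> (ws - ws) / \<kappa>"
    using w LIMSEQ_Suc[OF w] \<kappa> by (intro tendsto_intros) auto
  then have lim: "(\<lambda>t. (w t - w (Suc t)) / \<kappa>) \<longlonglongrightarrow> 0" by simp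
  have "(d (Suc t))\<^sup>2 \<le> (w t - w (Suc t)) / \<kappa>" for t
    using descent[of t] \<kappa> by (simp add: field_simps)
  then have "(\<lambda>t. (d (Suc t))\<^sup>2) \<longlonglongrightarrow> 0"
    by (intro tendsto_sandwich[OF _ _ tendsto_const lim]) auto
  from tendsto_real_sqrt[OF this] d have "(\<lambda>t. d (Suc t)) \<longlonglongrightarrow> 0" by simp
  then show ?thesis by (rule LIMSEQ_imp_Suc)
qed

section \<open>Descent sequences under the Kurdyka-Lojasiewicz inequality\<close>

text \<open>A bounded sequence \<open>z\<close> along which \<open>h\<close> decreases quadratically in the step lengths \<open>d\<close> and has
  subgradients of the size of the steps. The shift is essential for the application: the subgradient at
  \<open>z t\<close> is controlled by \<open>d t\<close>, and the decrease from \<open>z t\<close> to \<open>z (t + 1)\<close> by \<open>d (t + 1)\<close>. The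
  distance of consecutive points of \<open>z\<close> is not controlled by \<open>d\<close>, so convergence is shown for the series
  of the \<open>d t\<close> and not for \<open>z\<close>.\<close>

locale kl_descent =
  fixes h :: "'a::euclidean_space \<Rightarrow> ereal" and z v :: "nat \<Rightarrow> 'a" and w d :: "nat \<Rightarrow> real" and ws C \<kappa> :: real
  assumes bounded_z: "bounded (range z)"
    and h_z: "\<And>t. h (z t) = ereal (w t)"
    and w_tendsto: "w \<longlonglongrightarrow> ws"
    and v_subdiff: "\<And>t. v t \<in> limiting_subdiff h (z t)"
    and v_bound: "\<And>t. norm (v t) \<le> C * d t"
    and d_nonneg: "\<And>t. 0 \<le> d t"
    and descent: "\<And>t. \<kappa> * (d (Suc t))\<^sup>2 \<le> w t - w (Suc t)"
    and h_cluster: "\<And>p. cluster_point z p \<Longrightarrow> h p = ereal ws"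
    and C_pos: "C > 0" and \<kappa>_pos: "\<kappa> > 0"
begin

definition tail :: "nat \<Rightarrow> real" where "tail t = (\<Sum>i. d (i + t))"

lemma w_decseq: "decseq w"
proof (rule decseq_SucI)
  fix t
  have "0 \<le> \<kappa> * (d (Suc t))\<^sup>2" using \<kappa>_pos by simp
  then show "w (Suc t) \<le> w t" using descent[of t] by linarith
qed

lemma w_ge: "ws \<le> w t"
  by (rule decseq_ge[OF w_decseq w_tendsto])

lemma stationary_after:
  assumes "w T \<le> ws" shows "\<forall>t>T. d t = 0"
proof (intro allI impI)
  fix t assume t: "t > T"
  then obtain s where s: "t = Suc s" "T \<le> s" by (metis less_imp_Suc_add le_add1)
  have "w s \<le> ws" using w_decseq assms s(2) unfolding decseq_def by (meson order_trans)
  then have "\<kappa> * (d t)\<^sup>2 \<le> 0" using descent[of s] w_ge[of "Suc s"] s(1) by simp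
  then show "d t = 0" using \<kappa>_pos by (simp add: mult_le_0_iff)
qed

lemma d_tendsto_0: "d \<longlonglongrightarrow> 0"
  by (rule steps_tendsto_0_of_descent[OF \<kappa>_pos w_tendsto descent d_nonneg])

text \<open>Either \<open>w\<close> reaches its limit, and then all later steps vanish, or the inequality holds
  eventually. In the second case, with \<open>\<psi> = \<Phi>'\<close> at the current excess,
  \<open>\<kappa> d (t + 1)^2 \<le> w t - w (t + 1) \<le> \<psi> C d t (w t - w (t + 1)) \<le> C d t (\<Phi> t - \<Phi> (t + 1))\<close>, and the
  inequality between geometric and arithmetic means yields the halving recursion.\<close>

lemma desingularized_descent:
  assumes KL: "\<And>p. cluster_point z p \<Longrightarrow> KL_property_via h p (a p) (\<phi> p)"
  shows "summable d \<and> ((\<exists>T. \<forall>t>T. d t = 0) \<or>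
    (\<exists>T J. finite J \<and> (\<forall>p\<in>J. cluster_point z p) \<and> (\<forall>t\<ge>T. ws < w t \<and>
       1 \<le> (\<Sum>p\<in>J. deriv (\<phi> p) (w t - ws)) * (C * d t) \<and>
       tail (Suc t) \<le> d t + C / \<kappa> * (\<Sum>p\<in>J. \<phi> p (w t - ws)))))"
proof (cases "\<exists>T. w T \<le> ws")
  case True
  then obtain T where T: "\<forall>t>T. d t = 0" using stationary_after by blast
  then have "summable (\<lambda>i. d (i + Suc T))" by simp
  then have "summable d" by (subst (asm) summable_iff_shift)
  then show ?thesis using T by blast
next
  case False
  then have wgt: "ws < w t" for t by (simp add: not_le)
  obtain J a0 where J: "finite J" "\<And>p. p \<in> J \<Longrightarrow> cluster_point z p" "\<And>p. p \<in> J \<Longrightarrow> ereal a0 \<le> a p"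
    "\<forall>\<^sub>F t in sequentially. w t - ws < a0 \<and>
       (ws < w t \<longrightarrow> 1 \<le> (\<Sum>p\<in>J. deriv (\<phi> p) (w t - ws)) * norm (v t))"
    using uniformized_KL[OF bounded_z h_z w_tendsto v_subdiff, of a \<phi>] h_cluster KL by blast
  then obtain T where T: "\<And>t. T \<le> t \<Longrightarrow> w t - ws < a0"
      "\<And>t. T \<le> t \<Longrightarrow> 1 \<le> (\<Sum>p\<in>J. deriv (\<phi> p) (w t - ws)) * norm (v t)"
    using wgt unfolding eventually_sequentially by blast
  define \<psi> \<Phi> where "\<psi> t = (\<Sum>p\<in>J. deriv (\<phi> p) (w t - ws))" and "\<Phi> t = (\<Sum>p\<in>J. \<phi> p (w t - ws))" for t
  have des: "desingularizing (a p) (\<phi> p)" "ereal (w t - ws) < a p" if "p \<in> J" "T \<le> t" for p t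
  proof -
    show "desingularizing (a p) (\<phi> p)" using KL J(2) that by (auto simp: KL_property_via_def)
    show "ereal (w t - ws) < a p"
      using T(1)[OF that(2)] less_le_trans[OF _ J(3)[OF that(1)], of "ereal (w t - ws)"] by simp
  qed
  have \<psi>: "0 \<le> \<psi> t" if "T \<le> t" for t
    unfolding \<psi>_def using des that wgt[of t] by (intro sum_nonneg less_imp_le) (auto simp: desingularizing_def)
  have KLd: "1 \<le> \<psi> t * (C * d t)" if "T \<le> t" for t
    using T(2)[OF that] mult_left_mono[OF v_bound[of t] \<psi>[OF that]] by (simp add: \<psi>_def)
  have \<Phi>: "0 \<le> \<Phi> t" if "T \<le> t" for t
    unfolding \<Phi>_def using des that wgt[of t] by (intro sum_nonneg) (auto simp: desingularizing_def)
  have tangent: "\<psi> t * (w t - w (Suc t)) \<le> \<Phi> t - \<Phi> (Suc t)" if "T \<le> t" for t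
  proof -
    have "deriv (\<phi> p) (w t - ws) * ((w t - ws) - (w (Suc t) - ws)) \<le> \<phi> p (w t - ws) - \<phi> p (w (Suc t) - ws)"
      if "p \<in> J" for p
      using des[OF that \<open>T \<le> t\<close>] wgt[of t] wgt[of "Suc t"] decseq_SucD[OF w_decseq, of t]
      by (intro desingularizing_tangent) auto
    then show ?thesis
      unfolding \<psi>_def \<Phi>_def sum_distrib_right sum_subtractf[symmetric] by (intro sum_mono) auto
  qed
  have rec: "d (Suc t) \<le> (d t + (C / \<kappa> * \<Phi> t - C / \<kappa> * \<Phi> (Suc t))) / 2" if t: "T \<le> t" for t
  proof (rule power2_le_imp_le)
    have amgm: "x * y \<le> ((x + y) / 2)\<^sup>2" for x y :: real
      using zero_le_power2[of "x - y"] by (simp add: power2_eq_square field_simps)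
    let ?g = "w t - w (Suc t)" let ?D = "C / \<kappa> * \<Phi> t - C / \<kappa> * \<Phi> (Suc t)"
    have g: "0 \<le> ?g" using decseq_SucD[OF w_decseq, of t] by simp
    have D0: "?D = C / \<kappa> * (\<Phi> t - \<Phi> (Suc t))" by (simp add: right_diff_distrib)
    have "0 \<le> \<Phi> t - \<Phi> (Suc t)" using tangent[OF t] mult_nonneg_nonneg[OF \<psi>[OF t] g] by linarith
    then have D: "0 \<le> ?D" unfolding D0 using C_pos \<kappa>_pos by simp
    then show "0 \<le> (d t + ?D) / 2" using d_nonneg[of t] by simp
    have "\<kappa> * (d (Suc t))\<^sup>2 \<le> 1 * ?g" using descent[of t] by simp
    also have "\<dots> \<le> (\<psi> t * (C * d t)) * ?g" by (intro mult_right_mono KLd t g)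
    also have "\<dots> = C * d t * (\<psi> t * ?g)" by (simp add: mult_ac)
    also have "\<dots> \<le> C * d t * (\<Phi> t - \<Phi> (Suc t))"
      using C_pos d_nonneg[of t] tangent[OF t] by (intro mult_left_mono) auto
    finally have "(d (Suc t))\<^sup>2 \<le> d t * ?D" unfolding D0 using \<kappa>_pos by (simp add: field_simps)
    also have "\<dots> \<le> ((d t + ?D) / 2)\<^sup>2"
      by (rule amgm)
    finally show "(d (Suc t))\<^sup>2 \<le> ((d t + ?D) / 2)\<^sup>2" .
  qed
  have "summable d" "\<And>t. T \<le> t \<Longrightarrow> tail (Suc t) \<le> d t + C / \<kappa> * \<Phi> t"
    unfolding tail_def
    using halving_recursion[where d = d and \<Phi> = "\<lambda>t. C / \<kappa> * \<Phi> t" and T = T] d_nonneg rec \<Phi> C_pos \<kappa>_pos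
    by auto
  then show ?thesis
    using J(1,2) wgt KLd by (intro conjI disjI2 exI[of _ T] exI[of _ J]) (auto simp: \<psi>_def \<Phi>_def)
qed

lemma finite_length:
  assumes "\<And>p. cluster_point z p \<Longrightarrow> KL_property_at h p"
  shows "summable d"
proof -
  from assms obtain a \<phi> where "\<And>p. cluster_point z p \<Longrightarrow> KL_property_via h p (a p) (\<phi> p)"
    unfolding KL_property_at_def by metis
  from desingularized_descent[OF this] show ?thesis by blast
qed

lemma tail_step: "summable d \<Longrightarrow> tail t = d t + tail (Suc t)"
  unfolding tail_def using suminf_split_head[of "\<lambda>i. d (i + t)"] by (simp add: summable_iff_shift)

lemma tail_nonneg: "summable d \<Longrightarrow> 0 \<le> tail t"
  unfolding tail_def by (intro suminf_nonneg) (auto simp: summable_iff_shift d_nonneg)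

text \<open>A sum of functions \<open>a0 * \<nu> powr (1 - \<theta>)\<close> over finitely many cluster points is again of this
  form, so one pair of constants serves for all late \<open>t\<close>.\<close>

lemma exponent_descent:
  assumes KL: "\<And>p. cluster_point z p \<Longrightarrow> KL_exponent_at h p \<theta>"
    and \<theta>: "\<theta> \<in> {0..<1}" and not_stationary: "\<not> (\<exists>T. \<forall>t>T. d t = 0)"
  shows "\<exists>T A B. A > 0 \<and> B > 0 \<and> (\<forall>t\<ge>T. ws < w t \<and> (w t - ws) powr \<theta> \<le> A * d t \<and>
       tail (Suc t) \<le> d t + B * (w t - ws) powr (1 - \<theta>))"
proof -
  from KL obtain a a0 where a0: "\<And>p. cluster_point z p \<Longrightarrow> 0 < a0 p"
      "\<And>p. cluster_point z p \<Longrightarrow> KL_property_via h p (a p) (\<lambda>\<nu>. a0 p * \<nu> powr (1 - \<theta>))"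
    unfolding KL_exponent_at_def by metis
  from desingularized_descent[OF a0(2)] not_stationary obtain T J where J: "finite J" "\<forall>p\<in>J. cluster_point z p"
    and T: "\<And>t. T \<le> t \<Longrightarrow> ws < w t \<and>
       1 \<le> (\<Sum>p\<in>J. deriv (\<lambda>\<nu>. a0 p * \<nu> powr (1 - \<theta>)) (w t - ws)) * (C * d t) \<and>
       tail (Suc t) \<le> d t + C / \<kappa> * (\<Sum>p\<in>J. a0 p * (w t - ws) powr (1 - \<theta>))" by blast
  define A where "A = (\<Sum>p\<in>J. a0 p)"
  have der: "deriv (\<lambda>\<nu>. c * \<nu> powr (1 - \<theta>)) s = c * ((1 - \<theta>) * s powr (- \<theta>))" if "s > 0" for c s
    using that by (intro DERIV_imp_deriv) (auto intro!: derivative_eq_intros)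
  have J0: "J \<noteq> {}" using T[of T] by auto
  have A: "A > 0" unfolding A_def using J J0 a0(1) by (intro sum_pos) auto
  show ?thesis
  proof (intro exI conjI allI impI)
    show "A * (1 - \<theta>) * C > 0" "C / \<kappa> * A > 0" using A \<theta> C_pos \<kappa>_pos by auto
    fix t assume t: "T \<le> t"
    let ?r = "w t - ws"
    have r: "?r > 0" using T[OF t] by simp
    have "1 \<le> (\<Sum>p\<in>J. a0 p * ((1 - \<theta>) * ?r powr (- \<theta>))) * (C * d t)"
      using T[OF t] der[OF r] by simp
    then have "1 \<le> A * (1 - \<theta>) * C * d t * ?r powr (- \<theta>)"
      unfolding A_def by (simp add: sum_distrib_right[symmetric] mult_ac)
    then have "?r powr \<theta> \<le> A * (1 - \<theta>) * C * d t" using r by (simp add: powr_minus field_simps)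
    moreover have "tail (Suc t) \<le> d t + C / \<kappa> * A * ?r powr (1 - \<theta>)"
      using T[OF t] unfolding A_def by (simp add: sum_distrib_right[symmetric] mult.assoc)
    ultimately show "ws < w t" "?r powr \<theta> \<le> A * (1 - \<theta>) * C * d t"
       "tail (Suc t) \<le> d t + C / \<kappa> * A * ?r powr (1 - \<theta>)" using r by simp_all
  qed
qed

lemma KL_exponent_imp_at: "KL_exponent_at h p \<theta> \<Longrightarrow> KL_property_at h p"
  unfolding KL_exponent_at_def KL_property_at_def by blast

text \<open>For exponent 0 the inequality bounds the steps from below, but they tend to 0.\<close>

lemma finite_termination:
  assumes KL: "\<And>p. cluster_point z p \<Longrightarrow> KL_exponent_at h p 0"
  shows "\<exists>T. \<forall>t>T. d t = 0"
proof (rule ccontr)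
  assume moving: "\<not> ?thesis"
  have "(0::real) \<in> {0..<1}" by simp
  then obtain T A B where A: "A > 0" and "B > 0" and T: "\<And>t. T \<le> t \<Longrightarrow> ws < w t \<and> (w t - ws) powr 0 \<le> A * d t \<and>
       tail (Suc t) \<le> d t + B * (w t - ws) powr (1 - 0)"
    using exponent_descent[OF KL _ moving] by blast
  have "1 / A \<le> d t" if "T \<le> t" for t using T[OF that] A by (auto simp: field_simps split: if_splits)
  then have "1 / A \<le> 0" using d_tendsto_0 by (intro LIMSEQ_le_const[of d 0]) auto
  then show False using A by simp
qed

text \<open>The excess \<open>w t - ws\<close> is eliminated: its power \<open>\<theta>\<close> is at most a multiple of \<open>d t\<close>, so its power
  \<open>1 - \<theta>\<close> is at most a multiple of \<open>d t powr ((1 - \<theta>) / \<theta>)\<close>.\<close>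

lemma tail_recursion:
  assumes KL: "\<And>p. cluster_point z p \<Longrightarrow> KL_exponent_at h p \<theta>"
    and \<theta>: "\<theta> \<in> {0<..<1}" and not_stationary: "\<not> (\<exists>T. \<forall>t>T. d t = 0)"
  obtains T K where "K > 0" "\<And>t. T \<le> t \<Longrightarrow> 0 < d t \<and> d t \<le> 1 \<and>
       tail (Suc t) \<le> d t + K * d t powr ((1 - \<theta>) / \<theta>)"
proof -
  have "\<theta> \<in> {0..<1}" using \<theta> by simp
  then obtain T A B where AB: "A > 0" "B > 0" and T: "\<And>t. T \<le> t \<Longrightarrow> ws < w t \<and> (w t - ws) powr \<theta> \<le> A * d t \<and>
       tail (Suc t) \<le> d t + B * (w t - ws) powr (1 - \<theta>)"
    using exponent_descent[OF KL _ not_stationary] by blast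
  obtain T' where T': "\<And>t. T' \<le> t \<Longrightarrow> d t < 1"
    using order_tendstoD(2)[OF d_tendsto_0, of 1] by (auto simp: eventually_sequentially)
  define e where "e = (1 - \<theta>) / \<theta>"
  have e: "e > 0" "\<theta> * e = 1 - \<theta>" using \<theta> by (auto simp: e_def)
  show ?thesis
  proof (rule that)
    show "B * A powr e > 0" using AB by simp
    fix t assume t: "max T T' \<le> t"
    let ?r = "w t - ws"
    have r: "0 < ?r" "?r powr \<theta> \<le> A * d t" "tail (Suc t) \<le> d t + B * ?r powr (1 - \<theta>)" using T[of t] t by auto
    have "0 < ?r powr \<theta>" using r(1) by simp
    then have "0 < A * d t" using r(2) by linarith
    then have d: "0 < d t" using AB by (simp add: zero_less_mult_iff)
    have "?r powr (1 - \<theta>) = (?r powr \<theta>) powr e" by (simp add: powr_powr e)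
    also have "\<dots> \<le> (A * d t) powr e" using r e by (intro powr_mono2) auto
    also have "\<dots> = A powr e * d t powr e" using AB d by (simp add: powr_mult)
    finally have "B * ?r powr (1 - \<theta>) \<le> B * (A powr e * d t powr e)" using AB by simp
    then show "0 < d t \<and> d t \<le> 1 \<and> tail (Suc t) \<le> d t + B * A powr e * d t powr ((1 - \<theta>) / \<theta>)"
      using d r(3) T'[of t] t by (simp add: e_def[symmetric] mult.assoc)
  qed
qed

lemma eventually_stationary_tail: "\<forall>t>T. d t = 0 \<Longrightarrow> t > T \<Longrightarrow> tail t = 0"
  by (simp add: tail_def)

text \<open>Here \<open>(1 - \<theta>) / \<theta> \<ge> 1\<close>, so that the linear term \<open>d t\<close> dominates in the tail recursion.\<close>

lemma linear_rate:
  assumes KL: "\<And>p. cluster_point z p \<Longrightarrow> KL_exponent_at h p \<theta>" and \<theta>: "\<theta> \<in> {0<..1/2}"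
  shows "\<exists>c Q T. c > 0 \<and> Q \<in> {0<..<1} \<and> (\<forall>t>T. tail t \<le> c * Q ^ t)"
proof (cases "\<exists>T. \<forall>t>T. d t = 0")
  case True
  then obtain T where "\<forall>t>T. d t = 0" by blast
  then show ?thesis
    by (intro exI[of _ 1] exI[of _ "1/2"] exI[of _ T]) (auto simp: eventually_stationary_tail)
next
  case False
  have summable: "summable d" using finite_length KL KL_exponent_imp_at by blast
  have "\<theta> \<in> {0<..<1}" using \<theta> by auto
  then obtain T K where K: "K > 0" and T: "\<And>t. T \<le> t \<Longrightarrow> 0 < d t \<and> d t \<le> 1 \<and>
       tail (Suc t) \<le> d t + K * d t powr ((1 - \<theta>) / \<theta>)"
    using tail_recursion[OF KL _ False] by blast
  have "tail (Suc t) \<le> (1 + K) * (tail t - tail (Suc t))" if t: "T \<le> t" for t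
  proof -
    have "d t powr ((1 - \<theta>) / \<theta>) \<le> d t powr 1"
      using T[OF t] \<theta> by (intro powr_mono') (auto simp: field_simps)
    then have "K * d t powr ((1 - \<theta>) / \<theta>) \<le> K * d t" using K T[OF t] by simp
    then have "tail (Suc t) \<le> (1 + K) * d t" using T[OF t] by (simp add: distrib_right)
    then show ?thesis using tail_step[OF summable, of t] by simp
  qed
  then show ?thesis using K by (intro geometric_rate[of "1 + K" T]) (auto simp: tail_nonneg[OF summable])
qed

text \<open>Here \<open>(1 - \<theta>) / \<theta> < 1\<close>, so that the power of \<open>d t\<close> dominates in the tail recursion; raising the
  inequality to the power \<open>p = \<theta> / (1 - \<theta>)\<close> gives the hypothesis of \<open>sublinear_rate\<close>.\<close>

lemma power_rate:
  assumes KL: "\<And>p. cluster_point z p \<Longrightarrow> KL_exponent_at h p \<theta>" and \<theta>: "\<theta> \<in> {1/2<..<1}"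
  shows "\<exists>c T. c > 0 \<and> (\<forall>t>T. tail t \<le> c * real t powr (- ((1 - \<theta>) / (2 * \<theta> - 1))))"
proof (cases "\<exists>T. \<forall>t>T. d t = 0")
  case True
  then obtain T where "\<forall>t>T. d t = 0" by blast
  then show ?thesis by (intro exI[of _ 1] exI[of _ T]) (auto simp: eventually_stationary_tail)
next
  case False
  have summable: "summable d" using finite_length KL KL_exponent_imp_at by blast
  have "\<theta> \<in> {0<..<1}" using \<theta> by auto
  then obtain T K where K: "K > 0" and T: "\<And>t. T \<le> t \<Longrightarrow> 0 < d t \<and> d t \<le> 1 \<and>
       tail (Suc t) \<le> d t + K * d t powr ((1 - \<theta>) / \<theta>)"
    using tail_recursion[OF KL _ False] by blast
  define p where "p = \<theta> / (1 - \<theta>)"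
  have p: "p > 1" "(1 - \<theta>) / \<theta> * p = 1" "1 / (p - 1) = (1 - \<theta>) / (2 * \<theta> - 1)"
    using \<theta> by (auto simp: p_def field_simps)
  have pos: "0 < tail t" if "T \<le> t" for t
    using T[OF that] tail_step[OF summable, of t] tail_nonneg[OF summable, of "Suc t"] by simp
  have "tail (Suc t) powr p \<le> (1 + K) powr p * (tail t - tail (Suc t))" if t: "T \<le> t" for t
  proof -
    let ?D = "d t powr ((1 - \<theta>) / \<theta>)"
    have "d t powr 1 \<le> ?D"
      using T[OF t] \<theta> by (intro powr_mono') (auto simp: field_simps)
    then have "tail (Suc t) \<le> (1 + K) * ?D" using T[OF t] by (simp add: distrib_right)
    then have "tail (Suc t) powr p \<le> ((1 + K) * ?D) powr p"
      using p tail_nonneg[OF summable] by (intro powr_mono2) auto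
    also have "\<dots> = (1 + K) powr p * d t" using K T[OF t] p by (simp add: powr_mult powr_powr)
    finally show ?thesis using tail_step[OF summable, of t] by simp
  qed
  then have "\<exists>c T. c > 0 \<and> (\<forall>t>T. tail t \<le> c * real t powr (- (1 / (p - 1))))"
    using K p pos by (intro sublinear_rate[of p "(1 + K) powr p" T]) auto
  then show ?thesis by (simp only: p(3))
qed

end

section \<open>Subgradients of the potential function\<close>

lemma norm_adjoint_le:
  fixes T :: "'a::euclidean_space \<Rightarrow>\<^sub>L 'a"
  shows "norm (adjoint (blinfun_apply T) u) \<le> norm T * norm u"
proof -
  let ?a = "adjoint (blinfun_apply T) u"
  have "norm ?a * norm ?a = ?a \<bullet> ?a" by (simp add: power2_norm_eq_inner[symmetric] power2_eq_square)
  also have "\<dots> = T ?a \<bullet> u"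
    using adjoint_works[of "blinfun_apply T" ?a u] by (simp add: blinfun.bounded_linear_right bounded_linear.linear)
  also have "\<dots> \<le> norm (T ?a) * norm u" by (rule norm_cauchy_schwarz)
  also have "\<dots> \<le> norm T * norm ?a * norm u" by (intro mult_right_mono norm_blinfun) auto
  finally have "norm ?a * norm ?a \<le> (norm T * norm u) * norm ?a" by (simp add: mult_ac)
  then show ?thesis by (cases "norm ?a = 0") auto
qed

lemma convex_conjugate_subgrad:
  assumes "\<zeta> \<in> subgrad f y"
  shows "convex_conjugate f \<zeta> = ereal (y \<bullet> \<zeta> - f y)"
  unfolding convex_conjugate_def
proof (rule antisym[OF SUP_least SUP_upper])
  fix u
  have "f y + \<zeta> \<bullet> (u - y) \<le> f u" using assms by (simp add: subgrad_def)
  then show "ereal (u \<bullet> \<zeta> - f u) \<le> ereal (y \<bullet> \<zeta> - f y)"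
    by (simp add: inner_diff_right inner_commute)
qed simp

lemma convex_conjugate_ge: "ereal (y \<bullet> z - f y) \<le> convex_conjugate f z"
  unfolding convex_conjugate_def by (rule SUP_upper) simp

text \<open>The conjugate of \<open>P2\<close> is the only nonsmooth part of \<^const>\<open>q_tilde\<close>; here it is replaced by
  its affine minorant with slope \<open>b\<close>, which is exact at the subgradients of \<open>P2\<close> at \<open>b\<close>.\<close>

definition q_tilde_minorant ::
    "(real^'n \<Rightarrow> real) \<Rightarrow> (real^'n \<Rightarrow> real^'n) \<Rightarrow> (real^'n \<Rightarrow> real) \<Rightarrow> real^'n \<Rightarrow>
     (real^'n) \<times> (real^'n) \<times> (real^'n) \<times> real \<Rightarrow> real" where
  "q_tilde_minorant P1 gP1 P2 b = (\<lambda>(x, y, \<zeta>, w).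
     P1 y + gP1 y \<bullet> (x - y) + (b \<bullet> \<zeta> - P2 b) - \<zeta> \<bullet> x + w / 2 * (norm (x - y))\<^sup>2)"

lemma q_tilde_minorant_le:
  "ereal (q_tilde_minorant P1 gP1 P2 b p) \<le> q_tilde P1 gP1 P2 p"
proof (cases p)
  case (fields x y \<zeta> w)
  show ?thesis
    using convex_conjugate_ge[of b \<zeta> P2]
    by (cases "convex_conjugate P2 \<zeta>") (auto simp: fields q_tilde_minorant_def q_tilde_def)
qed

lemma q_tilde_eq_minorant:
  assumes "\<zeta> \<in> subgrad P2 y"
  shows "q_tilde P1 gP1 P2 (x, y, \<zeta>, w) = ereal (q_tilde_minorant P1 gP1 P2 y (x, y, \<zeta>, w))"
  by (simp add: q_tilde_def q_tilde_minorant_def convex_conjugate_subgrad[OF assms])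

lemma q_tilde_minorant_derivative:
  fixes T :: "(real^'n) \<Rightarrow>\<^sub>L (real^'n)"
  assumes P1: "GDERIV P1 y :> gP1 y" and gP1: "(gP1 has_derivative blinfun_apply T) (at y)"
  shows "(q_tilde_minorant P1 gP1 P2 y has_derivative
     (\<lambda>h. (gP1 y - \<zeta> + w *\<^sub>R (x - y), adjoint (blinfun_apply T) (x - y) - w *\<^sub>R (x - y),
       y - x, (norm (x - y))\<^sup>2 / 2) \<bullet> h)) (at (x, y, \<zeta>, w))"
proof -
  let ?p = "(x, y, \<zeta>, w)"
  have P1': "(P1 has_derivative (\<lambda>d. gP1 y \<bullet> d)) (at y)"
    using P1 by (simp add: gderiv_def inner_commute)
  have 1: "((\<lambda>p. P1 (fst (snd p))) has_derivative (\<lambda>h. gP1 y \<bullet> fst (snd h))) (at ?p)"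
    by (rule has_derivative_compose[of "\<lambda>p. fst (snd p)" "\<lambda>h. fst (snd h)" ?p UNIV P1 "\<lambda>d. gP1 y \<bullet> d"])
       (auto intro!: derivative_eq_intros P1')
  have 2: "((\<lambda>p. gP1 (fst (snd p))) has_derivative (\<lambda>h. T (fst (snd h)))) (at ?p)"
    by (rule has_derivative_compose[of "\<lambda>p. fst (snd p)" "\<lambda>h. fst (snd h)" ?p UNIV gP1 "blinfun_apply T"])
       (auto intro!: derivative_eq_intros gP1)
  have adj: "adjoint (blinfun_apply T) (x - y) \<bullet> k = (x - y) \<bullet> T k" for k
    using adjoint_works[of "blinfun_apply T" k "x - y"]
    by (simp add: blinfun.bounded_linear_right bounded_linear.linear inner_commute)
  have adj': "k \<bullet> adjoint (blinfun_apply T) (x - y) = (x - y) \<bullet> T k" for k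
    using adj[of k] by (simp add: inner_commute)
  have G: "q_tilde_minorant P1 gP1 P2 y = (\<lambda>p. P1 (fst (snd p)) + gP1 (fst (snd p)) \<bullet> (fst p - fst (snd p))
      + (y \<bullet> fst (snd (snd p)) - P2 y) - fst (snd (snd p)) \<bullet> fst p
      + snd (snd (snd p)) / 2 * ((fst p - fst (snd p)) \<bullet> (fst p - fst (snd p))))"
    by (auto simp: q_tilde_minorant_def power2_norm_eq_inner)
  show ?thesis
    unfolding G
  proof (rule has_derivative_eq_rhs)
    show "((\<lambda>p. P1 (fst (snd p)) + gP1 (fst (snd p)) \<bullet> (fst p - fst (snd p))
      + (y \<bullet> fst (snd (snd p)) - P2 y) - fst (snd (snd p)) \<bullet> fst p
      + snd (snd (snd p)) / 2 * ((fst p - fst (snd p)) \<bullet> (fst p - fst (snd p)))) has_derivative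
      (\<lambda>h. gP1 y \<bullet> fst (snd h) + (gP1 y \<bullet> (fst h - fst (snd h)) + T (fst (snd h)) \<bullet> (x - y))
        + y \<bullet> fst (snd (snd h)) - (\<zeta> \<bullet> fst h + fst (snd (snd h)) \<bullet> x)
        + (w / 2 * (2 * ((x - y) \<bullet> (fst h - fst (snd h)))) + snd (snd (snd h)) / 2 * ((x - y) \<bullet> (x - y))))) (at ?p)"
      by (auto intro!: derivative_eq_intros 1 2 simp: fun_eq_iff inner_commute)
  next
    show "(\<lambda>h. gP1 y \<bullet> fst (snd h) + (gP1 y \<bullet> (fst h - fst (snd h)) + T (fst (snd h)) \<bullet> (x - y))
        + y \<bullet> fst (snd (snd h)) - (\<zeta> \<bullet> fst h + fst (snd (snd h)) \<bullet> x)
        + (w / 2 * (2 * ((x - y) \<bullet> (fst h - fst (snd h)))) + snd (snd (snd h)) / 2 * ((x - y) \<bullet> (x - y))))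
      = (\<lambda>h. (gP1 y - \<zeta> + w *\<^sub>R (x - y), adjoint (blinfun_apply T) (x - y) - w *\<^sub>R (x - y),
       y - x, (norm (x - y))\<^sup>2 / 2) \<bullet> h)"
      by (rule ext)
        (simp add: inner_prod_def inner_add_left inner_diff_left adj adj' power2_norm_eq_inner inner_diff_right inner_add_right
          inner_commute field_simps)
  qed
qed

lemma F_tilde_eq_l1_l2_or_infinity:
  "F_tilde P1 gP1 P2 \<rho> p \<noteq> \<infinity> \<Longrightarrow> F_tilde P1 gP1 P2 \<rho> p = ereal (l1_l2 (fst p)) \<and> \<rho> \<le> norm (fst p)"
  by (cases p) (auto simp: F_tilde_def delta_fun_def split: if_splits)

text \<open>Where the potential is finite, \<open>m\<close> times the minorant of \<^const>\<open>q_tilde\<close> is nonpositive,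
  so adding it to a minorant of the ratio leaves a minorant of the potential. Complementarity makes the two
  agree at the point under consideration.\<close>

lemma frechet_subdiff_F_tilde:
  fixes X Y \<zeta> s :: "real^'n" and T :: "(real^'n) \<Rightarrow>\<^sub>L (real^'n)"
  assumes P1: "GDERIV P1 Y :> gP1 Y" and gP1: "(gP1 has_derivative blinfun_apply T) (at Y)"
    and \<zeta>: "\<zeta> \<in> subgrad P2 Y" and s: "s \<in> subgrad l1_norm X"
    and \<rho>: "0 < \<rho>" "\<rho> \<le> norm X" and m: "0 \<le> m"
    and le: "q_tilde_minorant P1 gP1 P2 Y (X, Y, \<zeta>, w) \<le> 0"
    and compl: "m * q_tilde_minorant P1 gP1 P2 Y (X, Y, \<zeta>, w) = 0"
  shows "F_tilde P1 gP1 P2 \<rho> (X, Y, \<zeta>, w) = ereal (l1_l2 X)"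
    and "((1 / norm X) *\<^sub>R (s - (l1_l2 X / norm X) *\<^sub>R X) + m *\<^sub>R (gP1 Y - \<zeta> + w *\<^sub>R (X - Y)),
      m *\<^sub>R (adjoint (blinfun_apply T) (X - Y) - w *\<^sub>R (X - Y)), m *\<^sub>R (Y - X), m * ((norm (X - Y))\<^sup>2 / 2))
      \<in> frechet_subdiff (F_tilde P1 gP1 P2 \<rho>) (X, Y, \<zeta>, w)" (is "?v \<in> _")
proof -
  let ?F = "F_tilde P1 gP1 P2 \<rho>" and ?G = "q_tilde_minorant P1 gP1 P2 Y" and ?p = "(X, Y, \<zeta>, w)"
  have X: "X \<noteq> 0" using \<rho> by auto
  \<comment> \<open>The differentiable minorant of the potential that touches it at \<open>?p\<close>.\<close>
  define M where "M p = (l1_norm X + s \<bullet> (fst p - X)) / norm (fst p) + m * ?G p" for p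
  have "q_tilde P1 gP1 P2 ?p \<le> 0" using le by (simp add: q_tilde_eq_minorant[OF \<zeta>])
  then show F: "?F ?p = ereal (l1_l2 X)" using \<rho> by (simp add: F_tilde_def delta_fun_def)
  have "((\<lambda>p. (l1_norm X + s \<bullet> (fst p - X)) / norm (fst p)) has_derivative
      (\<lambda>h. ((1 / norm X) *\<^sub>R (s - (l1_l2 X / norm X) *\<^sub>R X)) \<bullet> fst h)) (at ?p)"
  proof (rule has_derivative_compose[where g = "\<lambda>y. (l1_norm X + s \<bullet> (y - X)) / norm y"])
    show "(fst has_derivative fst) (at ?p)" by (rule has_derivative_fst[OF has_derivative_ident])
    show "((\<lambda>y. (l1_norm X + s \<bullet> (y - X)) / norm y) has_derivative
      (\<lambda>d. ((1 / norm X) *\<^sub>R (s - (l1_l2 X / norm X) *\<^sub>R X)) \<bullet> d)) (at (fst ?p))"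
      using frechet_subdiff_l1_l2(2)[OF s X] by (simp only: fst_conv)
  qed
  moreover have "((\<lambda>p. m * ?G p) has_derivative (\<lambda>h. m * ((gP1 Y - \<zeta> + w *\<^sub>R (X - Y),
      adjoint (blinfun_apply T) (X - Y) - w *\<^sub>R (X - Y), Y - X, (norm (X - Y))\<^sup>2 / 2) \<bullet> h))) (at ?p)"
    by (rule has_derivative_mult_right[OF q_tilde_minorant_derivative[of P1 Y gP1, OF P1 gP1]])
  ultimately have "((\<lambda>p. (l1_norm X + s \<bullet> (fst p - X)) / norm (fst p) + m * ?G p) has_derivative
      (\<lambda>h. ((1 / norm X) *\<^sub>R (s - (l1_l2 X / norm X) *\<^sub>R X)) \<bullet> fst h + m * ((gP1 Y - \<zeta> + w *\<^sub>R (X - Y),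
      adjoint (blinfun_apply T) (X - Y) - w *\<^sub>R (X - Y), Y - X, (norm (X - Y))\<^sup>2 / 2) \<bullet> h))) (at ?p)"
    by (rule has_derivative_add)
  then have "(M has_derivative (\<lambda>h. ?v \<bullet> h)) (at ?p)"
    unfolding M_def
    by (rule has_derivative_eq_rhs) (simp add: fun_eq_iff inner_prod_def inner_add_left distrib_left)
  then have "?v \<in> frechet_subdiff (\<lambda>p. ereal (M p)) ?p" by (rule frechet_subdiff_differentiable)
  moreover have "ereal (M p) \<le> ?F p" for p
  proof (cases "?F p = \<infinity>")
    case False
    then have Fp: "?F p = ereal (l1_l2 (fst p))" by (simp add: F_tilde_eq_l1_l2_or_infinity)
    have "q_tilde P1 gP1 P2 p \<le> 0"
      using False by (cases p) (auto simp: F_tilde_def delta_fun_def split: if_splits)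
    then have "ereal (?G p) \<le> 0" using q_tilde_minorant_le order_trans by blast
    then have "m * ?G p \<le> 0" using m by (simp add: mult_nonneg_nonpos)
    then have "M p \<le> l1_l2 (fst p)" using frechet_subdiff_l1_l2(3)[OF s X, of "fst p"] by (simp add: M_def)
    then show ?thesis by (simp add: Fp)
  qed simp
  moreover have "?F ?p = ereal (M ?p)" using F compl by (simp add: M_def l1_l2_def)
  ultimately show "?v \<in> frechet_subdiff ?F ?p" by (rule frechet_subdiff_minorant)
qed

section \<open>The iterates and their multipliers\<close>

text \<open>The iterates of the algorithm together with the quantities that witness optimality in the
  subproblems: \<open>\<zeta>\<close> and \<open>l\<close> are those used in the accepted subproblem, \<open>lam\<close> is the multiplier of its
  constraint, and \<open>s\<close> the subgradient of the 1-norm in its optimality system.\<close>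

locale mba_kkt =
  fixes P1 P2 q :: "real^'n \<Rightarrow> real"
    and gP1 :: "real^'n \<Rightarrow> real^'n"
    and HP1 :: "real^'n \<Rightarrow> (real^'n) \<Rightarrow>\<^sub>L (real^'n)"
    and x \<zeta> s :: "nat \<Rightarrow> real^'n" and l lam :: "nat \<Rightarrow> real"
    and \<alpha> \<rho> lbar :: real
  assumes q_def: "\<And>y. q y = P1 y - P2 y"
    and P1_gradient: "\<And>y. GDERIV P1 y :> gP1 y"
    and gP1_derivative: "\<And>y. (gP1 has_derivative blinfun_apply (HP1 y)) (at y)"
    and HP1_continuous: "continuous_on UNIV HP1"
    and P2_continuous: "continuous_on UNIV P2"
    and GMFCQ: "\<And>y. q y \<le> 0 \<Longrightarrow> GMFCQ_at q y"
    and \<rho>_pos: "\<rho> > 0" and feasible_norm: "\<And>y. q y \<le> 0 \<Longrightarrow> norm y > \<rho>"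
    and bounded_x: "bounded (range x)"
    and x_feasible: "\<And>t. q (x t) \<le> 0"
    and \<alpha>_pos: "\<alpha> > 0"
    and l_bounds: "\<And>t. 0 \<le> l t \<and> l t \<le> lbar"
    and \<zeta>_subgrad: "\<And>t. \<zeta> t \<in> subgrad P2 (x t)"
    and objective_decrease: "\<And>t. mba_objective \<alpha> (l1_l2 (x t)) (x t) (x (Suc t))
          \<le> mba_objective \<alpha> (l1_l2 (x t)) (x t) (x t)"
    and model_le: "\<And>t. q (x t) + (gP1 (x t) - \<zeta> t) \<bullet> (x (Suc t) - x t)
          + l t / 2 * (norm (x (Suc t) - x t))\<^sup>2 \<le> 0"
    and lam_nonneg: "\<And>t. 0 \<le> lam t"
    and complementarity: "\<And>t. lam t * (q (x t) + (gP1 (x t) - \<zeta> t) \<bullet> (x (Suc t) - x t)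
          + l t / 2 * (norm (x (Suc t) - x t))\<^sup>2) = 0"
    and s_subgrad: "\<And>t. s t \<in> subgrad l1_norm (x (Suc t))"
    and kkt: "\<And>t. s t - (l1_l2 (x t) / norm (x t)) *\<^sub>R x t + \<alpha> *\<^sub>R (x (Suc t) - x t)
          + lam t *\<^sub>R (gP1 (x t) - \<zeta> t + l t *\<^sub>R (x (Suc t) - x t)) = 0"
begin

definition d :: "nat \<Rightarrow> real" where "d t = norm (x (Suc t) - x t)"

definition w :: "nat \<Rightarrow> real" where "w t = l1_l2 (x (Suc t))"

definition z :: "nat \<Rightarrow> (real^'n) \<times> (real^'n) \<times> (real^'n) \<times> real" where
  "z t = (x (Suc t), x t, \<zeta> t, l t)"

lemma norm_x_gt: "\<rho> < norm (x t)"
  using feasible_norm x_feasible by blast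

lemma x_nonzero: "x t \<noteq> 0"
  using norm_x_gt[of t] \<rho>_pos by auto

lemma norm_x_bound: obtains R where "R > 0" "\<And>t. norm (x t) \<le> R"
  using bounded_x by (auto simp: bounded_pos)

text \<open>The objective of the subproblem vanishes at \<open>x t\<close>, and
  \<open>x (Suc t) \<bullet> x t \<le> norm (x (Suc t)) * norm (x t)\<close>; division by \<open>norm (x (Suc t))\<close> gives the claim.\<close>

lemma ratio_decrease:
  assumes R: "\<And>t. norm (x t) \<le> R"
  shows "\<alpha> / (2 * R) * (d t)\<^sup>2 \<le> l1_l2 (x t) - l1_l2 (x (Suc t))"
proof -
  let ?X = "x (Suc t)" and ?Y = "x t"
  have n: "norm ?X > 0" "norm ?Y > 0" using x_nonzero by auto
  have w0: "l1_l2 ?Y \<ge> 0" by (rule l1_l2_nonneg)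
  have "l1_norm ?X - l1_l2 ?Y / norm ?Y * (?X \<bullet> ?Y) + \<alpha> / 2 * (d t)\<^sup>2 \<le> l1_norm ?Y - l1_l2 ?Y / norm ?Y * (?Y \<bullet> ?Y)"
    using objective_decrease[of t] by (simp add: mba_objective_def d_def)
  also have "l1_norm ?Y - l1_l2 ?Y / norm ?Y * (?Y \<bullet> ?Y) = 0"
    using n by (simp add: l1_l2_def power2_norm_eq_inner[symmetric] power2_eq_square)
  finally have "l1_norm ?X + \<alpha> / 2 * (d t)\<^sup>2 \<le> l1_l2 ?Y / norm ?Y * (?X \<bullet> ?Y)" by simp
  also have "\<dots> \<le> l1_l2 ?Y / norm ?Y * (norm ?X * norm ?Y)"
    using w0 n by (intro mult_left_mono norm_cauchy_schwarz) auto
  also have "\<dots> = l1_l2 ?Y * norm ?X" using n by simp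
  finally have "l1_norm ?X / norm ?X + \<alpha> / 2 * (d t)\<^sup>2 / norm ?X \<le> l1_l2 ?Y"
    using n by (simp add: field_simps)
  moreover have "\<alpha> / 2 * (d t)\<^sup>2 / R \<le> \<alpha> / 2 * (d t)\<^sup>2 / norm ?X"
    using n R[of "Suc t"] \<alpha>_pos less_le_trans[OF n(1) R] by (intro divide_left_mono mult_pos_pos) auto
  ultimately show ?thesis by (simp add: l1_l2_def field_simps)
qed

lemma ratio_decseq: "l1_l2 (x (Suc t)) \<le> l1_l2 (x t)"
proof -
  obtain R where R: "R > 0" "\<And>t. norm (x t) \<le> R" using norm_x_bound by blast
  have "0 \<le> \<alpha> / (2 * R) * (d t)\<^sup>2" using R \<alpha>_pos by simp
  then show ?thesis using ratio_decrease[OF R(2), of t] by linarith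
qed

lemma ratio_le_initial: "l1_l2 (x t) \<le> l1_l2 (x 0)"
  by (induction t) (use ratio_decseq order_trans in auto)

lemma w_convergent: obtains ws where "w \<longlonglongrightarrow> ws" "\<And>t. ws \<le> w t"
proof (rule decseq_convergent[of w 0])
  show "decseq w" unfolding w_def by (intro decseq_SucI ratio_decseq)
qed (use l1_l2_nonneg in \<open>auto simp: w_def that\<close>)

lemma d_tendsto_0: "d \<longlonglongrightarrow> 0"
proof -
  obtain R where R: "R > 0" "\<And>t. norm (x t) \<le> R" using norm_x_bound by blast
  obtain ws where ws: "w \<longlonglongrightarrow> ws" using w_convergent by blast
  show ?thesis
  proof (rule steps_tendsto_0_of_descent[OF _ ws])
    show "0 < \<alpha> / (2 * R)" using R \<alpha>_pos by simp
    show "\<alpha> / (2 * R) * (d (Suc t))\<^sup>2 \<le> w t - w (Suc t)" for t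
      unfolding w_def by (rule ratio_decrease[OF R(2)])
  qed (simp add: d_def)
qed

lemma steps_tendsto_0: "(\<lambda>t. x (Suc t) - x t) \<longlonglongrightarrow> 0"
  using d_tendsto_0 unfolding d_def by (simp add: tendsto_norm_zero_iff)

lemma l_step_tendsto_0: "(\<lambda>t. l t *\<^sub>R (x (Suc t) - x t)) \<longlonglongrightarrow> 0"
proof (rule Lim_null_comparison)
  have "\<bar>l t\<bar> * d t \<le> lbar * d t" for t
    using l_bounds[of t] by (intro mult_right_mono) (auto simp: d_def)
  then show "\<forall>\<^sub>F t in sequentially. norm (l t *\<^sub>R (x (Suc t) - x t)) \<le> lbar * d t"
    by (simp add: d_def)
  show "(\<lambda>t. lbar * d t) \<longlonglongrightarrow> 0" using tendsto_mult_left[OF d_tendsto_0, of lbar] by simp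
qed

lemma bounded_\<zeta>: "bounded (range \<zeta>)"
proof -
  obtain B where "\<And>y v. y \<in> range x \<Longrightarrow> v \<in> subgrad P2 y \<Longrightarrow> norm v \<le> B"
    using subgrad_bounded[OF P2_continuous bounded_x] by metis
  then show ?thesis unfolding bounded_iff using \<zeta>_subgrad by blast
qed

lemma bounded_s: "bounded (range s)"
proof -
  obtain B where "\<And>y v. y \<in> range x \<Longrightarrow> v \<in> subgrad l1_norm y \<Longrightarrow> norm v \<le> B"
    using subgrad_bounded[OF continuous_on_l1_norm bounded_x] by metis
  then show ?thesis unfolding bounded_iff using s_subgrad by blast
qed

lemma bounded_l: "bounded (range l)"
  unfolding bounded_iff using l_bounds by (intro exI[of _ lbar]) (auto simp: abs_of_nonneg)

lemma tendsto_gP1: "X \<longlonglongrightarrow> y \<Longrightarrow> (\<lambda>t. gP1 (X t)) \<longlonglongrightarrow> gP1 y"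
  by (rule isCont_tendsto_compose[OF has_derivative_continuous[OF gP1_derivative]])

lemma tendsto_q: "X \<longlonglongrightarrow> y \<Longrightarrow> (\<lambda>t. q (X t)) \<longlonglongrightarrow> q y"
  unfolding q_def
  by (intro tendsto_diff continuous_on_tendsto_compose[OF P2_continuous]
      isCont_tendsto_compose[OF has_derivative_continuous[OF P1_gradient[unfolded gderiv_def]]]) auto

text \<open>By the optimality system the products of \<open>lam t\<close> and the model gradient are bounded. Along
  indices with \<open>lam\<close> tending to infinity the model gradient, and hence also \<open>gP1 (x t) - \<zeta> t\<close>, tends to
  0, and the model constraint is active. A limit point \<open>xh\<close> then satisfies \<open>q xh = 0\<close> and 0 belongs to
  the Clarke subdifferential of \<open>q\<close> at \<open>xh\<close>, against the constraint qualification.\<close>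

lemma bounded_lam: "bounded (range lam)"
proof (rule ccontr)
  assume unbounded: "\<not> bounded (range lam)"
  have "\<exists>t\<ge>n. lam t > real n" for n
  proof (rule ccontr)
    assume "\<not> (\<exists>t\<ge>n. lam t > real n)"
    then have "\<forall>\<^sub>F t in sequentially. norm (lam t) \<le> real n"
      unfolding eventually_sequentially using lam_nonneg by (intro exI[of _ n]) (auto simp: not_less)
    then have "Bseq lam" by (rule BfunI)
    then show False using unbounded by (simp add: Bseq_eq_bounded)
  qed
  then obtain \<tau> where \<tau>: "\<And>n. \<tau> n \<ge> n" "\<And>n. lam (\<tau> n) > real n" by metis
  have \<tau>_lim: "filterlim \<tau> at_top sequentially"
    by (rule filterlim_at_top_mono[OF filterlim_ident]) (use \<tau>(1) in auto)
  obtain Bs where Bs: "\<And>t. norm (s t) \<le> Bs" using bounded_s by (auto simp: bounded_iff)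
  obtain R where R: "R > 0" "\<And>t. norm (x t) \<le> R" using norm_x_bound by blast
  \<comment> \<open>The gradient of the model constraint at the new iterate.\<close>
  define g where "g t = gP1 (x t) - \<zeta> t + l t *\<^sub>R (x (Suc t) - x t)" for t
  define B where "B = Bs + l1_l2 (x 0) + \<alpha> * (2 * R)"
  have lam_g: "lam t * norm (g t) \<le> B" for t
  proof -
    have "lam t *\<^sub>R g t = (l1_l2 (x t) / norm (x t)) *\<^sub>R x t - s t - \<alpha> *\<^sub>R (x (Suc t) - x t)"
      using kkt[of t] by (simp add: g_def algebra_simps add_eq_0_iff)
    then have "lam t * norm (g t) = norm ((l1_l2 (x t) / norm (x t)) *\<^sub>R x t - s t - \<alpha> *\<^sub>R (x (Suc t) - x t))"
      using lam_nonneg[of t] by (metis abs_of_nonneg norm_scaleR)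
    also have "\<dots> \<le> norm ((l1_l2 (x t) / norm (x t)) *\<^sub>R x t) + norm (s t) + norm (\<alpha> *\<^sub>R (x (Suc t) - x t))"
      using norm_triangle_ineq4[of "(l1_l2 (x t) / norm (x t)) *\<^sub>R x t - s t" "\<alpha> *\<^sub>R (x (Suc t) - x t)"]
        norm_triangle_ineq4[of "(l1_l2 (x t) / norm (x t)) *\<^sub>R x t" "s t"] by linarith
    also have "norm ((l1_l2 (x t) / norm (x t)) *\<^sub>R x t) = l1_l2 (x t)"
      using x_nonzero[of t] l1_l2_nonneg[of "x t"] by simp
    also have "norm (\<alpha> *\<^sub>R (x (Suc t) - x t)) \<le> \<alpha> * (2 * R)"
    proof -
      have "norm (x (Suc t) - x t) \<le> 2 * R" using norm_triangle_ineq4[of "x (Suc t)" "x t"] R(2)[of t] R(2)[of "Suc t"] by linarith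
      then show ?thesis using \<alpha>_pos by (simp add: mult_left_mono)
    qed
    finally show ?thesis using Bs[of t] ratio_le_initial[of t] by (simp add: B_def)
  qed
  have "(\<lambda>n. g (\<tau> n)) \<longlonglongrightarrow> 0"
  proof (rule Lim_null_comparison)
    show "\<forall>\<^sub>F n in sequentially. norm (g (\<tau> n)) \<le> B / real n"
      using eventually_gt_at_top[of 0]
    proof eventually_elim
      case (elim n)
      have "real n * norm (g (\<tau> n)) \<le> lam (\<tau> n) * norm (g (\<tau> n))"
        using \<tau>(2)[of n] by (intro mult_right_mono) auto
      also have "\<dots> \<le> B" by (rule lam_g)
      finally show ?case using elim by (simp add: field_simps)
    qed
    show "(\<lambda>n. B / real n) \<longlonglongrightarrow> 0" by (rule lim_const_over_n)
  qed
  from tendsto_diff[OF this filterlim_compose[OF l_step_tendsto_0 \<tau>_lim]]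
  have grad0: "(\<lambda>n. gP1 (x (\<tau> n)) - \<zeta> (\<tau> n)) \<longlonglongrightarrow> 0" by (simp add: g_def)
  have q_eq: "q (x (\<tau> n)) = - ((gP1 (x (\<tau> n)) - \<zeta> (\<tau> n)) \<bullet> (x (Suc (\<tau> n)) - x (\<tau> n)))
      - 1 / 2 * ((l (\<tau> n) *\<^sub>R (x (Suc (\<tau> n)) - x (\<tau> n))) \<bullet> (x (Suc (\<tau> n)) - x (\<tau> n)))" for n
    using complementarity[of "\<tau> n"] \<tau>(2)[of n] by (auto simp: power2_norm_eq_inner)
  have "(\<lambda>n. q (x (\<tau> n))) \<longlonglongrightarrow> - (0 \<bullet> (0 :: real^'n)) - 1 / 2 * (0 \<bullet> (0 :: real^'n))"
    unfolding q_eq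
    by (intro tendsto_intros grad0 filterlim_compose[OF l_step_tendsto_0 \<tau>_lim]
        filterlim_compose[OF steps_tendsto_0 \<tau>_lim])
  then have q0: "(\<lambda>n. q (x (\<tau> n))) \<longlonglongrightarrow> 0" by simp
  have "bounded (range (\<lambda>n. (x (\<tau> n), \<zeta> (\<tau> n))))"
    by (rule bounded_subset[OF bounded_Times[OF bounded_x bounded_\<zeta>]]) auto
  then obtain p r where r: "strict_mono r" "((\<lambda>n. (x (\<tau> n), \<zeta> (\<tau> n))) \<circ> r) \<longlonglongrightarrow> p"
    using bounded_imp_convergent_subsequence by blast
  obtain xh \<zeta>h where p: "p = (xh, \<zeta>h)" by (cases p)
  have xh: "(\<lambda>n. x (\<tau> (r n))) \<longlonglongrightarrow> xh" and \<zeta>h: "(\<lambda>n. \<zeta> (\<tau> (r n))) \<longlonglongrightarrow> \<zeta>h"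
    using tendsto_fst[OF r(2)] tendsto_snd[OF r(2)] by (auto simp: p o_def)
  have "q xh = 0"
    using LIMSEQ_unique[OF tendsto_q[OF xh]] LIMSEQ_subseq_LIMSEQ[OF q0 r(1)] by (simp add: o_def)
  moreover have "gP1 xh - \<zeta>h = 0"
    using LIMSEQ_unique[OF tendsto_diff[OF tendsto_gP1[OF xh] \<zeta>h]] LIMSEQ_subseq_LIMSEQ[OF grad0 r(1)]
    by (simp add: o_def)
  moreover have "\<zeta>h \<in> subgrad P2 xh"
    by (rule subgrad_closed[OF P2_continuous xh \<zeta>h \<zeta>_subgrad])
  then have "gP1 xh - \<zeta>h \<in> clarke_subdiff q xh"
    using clarke_subdiff_difference[OF P1_gradient] q_def by presburger
  ultimately show False using GMFCQ[of xh] by (simp add: GMFCQ_at_def)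
qed

definition potential_subgradient :: "nat \<Rightarrow> (real^'n) \<times> (real^'n) \<times> (real^'n) \<times> real" where
  "potential_subgradient t = (let X = x (Suc t); Y = x t; m = lam t / norm X in
     ((1 / norm X) *\<^sub>R (s t - (l1_l2 X / norm X) *\<^sub>R X) + m *\<^sub>R (gP1 Y - \<zeta> t + l t *\<^sub>R (X - Y)),
      m *\<^sub>R (adjoint (blinfun_apply (HP1 Y)) (X - Y) - l t *\<^sub>R (X - Y)), m *\<^sub>R (Y - X), m * ((norm (X - Y))\<^sup>2 / 2)))"

lemma q_tilde_minorant_z:
  "q_tilde_minorant P1 gP1 P2 (x t) (z t) = q (x t) + (gP1 (x t) - \<zeta> t) \<bullet> (x (Suc t) - x t)
          + l t / 2 * (norm (x (Suc t) - x t))\<^sup>2"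
  by (simp add: q_tilde_minorant_def z_def q_def inner_diff_right inner_diff_left inner_commute)

lemma F_tilde_z: "F_tilde P1 gP1 P2 \<rho> (z t) = ereal (w t)"
  and potential_subgradient_frechet: "potential_subgradient t \<in> frechet_subdiff (F_tilde P1 gP1 P2 \<rho>) (z t)"
proof -
  have m: "0 \<le> lam t / norm (x (Suc t))" using lam_nonneg by simp
  have le: "q_tilde_minorant P1 gP1 P2 (x t) (x (Suc t), x t, \<zeta> t, l t) \<le> 0"
    using model_le[of t] q_tilde_minorant_z[of t] by (simp add: z_def)
  have compl: "lam t / norm (x (Suc t)) * q_tilde_minorant P1 gP1 P2 (x t) (x (Suc t), x t, \<zeta> t, l t) = 0"
    using complementarity[of t] q_tilde_minorant_z[of t] by (auto simp: z_def)
  note F = frechet_subdiff_F_tilde[of P1 "x t" gP1 "HP1 (x t)" "\<zeta> t" P2 "s t" "x (Suc t)" \<rho>,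
      OF P1_gradient gP1_derivative \<zeta>_subgrad s_subgrad \<rho>_pos less_imp_le[OF norm_x_gt] m le compl]
  show "F_tilde P1 gP1 P2 \<rho> (z t) = ereal (w t)" using F(1) by (simp add: z_def w_def)
  show "potential_subgradient t \<in> frechet_subdiff (F_tilde P1 gP1 P2 \<rho>) (z t)"
    using F(2) by (simp only: potential_subgradient_def Let_def z_def)
qed

text \<open>In the first component the optimality system cancels the model gradient, and what remains
  is the change of \<open>(l1_l2 x / norm x) x\<close> over one step plus the proximal term; every other component
  contains a factor \<open>x (Suc t) - x t\<close>. The remaining factors are bounded along the iterates.\<close>

lemma potential_subgradient_bound: "\<exists>C>0. \<forall>t. norm (potential_subgradient t) \<le> C * d t"
proof -
  obtain R where R: "R > 0" "\<And>t. norm (x t) \<le> R" using norm_x_bound by blast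
  obtain \<Lambda> where \<Lambda>: "\<And>t. lam t \<le> \<Lambda>" using bounded_lam by (auto simp: bounded_iff dest: abs_le_D1)
  have \<Lambda>0: "0 \<le> \<Lambda>" using lam_nonneg[of 0] \<Lambda>[of 0] by linarith
  have lbar0: "0 \<le> lbar" using l_bounds[of 0] by linarith
  have "compact (HP1 ` closure (range x))"
    using bounded_x by (intro compact_continuous_image continuous_on_subset[OF HP1_continuous])
      (auto simp: compact_closure)
  then obtain H where "\<forall>y\<in>closure (range x). norm (HP1 y) \<le> H"
    by (auto dest!: compact_imp_bounded simp: bounded_iff)
  then have H: "norm (HP1 (x t)) \<le> H" for t using closure_subset[of "range x"] by auto
  have H0: "0 \<le> H" using H[of 0] norm_ge_zero order_trans by blast
  define m where "m = \<Lambda> / \<rho>"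
  define CA where "CA = ((CARD('n) + 3 * l1_l2 (x 0)) / \<rho> + \<alpha>) / \<rho>"
  define C where "C = CA + m * (H + lbar) + m + m * R + 1"
  have m0: "0 \<le> m" using \<Lambda>0 \<rho>_pos by (simp add: m_def)
  have CA0: "0 \<le> CA" using \<rho>_pos \<alpha>_pos l1_l2_nonneg[of "x 0"] by (simp add: CA_def)
  have "norm (potential_subgradient t) \<le> C * d t" for t
  proof -
    let ?X = "x (Suc t)" and ?Y = "x t" and ?m = "lam t / norm (x (Suc t))"
    have X: "norm ?X > 0" "norm ?X \<ge> \<rho>" "norm ?Y \<ge> \<rho>" using norm_x_gt[of t] norm_x_gt[of "Suc t"] \<rho>_pos by auto
    have m: "0 \<le> ?m" "?m \<le> m"
      using lam_nonneg[of t] \<Lambda>[of t] X \<rho>_pos by (auto simp: m_def intro!: frac_le)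
    define A where "A = (1 / norm ?X) *\<^sub>R (s t - (l1_l2 ?X / norm ?X) *\<^sub>R ?X) + ?m *\<^sub>R (gP1 ?Y - \<zeta> t + l t *\<^sub>R (?X - ?Y))"
    define B where "B = ?m *\<^sub>R (adjoint (blinfun_apply (HP1 ?Y)) (?X - ?Y) - l t *\<^sub>R (?X - ?Y))"
    define D where "D = ?m *\<^sub>R (?Y - ?X)"
    define E where "E = ?m * ((norm (?X - ?Y))\<^sup>2 / 2)"
    have d0: "0 \<le> d t" by (simp add: d_def)
    have "A = (1 / norm ?X) *\<^sub>R ((l1_l2 ?Y / norm ?Y) *\<^sub>R ?Y - (l1_l2 ?X / norm ?X) *\<^sub>R ?X - \<alpha> *\<^sub>R (?X - ?Y))"
    proof -
      \<comment> \<open>Solving the optimality system for \<open>s t\<close> lets the multiplier terms cancel.\<close>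
      have st: "s t = (l1_l2 ?Y / norm ?Y) *\<^sub>R ?Y - \<alpha> *\<^sub>R (?X - ?Y) - lam t *\<^sub>R (gP1 ?Y - \<zeta> t + l t *\<^sub>R (?X - ?Y))"
        using kkt[of t] by (simp add: algebra_simps add_eq_0_iff)
      show ?thesis unfolding A_def st by (simp add: algebra_simps)
    qed
    then have "norm A = 1 / norm ?X * norm ((l1_l2 ?Y / norm ?Y) *\<^sub>R ?Y - (l1_l2 ?X / norm ?X) *\<^sub>R ?X - \<alpha> *\<^sub>R (?X - ?Y))"
      by simp
    also have "\<dots> \<le> 1 / \<rho> * (((CARD('n) + 3 * l1_l2 (x 0)) / \<rho> + \<alpha>) * d t)"
    proof (rule mult_mono)
      have "norm ((l1_l2 ?Y / norm ?Y) *\<^sub>R ?Y - (l1_l2 ?X / norm ?X) *\<^sub>R ?X) \<le> (CARD('n) + 3 * l1_l2 ?X) / \<rho> * norm (?X - ?Y)"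
        by (rule l1_l2_direction_lipschitz[OF \<rho>_pos X(2,3) ratio_decseq])
      also have "\<dots> \<le> (CARD('n) + 3 * l1_l2 (x 0)) / \<rho> * norm (?X - ?Y)"
        using ratio_le_initial[of "Suc t"] \<rho>_pos by (intro mult_right_mono divide_right_mono) auto
      finally show "norm ((l1_l2 ?Y / norm ?Y) *\<^sub>R ?Y - (l1_l2 ?X / norm ?X) *\<^sub>R ?X - \<alpha> *\<^sub>R (?X - ?Y))
          \<le> ((CARD('n) + 3 * l1_l2 (x 0)) / \<rho> + \<alpha>) * d t"
        using norm_triangle_ineq4[of "(l1_l2 ?Y / norm ?Y) *\<^sub>R ?Y - (l1_l2 ?X / norm ?X) *\<^sub>R ?X" "\<alpha> *\<^sub>R (?X - ?Y)"] \<alpha>_pos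
        by (simp add: d_def distrib_right)
    qed (use X \<rho>_pos in \<open>auto intro!: divide_left_mono\<close>)
    also have "\<dots> = CA * d t" by (simp add: CA_def)
    finally have A: "norm A \<le> CA * d t" .
    have "norm B = ?m * norm (adjoint (blinfun_apply (HP1 ?Y)) (?X - ?Y) - l t *\<^sub>R (?X - ?Y))"
      using lam_nonneg[of t] by (simp add: B_def)
    also have "\<dots> \<le> m * ((H + lbar) * d t)"
    proof (rule mult_mono[OF m(2)])
      have "norm (adjoint (blinfun_apply (HP1 ?Y)) (?X - ?Y)) \<le> H * d t"
        unfolding d_def using norm_adjoint_le mult_right_mono[OF H] norm_ge_zero order_trans by blast
      moreover have "norm (l t *\<^sub>R (?X - ?Y)) \<le> lbar * d t"
        using l_bounds[of t] by (simp add: d_def mult_right_mono)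
      ultimately show "norm (adjoint (blinfun_apply (HP1 ?Y)) (?X - ?Y) - l t *\<^sub>R (?X - ?Y)) \<le> (H + lbar) * d t"
        using norm_triangle_ineq4[of "adjoint (blinfun_apply (HP1 ?Y)) (?X - ?Y)" "l t *\<^sub>R (?X - ?Y)"]
        by (simp add: distrib_right)
    qed (use m0 in auto)
    finally have B: "norm B \<le> m * (H + lbar) * d t" by simp
    have "norm D = ?m * d t" using lam_nonneg[of t] by (simp add: D_def d_def norm_minus_commute)
    then have D: "norm D \<le> m * d t" using mult_right_mono[OF m(2) d0] by simp
    have dR: "d t \<le> 2 * R"
      unfolding d_def using norm_triangle_ineq4[of ?X ?Y] R(2)[of t] R(2)[of "Suc t"] by linarith
    have "norm E = ?m * ((d t)\<^sup>2 / 2)" using lam_nonneg[of t] by (simp add: E_def d_def)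
    also have "\<dots> \<le> m * (R * d t)"
      using m m0 mult_right_mono[OF dR d0] by (intro mult_mono) (auto simp: power2_eq_square)
    finally have E: "norm E \<le> m * R * d t" by simp
    have "norm (potential_subgradient t) = norm (A, B, D, E)"
      by (simp add: potential_subgradient_def Let_def A_def B_def D_def E_def)
    also have "\<dots> \<le> norm A + (norm B + (norm D + norm E))"
      by (meson norm_Pair_le add_left_mono order_trans)
    also have "\<dots> \<le> (CA + m * (H + lbar) + m + m * R) * d t"
      using A B D E by (simp add: distrib_right)
    also have "\<dots> \<le> C * d t" using d0 by (simp add: C_def distrib_right)
    finally show ?thesis .
  qed
  moreover have "C > 0"
    unfolding C_def using CA0 m0 H0 lbar0 R(1) by (intro add_nonneg_pos add_nonneg_nonneg mult_nonneg_nonneg) auto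
  ultimately show ?thesis by blast
qed

lemma bounded_z: "bounded (range z)"
proof -
  have "range z \<subseteq> range x \<times> range x \<times> range \<zeta> \<times> range l" by (auto simp: z_def)
  then show ?thesis
    using bounded_Times[OF bounded_x bounded_Times[OF bounded_x bounded_Times[OF bounded_\<zeta> bounded_l]]]
    by (rule bounded_subset[rotated])
qed

text \<open>Closedness of the potential bounds its value at \<open>p\<close> by the limit of the values, so it is finite
  there and given by the ratio, which is continuous. The subgradients along the sequence tend to 0, so 0 is
  a limiting subgradient at \<open>p\<close>.\<close>

lemma F_tilde_cluster_point:
  assumes closed: "closed_fun (F_tilde P1 gP1 P2 \<rho>)" and ws: "w \<longlonglongrightarrow> ws" and p: "cluster_point z p"
  shows "F_tilde P1 gP1 P2 \<rho> p = ereal ws" and "p \<in> dom_subdiff (F_tilde P1 gP1 P2 \<rho>)"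
proof -
  let ?F = "F_tilde P1 gP1 P2 \<rho>"
  obtain r where r: "strict_mono r" "(z \<circ> r) \<longlonglongrightarrow> p" using p by (auto simp: cluster_point_def)
  have wr: "(\<lambda>n. w (r n)) \<longlonglongrightarrow> ws" using LIMSEQ_subseq_LIMSEQ[OF ws r(1)] by (simp add: o_def)
  have "(\<lambda>n. (z (r n), w (r n))) \<longlonglongrightarrow> (p, ws)"
    using r(2) wr by (intro tendsto_Pair) (auto simp: o_def)
  then have "(p, ws) \<in> {(y, c). ?F y \<le> ereal c}"
    using closed unfolding closed_fun_def by (elim closed_sequentially) (auto simp: F_tilde_z)
  then have "?F p \<noteq> \<infinity>" by auto
  then have Fp: "?F p = ereal (l1_l2 (fst p))" and "\<rho> \<le> norm (fst p)"
    by (auto simp: F_tilde_eq_l1_l2_or_infinity)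
  then have "fst p \<noteq> 0" using \<rho>_pos by auto
  moreover have "(\<lambda>n. x (Suc (r n))) \<longlonglongrightarrow> fst p" using tendsto_fst[OF r(2)] by (simp add: z_def o_def)
  ultimately have "(\<lambda>n. w (r n)) \<longlonglongrightarrow> l1_l2 (fst p)" unfolding w_def by (intro tendsto_l1_l2)
  then have "l1_l2 (fst p) = ws" using wr LIMSEQ_unique by blast
  then show F: "?F p = ereal ws" using Fp by simp
  obtain C where C: "\<And>t. norm (potential_subgradient t) \<le> C * d t" using potential_subgradient_bound by blast
  have "potential_subgradient \<longlonglongrightarrow> 0"
    by (rule Lim_null_comparison[where g = "\<lambda>t. C * d t"])
       (use C tendsto_mult_left[OF d_tendsto_0, of C] in auto)
  then have "(potential_subgradient \<circ> r) \<longlonglongrightarrow> 0" using r(1) by (rule LIMSEQ_subseq_LIMSEQ)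
  then have "0 \<in> limiting_subdiff ?F p"
    unfolding limiting_subdiff_def
    using r(2) wr potential_subgradient_frechet
    by (intro CollectI conjI exI[of _ "z \<circ> r"] exI[of _ "potential_subgradient \<circ> r"]) (auto simp: F F_tilde_z)
  then show "p \<in> dom_subdiff ?F" by (auto simp: dom_subdiff_def)
qed

lemma kl_descent_potential:
  assumes closed: "closed_fun (F_tilde P1 gP1 P2 \<rho>)"
  obtains ws C \<kappa> where "kl_descent (F_tilde P1 gP1 P2 \<rho>) z potential_subgradient w d ws C \<kappa>"
    "\<And>p. cluster_point z p \<Longrightarrow> p \<in> dom_subdiff (F_tilde P1 gP1 P2 \<rho>)"
proof -
  obtain ws where ws: "w \<longlonglongrightarrow> ws" using w_convergent by blast
  obtain C where C: "C > 0" "\<And>t. norm (potential_subgradient t) \<le> C * d t" using potential_subgradient_bound by blast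
  obtain R where R: "R > 0" "\<And>t. norm (x t) \<le> R" using norm_x_bound by blast
  have "kl_descent (F_tilde P1 gP1 P2 \<rho>) z potential_subgradient w d ws C (\<alpha> / (2 * R))"
  proof
    show "potential_subgradient t \<in> limiting_subdiff (F_tilde P1 gP1 P2 \<rho>) (z t)" for t
      using potential_subgradient_frechet frechet_subset_limiting by blast
    show "\<alpha> / (2 * R) * (d (Suc t))\<^sup>2 \<le> w t - w (Suc t)" for t
      unfolding w_def by (rule ratio_decrease[OF R(2)])
    show "F_tilde P1 gP1 P2 \<rho> p = ereal ws" if "cluster_point z p" for p
      using F_tilde_cluster_point[OF closed ws that] by blast
    show "0 < \<alpha> / (2 * R)" using R \<alpha>_pos by simp
  qed (use bounded_z F_tilde_z ws C in \<open>auto simp: d_def\<close>)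
  with F_tilde_cluster_point(2)[OF closed ws] show ?thesis using that by blast
qed

text \<open>Subgradients, multipliers and steps are bounded, so along a subsequence the optimality systems
  converge. The limiting subgradient of the ratio is even a Frechet subgradient, which is what stationarity
  needs.\<close>

lemma limit_kkt:
  assumes xs: "x \<longlonglongrightarrow> xs"
  obtains u v m where "q xs \<le> 0" "0 \<le> m" "m * q xs = 0" "v \<in> subgrad P2 xs"
    "u \<in> frechet_subdiff (\<lambda>y. ereal (l1_l2 y)) xs" "u + m *\<^sub>R (gP1 xs - v) = 0"
proof -
  have q: "q xs \<le> 0" by (rule LIMSEQ_le_const2[OF tendsto_q[OF xs]]) (use x_feasible in auto)
  then have nz: "xs \<noteq> 0" using feasible_norm[of xs] \<rho>_pos by auto
  \<comment> \<open>One subsequence has to serve all three sequences, hence the product.\<close>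
  have "bounded (range (\<lambda>t. (\<zeta> t, lam t, s t)))"
    by (rule bounded_subset[OF bounded_Times[OF bounded_\<zeta> bounded_Times[OF bounded_lam bounded_s]]]) auto
  then obtain p r where r: "strict_mono r" "((\<lambda>t. (\<zeta> t, lam t, s t)) \<circ> r) \<longlonglongrightarrow> p"
    using bounded_imp_convergent_subsequence by blast
  obtain v m sh where p: "p = (v, m, sh)" by (cases p)
  have v: "(\<lambda>n. \<zeta> (r n)) \<longlonglongrightarrow> v" and m: "(\<lambda>n. lam (r n)) \<longlonglongrightarrow> m" and sh: "(\<lambda>n. s (r n)) \<longlonglongrightarrow> sh"
    using tendsto_fst[OF r(2)] tendsto_fst[OF tendsto_snd[OF r(2)]] tendsto_snd[OF tendsto_snd[OF r(2)]]
    by (auto simp: p o_def)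
  have xr: "(\<lambda>n. x (r n)) \<longlonglongrightarrow> xs" and xSr: "(\<lambda>n. x (Suc (r n))) \<longlonglongrightarrow> xs"
    using LIMSEQ_subseq_LIMSEQ[OF xs r(1)] LIMSEQ_subseq_LIMSEQ[OF LIMSEQ_Suc[OF xs] r(1)] by (auto simp: o_def)
  have step: "(\<lambda>n. x (Suc (r n)) - x (r n)) \<longlonglongrightarrow> 0" and lstep: "(\<lambda>n. l (r n) *\<^sub>R (x (Suc (r n)) - x (r n))) \<longlonglongrightarrow> 0"
    using LIMSEQ_subseq_LIMSEQ[OF steps_tendsto_0 r(1)] LIMSEQ_subseq_LIMSEQ[OF l_step_tendsto_0 r(1)]
    by (auto simp: o_def)
  have vP: "v \<in> subgrad P2 xs" by (rule subgrad_closed[OF P2_continuous xr v \<zeta>_subgrad])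
  have sP: "sh \<in> subgrad l1_norm xs" by (rule subgrad_closed[OF continuous_on_l1_norm xSr sh s_subgrad])
  have m0: "0 \<le> m" by (rule LIMSEQ_le_const[OF m]) (use lam_nonneg in auto)
  have "(\<lambda>n. s (r n) - (l1_l2 (x (r n)) / norm (x (r n))) *\<^sub>R x (r n) + \<alpha> *\<^sub>R (x (Suc (r n)) - x (r n))
          + lam (r n) *\<^sub>R (gP1 (x (r n)) - \<zeta> (r n) + l (r n) *\<^sub>R (x (Suc (r n)) - x (r n))))
      \<longlonglongrightarrow> sh - (l1_l2 xs / norm xs) *\<^sub>R xs + \<alpha> *\<^sub>R 0 + m *\<^sub>R (gP1 xs - v + 0)"
    using nz by (intro tendsto_intros sh xr step lstep m v tendsto_gP1 tendsto_l1_l2) auto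
  then have kkt_lim: "sh - (l1_l2 xs / norm xs) *\<^sub>R xs + m *\<^sub>R (gP1 xs - v) = 0"
    unfolding kkt by (simp add: tendsto_const_iff)
  have "(\<lambda>n. lam (r n) * (q (x (r n)) + (gP1 (x (r n)) - \<zeta> (r n)) \<bullet> (x (Suc (r n)) - x (r n))
          + 1 / 2 * ((l (r n) *\<^sub>R (x (Suc (r n)) - x (r n))) \<bullet> (x (Suc (r n)) - x (r n)))))
      \<longlonglongrightarrow> m * (q xs + (gP1 xs - v) \<bullet> 0 + 1 / 2 * (0 \<bullet> (0 :: real^'n)))"
    by (intro tendsto_intros m tendsto_q xr tendsto_gP1 v step lstep)
  moreover have "lam (r n) * (q (x (r n)) + (gP1 (x (r n)) - \<zeta> (r n)) \<bullet> (x (Suc (r n)) - x (r n))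
          + 1 / 2 * ((l (r n) *\<^sub>R (x (Suc (r n)) - x (r n))) \<bullet> (x (Suc (r n)) - x (r n)))) = 0" for n
    using complementarity[of "r n"] by (simp add: power2_norm_eq_inner)
  ultimately have "(\<lambda>n::nat. 0) \<longlonglongrightarrow> m * (q xs + (gP1 xs - v) \<bullet> 0 + 1 / 2 * (0 \<bullet> (0 :: real^'n)))"
    by (simp only:)
  then have mq: "m * q xs = 0" by (simp add: tendsto_const_iff)
  show ?thesis
  proof (rule that[OF q _ _ vP frechet_subdiff_l1_l2(1)[OF sP nz]])
    show "0 \<le> m / norm xs" "m / norm xs * q xs = 0" using m0 mq by auto
    have "(1 / norm xs) *\<^sub>R (sh - (l1_l2 xs / norm xs) *\<^sub>R xs + m *\<^sub>R (gP1 xs - v)) = 0" by (simp add: kkt_lim)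
    then show "(1 / norm xs) *\<^sub>R (sh - (l1_l2 xs / norm xs) *\<^sub>R xs) + (m / norm xs) *\<^sub>R (gP1 xs - v) = 0"
      by (simp only: scaleR_add_right scaleR_scaleR times_divide_eq_left mult_1)
  qed
qed

lemma limit_clarke_critical:
  assumes "x \<longlonglongrightarrow> xs"
  shows "clarke_critical_point q xs"
proof -
  obtain u v m where *: "q xs \<le> 0" "0 \<le> m" "m * q xs = 0" "v \<in> subgrad P2 xs"
    "u \<in> frechet_subdiff (\<lambda>y. ereal (l1_l2 y)) xs" "u + m *\<^sub>R (gP1 xs - v) = 0"
    using limit_kkt[OF assms] .
  have "gP1 xs - v \<in> clarke_subdiff q xs"
    using clarke_subdiff_difference[OF P1_gradient *(4)] q_def by presburger
  then show ?thesis
    unfolding clarke_critical_point_def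
    using *(1-3,5,6) frechet_subset_limiting[of "\<lambda>y. ereal (l1_l2 y)" xs]
    by (intro conjI exI[of _ m] CollectI exI[of _ u] exI[of _ "gP1 xs - v"]) auto
qed

text \<open>On the feasible set \<open>l1_l2 + m * q\<close> lies below the ratio, and both agree at \<open>xs\<close> by
  complementarity; regularity turns the limiting optimality system into one between Frechet subgradients.\<close>

lemma limit_stationary:
  assumes xs: "x \<longlonglongrightarrow> xs" and convex: "convex_on UNIV P2" and regular: "regular_fun_at q xs"
  shows "stationary_point q xs"
proof -
  obtain u v m where *: "q xs \<le> 0" "0 \<le> m" "m * q xs = 0" "v \<in> subgrad P2 xs"
    "u \<in> frechet_subdiff (\<lambda>y. ereal (l1_l2 y)) xs" "u + m *\<^sub>R (gP1 xs - v) = 0"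
    using limit_kkt[OF xs] .
  have q: "q = (\<lambda>y. P1 y - P2 y)" using q_def by auto
  have "gP1 xs - v \<in> frechet_subdiff (\<lambda>y. ereal (q y)) xs"
    using regular_difference_frechet_subdiff[OF P1_gradient convex P2_continuous *(4)] regular
    unfolding q by blast
  from frechet_subdiff_add_scaleR[OF *(5) this *(2)]
  have "0 \<in> frechet_subdiff (\<lambda>y. ereal (l1_l2 y + m * q y)) xs" by (simp only: *(6))
  then have "0 \<in> frechet_subdiff (\<lambda>y. ereal (l1_l2 y) + delta_fun {z. q z \<le> 0} y) xs"
  proof (rule frechet_subdiff_minorant)
    show "ereal (l1_l2 y + m * q y) \<le> ereal (l1_l2 y) + delta_fun {z. q z \<le> 0} y" for y
      using *(2) by (auto simp: delta_fun_def mult_nonneg_nonpos)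
  qed (use * in \<open>simp add: delta_fun_def\<close>)
  then show ?thesis using *(1) frechet_subset_limiting by (auto simp: stationary_point_def)
qed

end

text \<open>The line search accepts every \<open>l \<ge> L\<close>, because then the model constraint dominates \<open>q\<close>.
  So the last rejected value is below \<open>L\<close> and the accepted one at most \<open>max lmax (2 * L)\<close>.\<close>

lemma mba_step_kkt:
  fixes P1 P2 q :: "real^'n \<Rightarrow> real"
  assumes q_def: "\<And>y. q y = P1 y - P2 y"
    and P1_gradient: "\<And>y. GDERIV P1 y :> gP1 y"
    and lip: "L-lipschitz_on UNIV gP1"
    and convex: "convex_on UNIV P2"
    and GMFCQ: "\<And>y. q y \<le> 0 \<Longrightarrow> GMFCQ_at q y"
    and algorithm: "mba_sequence q gP1 P2 \<alpha> lmin lmax x"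
    and feas: "q (x t) \<le> 0"
  shows "\<exists>l \<zeta> lam s. 0 \<le> l \<and> l \<le> max lmax (2 * L) \<and> \<zeta> \<in> subgrad P2 (x t)
    \<and> mba_objective \<alpha> (l1_l2 (x t)) (x t) (x (Suc t)) \<le> mba_objective \<alpha> (l1_l2 (x t)) (x t) (x t)
    \<and> q (x t) + (gP1 (x t) - \<zeta>) \<bullet> (x (Suc t) - x t) + l / 2 * (norm (x (Suc t) - x t))\<^sup>2 \<le> 0
    \<and> 0 \<le> lam \<and> lam * (q (x t) + (gP1 (x t) - \<zeta>) \<bullet> (x (Suc t) - x t)
          + l / 2 * (norm (x (Suc t) - x t))\<^sup>2) = 0
    \<and> s \<in> subgrad l1_norm (x (Suc t))
    \<and> s - (l1_l2 (x t) / norm (x t)) *\<^sub>R x t + \<alpha> *\<^sub>R (x (Suc t) - x t)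
          + lam *\<^sub>R (gP1 (x t) - \<zeta> + l *\<^sub>R (x (Suc t) - x t)) = 0"
proof -
  have pars: "0 < \<alpha>" "0 < lmin" using algorithm by (auto simp: mba_sequence_def)
  obtain l0 \<zeta> z j where l0: "l0 \<in> {lmin..lmax}" and \<zeta>: "\<zeta> \<in> limiting_subdiff (\<lambda>y. ereal (P2 y)) (x t)"
    and min: "\<And>i. i \<le> j \<Longrightarrow> is_arg_min (mba_objective \<alpha> (l1_l2 (x t)) (x t))
                   (mba_feasible q gP1 (x t) \<zeta> (2 ^ i * l0)) (z i)"
    and fail: "\<And>i. i < j \<Longrightarrow> \<not> q (z i) \<le> 0" and xz: "x (Suc t) = z j"
    using algorithm unfolding mba_sequence_def by blast
  have sub: "\<zeta> \<in> subgrad P2 (x t)" using limiting_subdiff_convex[OF convex] \<zeta> by blast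
  define l where "l = 2 ^ j * l0"
  have l: "0 < l" using l0 pars by (simp add: l_def)
  have "l \<le> max lmax (2 * L)"
  proof (cases j)
    case 0
    then show ?thesis using l0 by (simp add: l_def le_max_iff_disj)
  next
    case (Suc i)
    let ?l = "2 ^ i * l0"
    have "?l < L"
    proof (rule ccontr)
      assume "\<not> ?l < L"
      then have "L / 2 * (norm (z i - x t))\<^sup>2 \<le> ?l / 2 * (norm (z i - x t))\<^sup>2" by (intro mult_right_mono) auto
      moreover have "P1 (z i) \<le> P1 (x t) + gP1 (x t) \<bullet> (z i - x t) + L / 2 * (norm (z i - x t))\<^sup>2"
        by (rule gradient_lipschitz_upper_bound[OF P1_gradient lip])
      moreover have "P2 (x t) + \<zeta> \<bullet> (z i - x t) \<le> P2 (z i)" using sub by (simp add: subgrad_def)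
      moreover have "q (x t) + (gP1 (x t) - \<zeta>) \<bullet> (z i - x t) + ?l / 2 * (norm (z i - x t))\<^sup>2 \<le> 0"
        using min[of i] Suc by (simp add: is_arg_min_def mba_feasible_def)
      ultimately have "q (z i) \<le> 0" unfolding inner_diff_left q_def by linarith
      then show False using fail Suc by blast
    qed
    then show ?thesis by (simp add: l_def Suc)
  qed
  have opt: "is_arg_min (mba_objective \<alpha> (l1_l2 (x t)) (x t)) (mba_feasible q gP1 (x t) \<zeta> l) (x (Suc t))"
    using min[of j] by (simp add: xz l_def)
  have "gP1 (x t) \<noteq> \<zeta>" if "q (x t) = 0"
  proof
    assume "gP1 (x t) = \<zeta>"
    moreover have "gP1 (x t) - \<zeta> \<in> clarke_subdiff q (x t)"
      using clarke_subdiff_difference[OF P1_gradient sub] q_def by presburger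
    ultimately show False using GMFCQ[OF feas] that by (simp add: GMFCQ_at_def)
  qed
  then obtain lam s where "lam \<ge> 0" "s \<in> subgrad l1_norm (x (Suc t))"
    "lam * (q (x t) + (gP1 (x t) - \<zeta>) \<bullet> (x (Suc t) - x t) + l / 2 * (norm (x (Suc t) - x t))\<^sup>2) = 0"
    "s - (l1_l2 (x t) / norm (x t)) *\<^sub>R x t + \<alpha> *\<^sub>R (x (Suc t) - x t)
       + lam *\<^sub>R (gP1 (x t) - \<zeta> + l *\<^sub>R (x (Suc t) - x t)) = 0"
    using mba_subproblem_kkt[OF opt pars(1) l feas] by metis
  moreover have "mba_objective \<alpha> (l1_l2 (x t)) (x t) (x (Suc t)) \<le> mba_objective \<alpha> (l1_l2 (x t)) (x t) (x t)"
    using opt feas by (auto simp: is_arg_min_def mba_feasible_def not_less)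
  moreover have "q (x t) + (gP1 (x t) - \<zeta>) \<bullet> (x (Suc t) - x t) + l / 2 * (norm (x (Suc t) - x t))\<^sup>2 \<le> 0"
    using opt by (simp add: is_arg_min_def mba_feasible_def)
  ultimately show ?thesis
    using less_imp_le[OF l] \<open>l \<le> max lmax (2 * L)\<close> sub by blast
qed

section \<open>Convergence\<close>

lemma convergent_of_summable_steps:
  fixes x :: "nat \<Rightarrow> 'a::banach"
  assumes "summable (\<lambda>t. norm (x (Suc t) - x t))"
  shows "\<exists>xs. x \<longlonglongrightarrow> xs \<and> (\<forall>t. norm (x t - xs) \<le> (\<Sum>i. norm (x (Suc (i + t)) - x (i + t))))"
proof -
  have sum: "summable (\<lambda>i. norm (x (Suc (i + t)) - x (i + t)))" for t
    using summable_ignore_initial_segment[OF assms, of t] by simp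
  define L where "L t = x t + (\<Sum>i. x (Suc (i + t)) - x (i + t))" for t
  have L: "x \<longlonglongrightarrow> L t" for t
  proof -
    have "(\<lambda>n. x t + (\<Sum>i<n. x (Suc (i + t)) - x (i + t))) \<longlonglongrightarrow> L t"
      unfolding L_def by (intro tendsto_intros summable_LIMSEQ summable_norm_cancel[OF sum])
    moreover have "x t + (\<Sum>i<n. x (Suc (i + t)) - x (i + t)) = x (n + t)" for n
      by (induction n) (auto simp: algebra_simps)
    ultimately have "(\<lambda>n. x (n + t)) \<longlonglongrightarrow> L t" by simp
    then show ?thesis by (rule LIMSEQ_offset)
  qed
  have "norm (x t - L 0) \<le> (\<Sum>i. norm (x (Suc (i + t)) - x (i + t)))" for t
  proof -
    have "L 0 = L t" by (rule LIMSEQ_unique[OF L L])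
    then have "x t - L 0 = - (\<Sum>i. x (Suc (i + t)) - x (i + t))" by (simp add: L_def)
    then show ?thesis using summable_norm[OF sum[of t]] by simp
  qed
  with L show ?thesis by blast
qed

theorem theorem6p6:
  fixes P1 P2 q :: "real^'n \<Rightarrow> real"
    and gP1 :: "real^'n \<Rightarrow> real^'n"
    and HP1 :: "real^'n \<Rightarrow> (real^'n) \<Rightarrow>\<^sub>L (real^'n)"
    and x :: "nat \<Rightarrow> real^'n"
    and L \<alpha> lmin lmax \<rho> :: real
  assumes q_def: "\<And>y. q y = P1 y - P2 y"
    and P1_gradient: "\<And>y. GDERIV P1 y :> gP1 y"
    and P1_gradient_Lipschitz: "L-lipschitz_on UNIV gP1"
    and P1_C2: "\<And>y. (gP1 has_derivative blinfun_apply (HP1 y)) (at y)"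
      "continuous_on UNIV HP1"
    and P2_convex: "convex_on UNIV P2"
    and P2_continuous: "continuous_on UNIV P2"
    and feasible: "{y. q y \<le> 0} \<noteq> {}"
    and q_0: "q 0 > 0"
    and GMFCQ: "\<And>y. q y \<le> 0 \<Longrightarrow> GMFCQ_at q y"
    and algorithm: "mba_sequence q gP1 P2 \<alpha> lmin lmax x"
    and bounded: "bounded (range x)"
    and \<rho>: "\<rho> > 0" "{y. q y \<le> 0} \<subseteq> {y. norm y > \<rho>}"
    and KL: "KL_function (F_tilde P1 gP1 P2 \<rho>)"
  shows "\<exists>xs. x \<longlonglongrightarrow> xs \<and> clarke_critical_point q xs \<and>
           (regular_fun_at q xs \<longrightarrow> stationary_point q xs) \<and>
           (\<forall>\<theta>\<in>{0..<1}. KL_function_with_exponent (F_tilde P1 gP1 P2 \<rho>) \<theta> \<longrightarrow>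
              (\<theta> = 0 \<longrightarrow> (\<exists>T. \<forall>t\<ge>T. x t = xs)) \<and>
              (\<theta> \<in> {0<..1/2} \<longrightarrow>
                 (\<exists>c0 Q1 T. c0 > 0 \<and> Q1 \<in> {0<..<1} \<and>
                    (\<forall>t>T. norm (x t - xs) \<le> c0 * Q1 ^ t))) \<and>
              (\<theta> \<in> {1/2<..<1} \<longrightarrow>
                 (\<exists>c0 T. c0 > 0 \<and>
                    (\<forall>t>T. norm (x t - xs) \<le> c0 * real t powr (- ((1 - \<theta>) / (2 * \<theta> - 1)))))))"
proof -
  have feas: "q (x t) \<le> 0" for t
    using algorithm unfolding mba_sequence_def by (cases t) metis+
  have "\<alpha> > 0" using algorithm by (simp add: mba_sequence_def)
  from mba_step_kkt[OF q_def P1_gradient P1_gradient_Lipschitz P2_convex GMFCQ algorithm feas]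
  obtain l \<zeta> lam s where kkt: "\<And>t. 0 \<le> l t \<and> l t \<le> max lmax (2 * L) \<and> \<zeta> t \<in> subgrad P2 (x t)
    \<and> mba_objective \<alpha> (l1_l2 (x t)) (x t) (x (Suc t)) \<le> mba_objective \<alpha> (l1_l2 (x t)) (x t) (x t)
    \<and> q (x t) + (gP1 (x t) - \<zeta> t) \<bullet> (x (Suc t) - x t) + l t / 2 * (norm (x (Suc t) - x t))\<^sup>2 \<le> 0
    \<and> 0 \<le> lam t \<and> lam t * (q (x t) + (gP1 (x t) - \<zeta> t) \<bullet> (x (Suc t) - x t)
          + l t / 2 * (norm (x (Suc t) - x t))\<^sup>2) = 0
    \<and> s t \<in> subgrad l1_norm (x (Suc t))
    \<and> s t - (l1_l2 (x t) / norm (x t)) *\<^sub>R x t + \<alpha> *\<^sub>R (x (Suc t) - x t)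
          + lam t *\<^sub>R (gP1 (x t) - \<zeta> t + l t *\<^sub>R (x (Suc t) - x t)) = 0"
    by metis
  interpret mba_kkt P1 P2 q gP1 HP1 x \<zeta> s l lam \<alpha> \<rho> "max lmax (2 * L)"
    by unfold_locales
      (use q_def P1_gradient P1_C2 P2_continuous GMFCQ \<rho> bounded feas \<open>\<alpha> > 0\<close> kkt in blast)+
  let ?F = "F_tilde P1 gP1 P2 \<rho>"
  have "closed_fun ?F" using KL by (simp add: KL_function_def)
  then obtain ws C \<kappa> where "kl_descent ?F z potential_subgradient w d ws C \<kappa>"
      and dom: "\<And>p. cluster_point z p \<Longrightarrow> p \<in> dom_subdiff ?F"
    using kl_descent_potential by blast
  then interpret D: kl_descent ?F z potential_subgradient w d ws C \<kappa> by simp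
  have "summable d" using D.finite_length KL dom by (auto simp: KL_function_def)
  then obtain xs where xs: "x \<longlonglongrightarrow> xs"
      and tail: "\<And>t. norm (x t - xs) \<le> (\<Sum>i. norm (x (Suc (i + t)) - x (i + t)))"
    using convergent_of_summable_steps[of x] unfolding d_def by blast
  have tail: "norm (x t - xs) \<le> D.tail t" for t using tail[of t] by (simp add: D.tail_def d_def)
  have exponent: "KL_exponent_at ?F p \<theta>" if "KL_function_with_exponent ?F \<theta>" "cluster_point z p" for \<theta> p
    using that dom by (auto simp: KL_function_with_exponent_def)
  show ?thesis
  proof (intro exI[of _ xs] conjI impI ballI)
    show "x \<longlonglongrightarrow> xs" by (rule xs)
    show "clarke_critical_point q xs" by (rule limit_clarke_critical[OF xs])
    show "stationary_point q xs" if "regular_fun_at q xs"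
      by (rule limit_stationary[OF xs P2_convex that])
  next
    fix \<theta> :: real assume KL\<theta>: "KL_function_with_exponent ?F \<theta>"
    {
      assume "\<theta> = 0"
      then obtain T where T: "\<forall>t>T. d t = 0" using D.finite_termination exponent KL\<theta> by blast
      have "x t = xs" if "Suc T \<le> t" for t
        using tail[of t] D.eventually_stationary_tail[OF T, of t] that by simp
      then show "\<exists>T. \<forall>t\<ge>T. x t = xs" by blast
    next
      assume "\<theta> \<in> {0<..1/2}"
      then obtain c Q T where "c > 0" "Q \<in> {0<..<1}" "\<forall>t>T. D.tail t \<le> c * Q ^ t"
        using D.linear_rate exponent KL\<theta> by blast
      then show "\<exists>c0 Q1 T. c0 > 0 \<and> Q1 \<in> {0<..<1} \<and> (\<forall>t>T. norm (x t - xs) \<le> c0 * Q1 ^ t)"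
        using tail order_trans by blast
    next
      assume "\<theta> \<in> {1/2<..<1}"
      then obtain c T where "c > 0" "\<forall>t>T. D.tail t \<le> c * real t powr (- ((1 - \<theta>) / (2 * \<theta> - 1)))"
        using D.power_rate exponent KL\<theta> by blast
      then show "\<exists>c0 T. c0 > 0 \<and> (\<forall>t>T. norm (x t - xs) \<le> c0 * real t powr (- ((1 - \<theta>) / (2 * \<theta> - 1))))"
        using tail order_trans by blast
    }
  qed
qed

end
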